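(* Let $(\mathcal{O},\mu,e)$ be an operad with multiplication over a field $\mathbb{K}$ of characteristic $0$ and $\mathcal{N}$ a cyclic unital opposite $\mathcal{O}$-module. Assume there is a cycle $\zeta\in\mathcal{N}(d)$ (i.e. $b\zeta=0$) such that the map $\mathcal{O}\to\mathcal{N}$, $\varphi\mapsto i_\varphi\zeta=(\mu\circ_2\varphi)\bullet_0\zeta$, induces isomorphisms $H^{d-p}(\mathcal{O})\cong H_p(\mathcal{N})$ for all $p$. Then the negative cyclic homology $HC^-_\bullet(\mathcal{N})$ carries a degree $(1-d)$ Lie bracket $$[\cdot,\cdot]\colon HC^-_p(\mathcal{N})\otimes HC^-_q(\mathcal{N})\to HC^-_{p+q+1-d}(\mathcal{N}),\qquad [z,w]=(-1)^{z+d}\,\beta\big((\pi z)\smile(\pi w)\big),$$ where $\pi\colon HC^-_p(\mathcal{N})\to H_p(\mathcal{N})$ and $\beta\colon H_p(\mathcal{N})\to HC^-_{p+1}(\mathcal{N})$ are the maps in Connes' long exact sequence in negative cyclic homology, and $\smile\colon H_p(\mathcal{N})\otimes H_q(\mathcal{N})\to H_{p+q-d}(\mathcal{N})$ is induced from the cup product on $H^\bullet(\mathcal{O})$ via the duality isomorphism.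
   Context: Operads. A (non-$\Sigma$, unital) operad is a sequence $\{\mathcal{O}(n)\}_{n\ge0}$ of $\mathbb{K}$-modules with bilinear $\circ_i\colon\mathcal{O}(p)\otimes\mathcal{O}(q)\to\mathcal{O}(p+q-1)$, $1\le i\le p$ (zero if $i>p$ or $p=0$), such that for $\varphi\in\mathcal{O}(p),\psi\in\mathcal{O}(q),\chi\in\mathcal{O}(r)$: $(\varphi\circ_i\psi)\circ_j\chi$ equals $(\varphi\circ_j\chi)\circ_{i+r-1}\psi$ if $j<i$; $\varphi\circ_i(\psi\circ_{j-i+1}\chi)$ if $i\le j<q+i$; $(\varphi\circ_{j-q+1}\chi)\circ_i\psi$ if $j\ge q+i$; and with $\mathbb{1}\in\mathcal{O}(1)$, $\varphi\circ_i\mathbb{1}=\mathbb{1}\circ_1\varphi=\varphi$. With multiplication: $\mu\in\mathcal{O}(2)$, $e\in\mathcal{O}(0)$, $\mu\circ_1\mu=\mu\circ_2\mu$, $\mu\circ_1e=\mu\circ_2e=\mathbb{1}$. The differential is $\delta\varphi=\mu\circ_1\varphi+\sum_{i=1}^p(-1)^i\varphi\circ_{p-i+1}\mu+(-1)^{p+1}\mu\circ_2\varphi$ for $\varphi\in\mathcal{O}(p)$, $H^\bullet(\mathcal{O})=H(\mathcal{O},\delta)$ (zero in negative degrees), and the cup product is $\psi\smile\varphi=(\mu\circ_2\psi)\circ_1\varphi$. Cyclic unital opposite module. A sequence $\{\mathcal{N}(n)\}_{n\ge0}$ of $\mathbb{K}$-modules with linear maps $\bullet_i\colon\mathcal{O}(p)\otimes\mathcal{N}(n)\to\mathcal{N}(n-p+1)$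 for $0\le i\le n-p+1$ (where $\bullet_i$, $i\ge1$, is declared zero if $p>n$, and $\bullet_0$ is defined for $p\le n+1$ and zero for $p>n+1$) satisfying, for $\varphi\in\mathcal{O}(p)$, $\psi\in\mathcal{O}(q)$: if $p>0$, $\varphi\bullet_i(\psi\bullet_jx)$ equals $\psi\bullet_j(\varphi\bullet_{i+q-1}x)$ if $j<i$; $(\varphi\circ_{j-i+1}\psi)\bullet_ix$ if $j-p<i\le j$; $\psi\bullet_{j-p+1}(\varphi\bullet_ix)$ if $0\le i\le j-p$; if $p=0$, it equals $\psi\bullet_j(\varphi\bullet_{i+q-1}x)$ if $j<i$, and $\psi\bullet_{j+1}(\varphi\bullet_ix)$ if $0\le i\le j$; $\mathbb{1}\bullet_ix=x$ for $0\le i\le n$; together with linear $t\colon\mathcal{N}(n)\to\mathcal{N}(n)$ with $t(\varphi\bullet_ix)=\varphi\bullet_{i+1}t(x)$ for $0\le i\le n-p$ and $t^{n+1}=\mathrm{id}$ on $\mathcal{N}(n)$. $\mathcal{N}$ is a cyclic $\mathbb{K}$-module with faces $d_i(x)=\mu\bullet_ix$ ($0\le i\le n-1$), $d_n(x)=\mu\bullet_0t(x)$, degeneracies $s_j(x)=e\bullet_{j+1}x$ ($0\le j\le n$) and cyclic operator $t$; $b=\sum_{i=0}^n(-1)^id_i$, $B=(\mathrm{id}-t)s_{-1}N$ with $s_{-1}(x)=e\bullet_0x$, $N=\sum_{i=0}^n(-1)^{in}t^i$. $H_\bullet(\mathcal{N})$ is the $b$-homology. $HC^-_\bullet$: set $M^i=\mathcal{N}(-i)$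 (zero for $i>0$); with $u$ of degree $2$ and $d_u=b+uB$ on $M[[u]]$, $M[[u]]^n=\prod_{i+2j=n,\,j\ge0}M^iu^j$, put $HC^-_{-n}(\mathcal{N})=H^n(M[[u]],d_u)$. The sequence $0\to M[[u]][-2]\xrightarrow{u}M[[u]]\xrightarrow{u=0}M\to0$ yields $\cdots\to HC^-_{n+2}\to HC^-_n\xrightarrow{\pi}H_n\xrightarrow{\beta}HC^-_{n+1}\to\cdots$, with $\beta[x]=[Bx]$. In the sign, $z$ denotes the homological degree of $z$. "Degree $(1-d)$ Lie bracket" means a graded Lie bracket (graded antisymmetry and Jacobi) when $HC^-_p(\mathcal{N})$ is placed in degree $d-1-p$.
   Formalization: Connes' operator is taken as B = (id − (−1)^{n+1} t) s_{-1} N on N(n), with the signed cyclic operator, instead of (id − t) s_{-1} N; with the unsigned t, bB + Bb is not zero on the unnormalised complex, so negative cyclic homology would be undefined. *)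

theory Defs
  imports Complex_Main "HOL-Library.Function_Algebras"
begin

section \<open>Subquotients of vector spaces and graded Lie brackets\<close>

text \<open>
  A sequence of vector spaces over a field is a sequence of subspaces of one ambient vector space.
  The subspaces need not be independent: every operation below takes the degrees of its
  arguments as parameters, so an element lying in several of them causes no ambiguity.
  Nothing is required of an operation outside the stated carriers and index ranges.
\<close>

definition linear_on ::
  "('k \<Rightarrow> 'a::ab_group_add \<Rightarrow> 'a) \<Rightarrow> ('k \<Rightarrow> 'b::ab_group_add \<Rightarrow> 'b) \<Rightarrow> 'a set \<Rightarrow> 'b set \<Rightarrow> ('a \<Rightarrow> 'b) \<Rightarrow> bool"
  where "linear_on sA sB A B f \<longleftrightarrow>
    (\<forall>x\<in>A. f x \<in> B) \<and>
    (\<forall>x\<in>A. \<forall>x'\<in>A. f (x + x') = f x + f x') \<and>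
    (\<forall>c. \<forall>x\<in>A. f (sA c x) = sB c (f x))"

definition bilinear_on ::
  "('k \<Rightarrow> 'a::ab_group_add \<Rightarrow> 'a) \<Rightarrow> ('k \<Rightarrow> 'b::ab_group_add \<Rightarrow> 'b) \<Rightarrow> ('k \<Rightarrow> 'c::ab_group_add \<Rightarrow> 'c) \<Rightarrow>
    'a set \<Rightarrow> 'b set \<Rightarrow> 'c set \<Rightarrow> ('a \<Rightarrow> 'b \<Rightarrow> 'c) \<Rightarrow> bool"
  where "bilinear_on sA sB sC A B C f \<longleftrightarrow>
    (\<forall>x\<in>A. linear_on sB sC B C (f x)) \<and> (\<forall>y\<in>B. linear_on sA sC A C (\<lambda>x. f x y))"

definition coset :: "'a::ab_group_add set \<Rightarrow> 'a \<Rightarrow> 'a set"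
  where "coset S x = (\<lambda>s. x + s) ` S"

text \<open>
  The maps induced on classes are unions over all representatives.  Hence a value is
  a single class of \<^term>\<open>S\<close> exactly if it does not depend on the representatives, and
  membership of the value in a quotient includes well-definedness.
\<close>

definition induced :: "'b::ab_group_add set \<Rightarrow> ('a \<Rightarrow> 'b) \<Rightarrow> 'a set \<Rightarrow> 'b set"
  where "induced S f X = (\<Union>x\<in>X. coset S (f x))"

definition induced2 :: "'c::ab_group_add set \<Rightarrow> ('a \<Rightarrow> 'b \<Rightarrow> 'c) \<Rightarrow> 'a set \<Rightarrow> 'b set \<Rightarrow> 'c set"
  where "induced2 S f X Y = (\<Union>x\<in>X. \<Union>y\<in>Y. coset S (f x y))"

definition cycles :: "(int \<Rightarrow> 'a::ab_group_add set) \<Rightarrow> (int \<Rightarrow> 'a \<Rightarrow> 'a) \<Rightarrow> int \<Rightarrow> 'a set"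
  where "cycles C D k = {x \<in> C k. D k x = 0}"

text \<open>The parameter \<^term>\<open>r\<close> is the degree of the differential: \<^term>\<open>D k\<close> maps \<^term>\<open>C k\<close> to \<^term>\<open>C (k + r)\<close>.\<close>

definition boundaries :: "int \<Rightarrow> (int \<Rightarrow> 'a::ab_group_add set) \<Rightarrow> (int \<Rightarrow> 'a \<Rightarrow> 'a) \<Rightarrow> int \<Rightarrow> 'a set"
  where "boundaries r C D k = D (k - r) ` C (k - r)"

definition homology :: "int \<Rightarrow> (int \<Rightarrow> 'a::ab_group_add set) \<Rightarrow> (int \<Rightarrow> 'a \<Rightarrow> 'a) \<Rightarrow> int \<Rightarrow> 'a set set"
  where "homology r C D k = coset (boundaries r C D k) ` cycles C D k"

definition zero_ext_space :: "(nat \<Rightarrow> 'a::ab_group_add set) \<Rightarrow> int \<Rightarrow> 'a set"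
  where "zero_ext_space C k = (if 0 \<le> k then C (nat k) else {0})"

definition zero_ext_map :: "(nat \<Rightarrow> 'a \<Rightarrow> 'b::ab_group_add) \<Rightarrow> int \<Rightarrow> 'a \<Rightarrow> 'b"
  where "zero_ext_map f k x = (if 0 \<le> k then f (nat k) x else 0)"

text \<open>
  A graded Lie bracket (of degree 0) on a \<open>\<int>\<close>-graded vector space with components \<^term>\<open>V m\<close>, whose addition
  and scalar multiplication are \<^term>\<open>add m\<close> and \<^term>\<open>sc m\<close>; \<^term>\<open>br m n\<close> is the bracket on \<open>V m \<times> V n\<close>.
\<close>

definition graded_Lie_bracket ::
  "(int \<Rightarrow> 'v set) \<Rightarrow> (int \<Rightarrow> 'v \<Rightarrow> 'v \<Rightarrow> 'v) \<Rightarrow> (int \<Rightarrow> 'k::field \<Rightarrow> 'v \<Rightarrow> 'v) \<Rightarrow>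
    (int \<Rightarrow> int \<Rightarrow> 'v \<Rightarrow> 'v \<Rightarrow> 'v) \<Rightarrow> bool"
  where "graded_Lie_bracket V add sc br \<longleftrightarrow>
    (\<forall>m n. \<forall>x\<in>V m. \<forall>y\<in>V n. br m n x y \<in> V (m + n)) \<and>
    (\<forall>m n. \<forall>x\<in>V m. \<forall>x'\<in>V m. \<forall>y\<in>V n.
       br m n (add m x x') y = add (m + n) (br m n x y) (br m n x' y)) \<and>
    (\<forall>m n. \<forall>x\<in>V m. \<forall>y\<in>V n. \<forall>y'\<in>V n.
       br m n x (add n y y') = add (m + n) (br m n x y) (br m n x y')) \<and>
    (\<forall>m n c. \<forall>x\<in>V m. \<forall>y\<in>V n.
       br m n (sc m c x) y = sc (m + n) c (br m n x y) \<and>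
       br m n x (sc n c y) = sc (m + n) c (br m n x y)) \<and>
    (\<forall>m n. \<forall>x\<in>V m. \<forall>y\<in>V n.
       br m n x y = sc (m + n) (- ((-1) powi (m * n))) (br n m y x)) \<and>
    (\<forall>m n k. \<forall>x\<in>V m. \<forall>y\<in>V n. \<forall>z\<in>V k.
       br m (n + k) x (br n k y z) =
         add (m + n + k) (br (m + n) k (br m n x y) z)
           (sc (m + n + k) ((-1) powi (m * n)) (br n (m + k) y (br m k x z))))"


section \<open>Operads with multiplication\<close>

text \<open>\<^term>\<open>ocomp P p q i \<phi> \<psi>\<close> is \<open>\<phi> \<circ>\<^sub>i \<psi>\<close> for \<open>\<phi>\<close> of arity \<open>p\<close> and \<open>\<psi>\<close> of arity \<open>q\<close>.\<close>

record ('k, 'o) operad =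
  ospace :: "nat \<Rightarrow> 'o set"
  oscale :: "'k \<Rightarrow> 'o \<Rightarrow> 'o"
  ocomp :: "nat \<Rightarrow> nat \<Rightarrow> nat \<Rightarrow> 'o \<Rightarrow> 'o \<Rightarrow> 'o"
  ounit :: "'o"

record ('k, 'o) operad_mult = "('k, 'o) operad" +
  omult :: "'o"
  opoint :: "'o"

locale operad =
  fixes P :: "('k::field, 'o::ab_group_add, 'z) operad_scheme"
  assumes oscale_vector_space: "vector_space (oscale P)"
    and ospace_subspace: "module.subspace (oscale P) (ospace P n)"
    and ocomp_bilinear: "1 \<le> i \<Longrightarrow> i \<le> p \<Longrightarrow>
      bilinear_on (oscale P) (oscale P) (oscale P)
        (ospace P p) (ospace P q) (ospace P (p + q - 1)) (ocomp P p q i)"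
    and ocomp_assoc_left:
      "\<phi> \<in> ospace P p \<Longrightarrow> \<psi> \<in> ospace P q \<Longrightarrow> \<chi> \<in> ospace P r \<Longrightarrow> i \<le> p \<Longrightarrow> 1 \<le> j \<Longrightarrow> j < i \<Longrightarrow>
        ocomp P (p + q - 1) r j (ocomp P p q i \<phi> \<psi>) \<chi> =
        ocomp P (p + r - 1) q (i + r - 1) (ocomp P p r j \<phi> \<chi>) \<psi>"
    and ocomp_assoc_mid:
      "\<phi> \<in> ospace P p \<Longrightarrow> \<psi> \<in> ospace P q \<Longrightarrow> \<chi> \<in> ospace P r \<Longrightarrow> 1 \<le> i \<Longrightarrow> i \<le> p \<Longrightarrow> i \<le> j \<Longrightarrow> j < q + i \<Longrightarrow>
        ocomp P (p + q - 1) r j (ocomp P p q i \<phi> \<psi>) \<chi> =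
        ocomp P p (q + r - 1) i \<phi> (ocomp P q r (j - i + 1) \<psi> \<chi>)"
    and ocomp_assoc_right:
      "\<phi> \<in> ospace P p \<Longrightarrow> \<psi> \<in> ospace P q \<Longrightarrow> \<chi> \<in> ospace P r \<Longrightarrow>
        1 \<le> i \<Longrightarrow> i \<le> p \<Longrightarrow> q + i \<le> j \<Longrightarrow> j \<le> p + q - 1 \<Longrightarrow>
        ocomp P (p + q - 1) r j (ocomp P p q i \<phi> \<psi>) \<chi> =
        ocomp P (p + r - 1) q i (ocomp P p r (j - q + 1) \<phi> \<chi>) \<psi>"
    and ounit_in: "ounit P \<in> ospace P 1"
    and ocomp_unit_right: "\<phi> \<in> ospace P p \<Longrightarrow> 1 \<le> i \<Longrightarrow> i \<le> p \<Longrightarrow> ocomp P p 1 i \<phi> (ounit P) = \<phi>"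
    and ocomp_unit_left: "\<phi> \<in> ospace P p \<Longrightarrow> ocomp P 1 p 1 (ounit P) \<phi> = \<phi>"

locale operad_with_multiplication = operad P
  for P :: "('k::field, 'o::ab_group_add, 'z) operad_mult_scheme" +
  assumes omult_in: "omult P \<in> ospace P 2"
    and opoint_in: "opoint P \<in> ospace P 0"
    and omult_assoc: "ocomp P 2 2 1 (omult P) (omult P) = ocomp P 2 2 2 (omult P) (omult P)"
    and omult_opoint_left: "ocomp P 2 0 1 (omult P) (opoint P) = ounit P"
    and omult_opoint_right: "ocomp P 2 0 2 (omult P) (opoint P) = ounit P"

definition odelta :: "('k::field, 'o::ab_group_add, 'z) operad_mult_scheme \<Rightarrow> nat \<Rightarrow> 'o \<Rightarrow> 'o"
  where "odelta P p \<phi> =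
    ocomp P 2 p 1 (omult P) \<phi>
    + (\<Sum>i=1..p. oscale P ((-1) ^ i) (ocomp P p 2 (p - i + 1) \<phi> (omult P)))
    + oscale P ((-1) ^ (p + 1)) (ocomp P 2 p 2 (omult P) \<phi>)"

abbreviation ocoboundaries :: "('k::field, 'o::ab_group_add, 'z) operad_mult_scheme \<Rightarrow> int \<Rightarrow> 'o set"
  where "ocoboundaries P \<equiv> boundaries 1 (zero_ext_space (ospace P)) (zero_ext_map (odelta P))"

definition ocohomology :: "('k::field, 'o::ab_group_add, 'z) operad_mult_scheme \<Rightarrow> int \<Rightarrow> 'o set set"
  where "ocohomology P = homology 1 (zero_ext_space (ospace P)) (zero_ext_map (odelta P))"

definition ocup :: "('k::field, 'o::ab_group_add, 'z) operad_mult_scheme \<Rightarrow> nat \<Rightarrow> nat \<Rightarrow> 'o \<Rightarrow> 'o \<Rightarrow> 'o"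
  where "ocup P p q \<psi> \<phi> = ocomp P (p + 1) q 1 (ocomp P 2 p 2 (omult P) \<psi>) \<phi>"

definition ocohomology_cup ::
  "('k::field, 'o::ab_group_add, 'z) operad_mult_scheme \<Rightarrow> int \<Rightarrow> int \<Rightarrow> 'o set \<Rightarrow> 'o set \<Rightarrow> 'o set"
  where "ocohomology_cup P k l =
    induced2 (ocoboundaries P (k + l))
      (\<lambda>\<psi> \<phi>. if 0 \<le> k \<and> 0 \<le> l then ocup P (nat k) (nat l) \<psi> \<phi> else 0)"


section \<open>Cyclic unital opposite modules\<close>

text \<open>
  \<^term>\<open>act M p n i \<phi> x\<close> is \<open>\<phi> \<bullet>\<^sub>i x\<close> for \<open>\<phi>\<close> of arity \<open>p\<close> and \<open>x\<close> of degree \<open>n\<close>, and \<^term>\<open>cyc M n\<close> is the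
  cyclic operator in degree \<open>n\<close>.
\<close>

record ('k, 'o, 'n) opmod =
  nspace :: "nat \<Rightarrow> 'n set"
  nscale :: "'k \<Rightarrow> 'n \<Rightarrow> 'n"
  act :: "nat \<Rightarrow> nat \<Rightarrow> nat \<Rightarrow> 'o \<Rightarrow> 'n \<Rightarrow> 'n"
  cyc :: "nat \<Rightarrow> 'n \<Rightarrow> 'n"

text \<open>
  The action \<open>\<bullet>\<^sub>i\<close> maps degree \<open>n\<close> to degree \<open>n - p + 1\<close> and is defined for \<open>0 \<le> i \<le> n - p + 1\<close>,
  that is, \<open>i + p \<le> n + 1\<close>; this includes the case \<open>p = n + 1\<close>, \<open>i = 0\<close>.
  The associativity laws cover arity \<open>p = 0\<close> as well as \<open>p > 0\<close>: for \<open>p = 0\<close> the middle law is void,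
  and in the third one \<open>j - p + 1\<close> is \<open>j + 1\<close>.
\<close>

locale cyclic_opposite_module = operad P
  for P :: "('k::field, 'o::ab_group_add, 'z) operad_scheme" +
  fixes M :: "('k, 'o, 'n::ab_group_add, 'y) opmod_scheme"
  assumes nscale_vector_space: "vector_space (nscale M)"
    and nspace_subspace: "module.subspace (nscale M) (nspace M n)"
    and act_bilinear: "i + p \<le> n + 1 \<Longrightarrow>
      bilinear_on (oscale P) (nscale M) (nscale M)
        (ospace P p) (nspace M n) (nspace M (n + 1 - p)) (act M p n i)"
    and act_assoc_left:
      "\<phi> \<in> ospace P p \<Longrightarrow> \<psi> \<in> ospace P q \<Longrightarrow> x \<in> nspace M n \<Longrightarrow>
        j + q \<le> n + 1 \<Longrightarrow> i + p + q \<le> n + 2 \<Longrightarrow> j < i \<Longrightarrow>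
        act M p (n + 1 - q) i \<phi> (act M q n j \<psi> x) =
        act M q (n + 1 - p) j \<psi> (act M p n (i + q - 1) \<phi> x)"
    and act_assoc_mid:
      "\<phi> \<in> ospace P p \<Longrightarrow> \<psi> \<in> ospace P q \<Longrightarrow> x \<in> nspace M n \<Longrightarrow>
        j + q \<le> n + 1 \<Longrightarrow> i + p + q \<le> n + 2 \<Longrightarrow> i \<le> j \<Longrightarrow> j < i + p \<Longrightarrow>
        act M p (n + 1 - q) i \<phi> (act M q n j \<psi> x) =
        act M (p + q - 1) n i (ocomp P p q (j - i + 1) \<phi> \<psi>) x"
    and act_assoc_right:
      "\<phi> \<in> ospace P p \<Longrightarrow> \<psi> \<in> ospace P q \<Longrightarrow> x \<in> nspace M n \<Longrightarrow>
        j + q \<le> n + 1 \<Longrightarrow> i + p \<le> j \<Longrightarrow>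
        act M p (n + 1 - q) i \<phi> (act M q n j \<psi> x) =
        act M q (n + 1 - p) (j - p + 1) \<psi> (act M p n i \<phi> x)"
    and act_unit: "x \<in> nspace M n \<Longrightarrow> i \<le> n \<Longrightarrow> act M 1 n i (ounit P) x = x"
    and cyc_linear: "linear_on (nscale M) (nscale M) (nspace M n) (nspace M n) (cyc M n)"
    and cyc_act: "\<phi> \<in> ospace P p \<Longrightarrow> x \<in> nspace M n \<Longrightarrow> i + p \<le> n \<Longrightarrow>
      cyc M (n + 1 - p) (act M p n i \<phi> x) = act M p n (i + 1) \<phi> (cyc M n x)"
    and cyc_power: "x \<in> nspace M n \<Longrightarrow> (cyc M n ^^ (n + 1)) x = x"

definition face ::
  "('k::field, 'o, 'z) operad_mult_scheme \<Rightarrow> ('k, 'o, 'n, 'y) opmod_scheme \<Rightarrow> nat \<Rightarrow> nat \<Rightarrow> 'n \<Rightarrow> 'n"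
  where "face P M n i x =
    (if i < n then act M 2 n i (omult P) x else act M 2 n 0 (omult P) (cyc M n x))"

definition bdiff ::
  "('k::field, 'o, 'z) operad_mult_scheme \<Rightarrow> ('k, 'o, 'n::ab_group_add, 'y) opmod_scheme \<Rightarrow> nat \<Rightarrow> 'n \<Rightarrow> 'n"
  where "bdiff P M n x =
    (if n = 0 then 0 else (\<Sum>i\<le>n. nscale M ((-1) ^ i) (face P M n i x)))"

definition cyc_norm :: "('k::field, 'o, 'n::ab_group_add, 'y) opmod_scheme \<Rightarrow> nat \<Rightarrow> 'n \<Rightarrow> 'n"
  where "cyc_norm M n x = (\<Sum>i\<le>n. nscale M ((-1) ^ (i * n)) ((cyc M n ^^ i) x))"

definition extra_degeneracy ::
  "('k::field, 'o, 'z) operad_mult_scheme \<Rightarrow> ('k, 'o, 'n, 'y) opmod_scheme \<Rightarrow> nat \<Rightarrow> 'n \<Rightarrow> 'n"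
  where "extra_degeneracy P M n x = act M 0 n 0 (opoint P) x"

text \<open>
  Connes' operator \<open>B = (id - t) s\<^sub>-\<^sub>1 N\<close>, where, as in the norm operator \<open>N\<close>, the cyclic operator
  carries its sign: \<open>t\<close> stands for \<open>(-1)\<^sup>m t\<close> in degree \<open>m\<close>, here \<open>m = n + 1\<close>.  Without this sign,
  \<open>b B + B b\<close> would not vanish on the unnormalised complex.
\<close>

definition Connes_B ::
  "('k::field, 'o, 'z) operad_mult_scheme \<Rightarrow> ('k, 'o, 'n::ab_group_add, 'y) opmod_scheme \<Rightarrow> nat \<Rightarrow> 'n \<Rightarrow> 'n"
  where "Connes_B P M n x =
    (let y = extra_degeneracy P M n (cyc_norm M n x)
     in y - nscale M ((-1) ^ (n + 1)) (cyc M (n + 1) y))"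

abbreviation nboundaries ::
  "('k::field, 'o, 'z) operad_mult_scheme \<Rightarrow> ('k, 'o, 'n::ab_group_add, 'y) opmod_scheme \<Rightarrow> int \<Rightarrow> 'n set"
  where "nboundaries P M \<equiv> boundaries (-1) (zero_ext_space (nspace M)) (zero_ext_map (bdiff P M))"

definition nhomology ::
  "('k::field, 'o, 'z) operad_mult_scheme \<Rightarrow> ('k, 'o, 'n::ab_group_add, 'y) opmod_scheme \<Rightarrow> int \<Rightarrow> 'n set set"
  where "nhomology P M = homology (-1) (zero_ext_space (nspace M)) (zero_ext_map (bdiff P M))"


section \<open>Negative cyclic homology\<close>

text \<open>
  A power series \<open>\<Sum>\<^sub>j x\<^sub>j u\<^sup>j\<close> is the sequence of its coefficients.  The homological degree \<open>p\<close>
  is minus the cohomological degree, so that \<open>x\<^sub>j\<close> has degree \<open>p + 2 j\<close>.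
\<close>

definition nc_space :: "('k, 'o, 'n::ab_group_add, 'y) opmod_scheme \<Rightarrow> int \<Rightarrow> (nat \<Rightarrow> 'n) set"
  where "nc_space M p = {x. \<forall>j. x j \<in> zero_ext_space (nspace M) (p + 2 * int j)}"

definition nc_scale :: "('k, 'o, 'n, 'y) opmod_scheme \<Rightarrow> 'k \<Rightarrow> (nat \<Rightarrow> 'n) \<Rightarrow> (nat \<Rightarrow> 'n)"
  where "nc_scale M c x = (\<lambda>j. nscale M c (x j))"

definition nc_diff ::
  "('k::field, 'o, 'z) operad_mult_scheme \<Rightarrow> ('k, 'o, 'n::ab_group_add, 'y) opmod_scheme \<Rightarrow>
    int \<Rightarrow> (nat \<Rightarrow> 'n) \<Rightarrow> (nat \<Rightarrow> 'n)"
  where "nc_diff P M p x = (\<lambda>j.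
    zero_ext_map (bdiff P M) (p + 2 * int j) (x j)
    + (case j of 0 \<Rightarrow> 0 | Suc i \<Rightarrow> zero_ext_map (Connes_B P M) (p + 2 * int i) (x i)))"

abbreviation nc_boundaries ::
  "('k::field, 'o, 'z) operad_mult_scheme \<Rightarrow> ('k, 'o, 'n::ab_group_add, 'y) opmod_scheme \<Rightarrow>
    int \<Rightarrow> (nat \<Rightarrow> 'n) set"
  where "nc_boundaries P M \<equiv> boundaries (-1) (nc_space M) (nc_diff P M)"

definition nc_homology ::
  "('k::field, 'o, 'z) operad_mult_scheme \<Rightarrow> ('k, 'o, 'n::ab_group_add, 'y) opmod_scheme \<Rightarrow>
    int \<Rightarrow> (nat \<Rightarrow> 'n) set set"
  where "nc_homology P M = homology (-1) (nc_space M) (nc_diff P M)"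

definition nc_homology_add ::
  "('k::field, 'o, 'z) operad_mult_scheme \<Rightarrow> ('k, 'o, 'n::ab_group_add, 'y) opmod_scheme \<Rightarrow>
    int \<Rightarrow> (nat \<Rightarrow> 'n) set \<Rightarrow> (nat \<Rightarrow> 'n) set \<Rightarrow> (nat \<Rightarrow> 'n) set"
  where "nc_homology_add P M p = induced2 (nc_boundaries P M p) (+)"

definition nc_homology_scale ::
  "('k::field, 'o, 'z) operad_mult_scheme \<Rightarrow> ('k, 'o, 'n::ab_group_add, 'y) opmod_scheme \<Rightarrow>
    int \<Rightarrow> 'k \<Rightarrow> (nat \<Rightarrow> 'n) set \<Rightarrow> (nat \<Rightarrow> 'n) set"
  where "nc_homology_scale P M p c = induced (nc_boundaries P M p) (nc_scale M c)"

text \<open>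
  The maps \<open>\<pi> : HC\<^sup>-\<^sub>p \<rightarrow> H\<^sub>p\<close>, induced by \<open>u = 0\<close>, and \<open>\<beta> : H\<^sub>p \<rightarrow> HC\<^sup>-\<^sub>p\<^sub>+\<^sub>1\<close>, \<open>\<beta>[x] = [B x]\<close>,
  of the long exact sequence.
\<close>

definition Connes_pi ::
  "('k::field, 'o, 'z) operad_mult_scheme \<Rightarrow> ('k, 'o, 'n::ab_group_add, 'y) opmod_scheme \<Rightarrow>
    int \<Rightarrow> (nat \<Rightarrow> 'n) set \<Rightarrow> 'n set"
  where "Connes_pi P M p = induced (nboundaries P M p) (\<lambda>x. x 0)"

definition Connes_beta ::
  "('k::field, 'o, 'z) operad_mult_scheme \<Rightarrow> ('k, 'o, 'n::ab_group_add, 'y) opmod_scheme \<Rightarrow>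
    int \<Rightarrow> 'n set \<Rightarrow> (nat \<Rightarrow> 'n) set"
  where "Connes_beta P M p = induced (nc_boundaries P M (p + 1))
    (\<lambda>x j. if j = 0 then zero_ext_map (Connes_B P M) p x else 0)"


section \<open>Duality and the bracket\<close>

text \<open>\<open>i\<^sub>\<phi> \<zeta> = (\<mu> \<circ>\<^sub>2 \<phi>) \<bullet>\<^sub>0 \<zeta>\<close> for \<open>\<phi>\<close> of degree \<open>m\<close> and \<open>\<zeta>\<close> of degree \<open>d\<close>.\<close>

definition cap ::
  "('k::field, 'o, 'z) operad_mult_scheme \<Rightarrow> ('k, 'o, 'n::ab_group_add, 'y) opmod_scheme \<Rightarrow>
    nat \<Rightarrow> 'n \<Rightarrow> int \<Rightarrow> 'o \<Rightarrow> 'n"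
  where "cap P M d \<zeta> m \<phi> =
    (if 0 \<le> m \<and> m \<le> int d
     then act M (nat m + 1) d 0 (ocomp P 2 (nat m) 2 (omult P) \<phi>) \<zeta> else 0)"

text \<open>The map \<open>H\<^sup>d\<^sup>-\<^sup>p(\<O>) \<rightarrow> H\<^sub>p(\<N>)\<close>.\<close>

definition duality ::
  "('k::field, 'o, 'z) operad_mult_scheme \<Rightarrow> ('k, 'o, 'n::ab_group_add, 'y) opmod_scheme \<Rightarrow>
    nat \<Rightarrow> 'n \<Rightarrow> int \<Rightarrow> 'o set \<Rightarrow> 'n set"
  where "duality P M d \<zeta> p = induced (nboundaries P M p) (cap P M d \<zeta> (int d - p))"

definition nhomology_cup ::
  "('k::field, 'o::ab_group_add, 'z) operad_mult_scheme \<Rightarrow> ('k, 'o, 'n::ab_group_add, 'y) opmod_scheme \<Rightarrow>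
    nat \<Rightarrow> 'n \<Rightarrow> int \<Rightarrow> int \<Rightarrow> 'n set \<Rightarrow> 'n set \<Rightarrow> 'n set"
  where "nhomology_cup P M d \<zeta> p q X Y =
    duality P M d \<zeta> (p + q - int d)
      (ocohomology_cup P (int d - p) (int d - q)
        (inv_into (ocohomology P (int d - p)) (duality P M d \<zeta> p) X)
        (inv_into (ocohomology P (int d - q)) (duality P M d \<zeta> q) Y))"

definition nc_bracket ::
  "('k::field, 'o::ab_group_add, 'z) operad_mult_scheme \<Rightarrow> ('k, 'o, 'n::ab_group_add, 'y) opmod_scheme \<Rightarrow>
    nat \<Rightarrow> 'n \<Rightarrow> int \<Rightarrow> int \<Rightarrow> (nat \<Rightarrow> 'n) set \<Rightarrow> (nat \<Rightarrow> 'n) set \<Rightarrow> (nat \<Rightarrow> 'n) set"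
  where "nc_bracket P M d \<zeta> p q z w =
    nc_homology_scale P M (p + q + 1 - int d) ((-1) powi (p + int d))
      (Connes_beta P M (p + q - int d)
        (nhomology_cup P M d \<zeta> p q (Connes_pi P M p z) (Connes_pi P M q w)))"

end

theory Submission
  imports Defs
begin

text \<open>
  Transport Connes' operator \<open>B\<close> along the duality \<open>\<phi> \<mapsto> i\<^sub>\<phi>\<zeta>\<close>.  The cup product on \<open>H(\<N>)\<close> becomes
  \<open>[i\<^sub>\<phi>\<zeta>] \<smile> [y] = [i\<^sub>\<phi> y]\<close>, and \<open>B\<zeta>\<close> is a boundary because \<open>H\<^sub>d\<^sub>+\<^sub>1(\<N>) \<cong> H\<^sup>-\<^sup>1(\<O>) = 0\<close>.
  The Cartan formulas say that on homology \<open>L\<^sub>\<phi> = [B, i\<^sub>\<phi>]\<close> and \<open>[L\<^sub>\<phi>, i\<^sub>\<psi>]\<close> is the cap product with a cocycle,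
  so together with the graded commutativity of the cup product they make \<open>B\<close> a second order operator
  (the seven-term relation).  Since \<open>B = \<pi>\<beta>\<close>, \<open>\<beta>\<pi> = 0\<close> and \<open>\<beta>B = 0\<close>, the relation turns
  into the Jacobi identity of \<open>\<beta>(\<pi>z \<smile> \<pi>w)\<close>.  No normalisation is needed: \<open>t s\<^sub>-\<^sub>1 N\<close> is null-homotopic, so
  \<open>B\<close> may be replaced by \<open>s\<^sub>-\<^sub>1 N\<close> in the homotopies.
\<close>

section \<open>Signs, sums and cosets\<close>

definition sg :: "int \<Rightarrow> 'a::ab_group_add \<Rightarrow> 'a"
  where "sg k x = (if even k then x else - x)"

lemma sg_zero [simp]: "sg k 0 = 0"
  by (simp add: sg_def)

lemma sg_0 [simp]: "sg 0 x = x"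
  by (simp add: sg_def)

lemma sg_even [simp]: "even k \<Longrightarrow> sg k x = x"
  by (simp add: sg_def)

lemma sg_sg [simp]: "sg a (sg b x) = sg (a + b) x"
  by (simp add: sg_def)

lemma sg_add: "sg k (x + y) = sg k x + sg k y"
  by (simp add: sg_def)

lemma sg_diff: "sg k (x - y) = sg k x - sg k y"
  by (simp add: sg_def)

lemma sg_minus: "sg k (- x) = - sg k x"
  by (simp add: sg_def)

lemma sg_sum: "sg k (sum f A) = (\<Sum>i\<in>A. sg k (f i))"
  by (simp add: sg_def sum_negf)

lemma sg_cong: "even (a - b) \<Longrightarrow> x = y \<Longrightarrow> sg a x = sg b y"
  by (auto simp: sg_def)

lemma (in vector_space) scale_sign: "scale ((-1) ^ k) x = sg (int k) x"
  by (induction k) (auto simp: sg_def simp flip: scale_scale)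

lemma (in vector_space) scale_sign_powi: "scale ((-1) powi k) x = sg k x"
  by (cases "even k") (auto simp: sg_def power_int_minus_left)

lemma (in vector_space) scale_sg: "scale c (sg k x) = sg k (scale c x)"
  by (auto simp: sg_def)

lemma (in module) subspace_sg: "subspace S \<Longrightarrow> x \<in> S \<Longrightarrow> sg k x \<in> S"
  by (auto simp: sg_def subspace_neg)

lemma sum_int_head: "a \<le> b \<Longrightarrow> (\<Sum>i\<in>{a..b::int}. f i) = f a + (\<Sum>i\<in>{a+1..b}. f i)"
proof -
  assume "a \<le> b"
  then have "{a..b} = insert a {a+1..b}" by auto
  then show ?thesis by simp
qed

lemma sum_int_last: "a \<le> b \<Longrightarrow> (\<Sum>i\<in>{a..b::int}. f i) = (\<Sum>i\<in>{a..b-1}. f i) + f b"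
proof -
  assume "a \<le> b"
  then have "{a..b} = insert b {a..b-1}" by auto
  then show ?thesis by (simp add: add.commute)
qed

lemma sum_int_split:
  "a \<le> c \<Longrightarrow> c \<le> b + 1 \<Longrightarrow> (\<Sum>i\<in>{a..b::int}. f i) = (\<Sum>i\<in>{a..c-1}. f i) + (\<Sum>i\<in>{c..b}. f i)"
proof -
  assume "a \<le> c" "c \<le> b + 1"
  then have "{a..b} = {a..c-1} \<union> {c..b}" by auto
  then show ?thesis by (metis (no_types, lifting) sum.union_disjoint finite_atLeastAtMost_int
        ivl_disj_int_two(8) disjoint_iff atLeastAtMost_iff zle_diff1_eq not_less)
qed

lemma sum_int_shift: "(\<Sum>i\<in>{a..b::int}. f (i + k)) = (\<Sum>i\<in>{a+k..b+k}. f i)"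
  by (rule sum.reindex_bij_witness[of _ "\<lambda>i. i - k" "\<lambda>i. i + k"]) auto

definition diff_closed :: "'a::ab_group_add set \<Rightarrow> bool"
  where "diff_closed S \<longleftrightarrow> 0 \<in> S \<and> (\<forall>a\<in>S. \<forall>b\<in>S. a - b \<in> S)"

lemma coset_mem: "y \<in> coset S x \<longleftrightarrow> y - x \<in> S"
  by (auto simp: coset_def image_iff) (metis diff_add_cancel add.commute)

lemma coset_self: "diff_closed S \<Longrightarrow> x \<in> coset S x"
  by (simp add: coset_mem diff_closed_def)

lemma coset_eq_iff:
  assumes "diff_closed S" shows "coset S x = coset S y \<longleftrightarrow> x - y \<in> S"
proof
  assume "coset S x = coset S y"
  then show "x - y \<in> S" using coset_self[OF assms, of x] coset_mem[of x S y] by simp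
next
  assume xy: "x - y \<in> S"
  have "z - x \<in> S \<longleftrightarrow> z - y \<in> S" for z
  proof
    assume "z - x \<in> S"
    moreover have "y - x \<in> S" using assms xy unfolding diff_closed_def by (metis diff_0 minus_diff_eq)
    ultimately have "(z - x) - (y - x) \<in> S" using assms unfolding diff_closed_def by blast
    moreover have "(z - x) - (y - x) = z - y" by (simp add: algebra_simps)
    ultimately show "z - y \<in> S" by simp
  next
    assume "z - y \<in> S"
    with xy have "(z - y) - (x - y) \<in> S" using assms unfolding diff_closed_def by blast
    moreover have "(z - y) - (x - y) = z - x" by (simp add: algebra_simps)
    ultimately show "z - x \<in> S" by simp
  qed
  then show "coset S x = coset S y" by (auto simp: coset_mem)
qed

lemma induced_coset:
  assumes S: "diff_closed S" and "0 \<in> T" and f: "\<And>s. s \<in> T \<Longrightarrow> f (x + s) - f x \<in> S"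
  shows "induced S f (coset T x) = coset S (f x)"
proof -
  have "coset S (f y) = coset S (f x)" if "y \<in> coset T x" for y
    using f[of "y - x"] that by (simp add: coset_eq_iff[OF S] coset_mem)
  moreover have "x \<in> coset T x" using assms by (simp add: coset_mem)
  ultimately show ?thesis unfolding induced_def by blast
qed

lemma induced2_coset:
  assumes S: "diff_closed S" and "0 \<in> T" "0 \<in> U"
    and f: "\<And>s t. s \<in> T \<Longrightarrow> t \<in> U \<Longrightarrow> f (x + s) (y + t) - f x y \<in> S"
  shows "induced2 S f (coset T x) (coset U y) = coset S (f x y)"
proof -
  have "coset S (f x' y') = coset S (f x y)" if "x' \<in> coset T x" "y' \<in> coset U y" for x' y'
    using f[of "x' - x" "y' - y"] that by (simp add: coset_eq_iff[OF S] coset_mem)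
  moreover have "x \<in> coset T x" "y \<in> coset U y" using assms by (simp_all add: coset_mem)
  ultimately show ?thesis unfolding induced2_def by blast
qed

lemma sum_int_nat: "(\<Sum>i\<in>{0..int n - 1}. f i) = (\<Sum>i<n. f (int i))"
  by (rule sum.reindex_bij_witness[of _ int nat]) auto

section \<open>Signed insertions\<close>

locale operad_calculus = operad_with_multiplication P + cyclic_opposite_module P M
  for P :: "('k::field, 'o::ab_group_add, 'z) operad_mult_scheme"
  and M :: "('k, 'o, 'n::ab_group_add, 'y) opmod_scheme"
begin

sublocale O: vector_space "oscale P"
  by (rule oscale_vector_space)

sublocale N: vector_space "nscale M"
  by (rule nscale_vector_space)

abbreviation OS :: "int \<Rightarrow> 'o set" where "OS \<equiv> zero_ext_space (ospace P)"

abbreviation NN :: "int \<Rightarrow> 'n set" where "NN \<equiv> zero_ext_space (nspace M)"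

lemma OS_subspace: "O.subspace (OS k)"
  using ospace_subspace by (auto simp: zero_ext_space_def O.subspace_def)

lemma NN_subspace: "N.subspace (NN k)"
  using nspace_subspace by (auto simp: zero_ext_space_def N.subspace_def)

lemmas OS_closed [simp] = O.subspace_0[OF OS_subspace] O.subspace_add[OF OS_subspace]
  O.subspace_diff[OF OS_subspace] O.subspace_neg[OF OS_subspace] O.subspace_sum[OF OS_subspace]
  O.subspace_scale[OF OS_subspace] O.subspace_sg[OF OS_subspace]

lemmas NN_closed [simp] = N.subspace_0[OF NN_subspace] N.subspace_add[OF NN_subspace]
  N.subspace_diff[OF NN_subspace] N.subspace_neg[OF NN_subspace] N.subspace_sum[OF NN_subspace]
  N.subspace_scale[OF NN_subspace] N.subspace_sg[OF NN_subspace]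

lemma OS_nat [simp]: "OS (int k) = ospace P k"
  by (simp add: zero_ext_space_def)

lemma NN_nat [simp]: "NN (int k) = nspace M k"
  by (simp add: zero_ext_space_def)

lemma NN_neg: "k < 0 \<Longrightarrow> NN k = {0}"
  by (simp add: zero_ext_space_def)

text \<open>
  With the signs \<open>(-1)\<^sup>i\<^sup>(\<^sup>p\<^sup>-\<^sup>1\<^sup>) \<phi> \<bullet>\<^sub>i x\<close> and \<open>(-1)\<^sup>n t\<close>, all differentials and homotopies below become
  sums without signs, and the only sign left in the axioms is \<open>(-1)\<^sup>(\<^sup>p\<^sup>-\<^sup>1\<^sup>)\<^sup>(\<^sup>q\<^sup>-\<^sup>1\<^sup>)\<close> for disjoint insertions.
  The operations are zero outside their carriers and index ranges, so that the axioms hold with hardly any side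
  conditions; degrees and arities are integers to avoid truncated subtraction.  The position in
  \<^term>\<open>circ\<close> is counted from \<open>0\<close>, and \<open>rot n k\<close> is the \<open>k\<close>-th power of the signed cyclic operator for
  any integer \<open>k\<close>.
\<close>

definition ins :: "int \<Rightarrow> 'o \<Rightarrow> int \<Rightarrow> int \<Rightarrow> 'n \<Rightarrow> 'n"
  where "ins p \<phi> i n x =
    (if 0 \<le> p \<and> 0 \<le> i \<and> 0 \<le> n \<and> i + p \<le> n + 1 \<and> \<phi> \<in> OS p \<and> x \<in> NN n
     then sg (i * (p + 1)) (act M (nat p) (nat n) (nat i) \<phi> x) else 0)"

definition circ :: "int \<Rightarrow> int \<Rightarrow> int \<Rightarrow> 'o \<Rightarrow> 'o \<Rightarrow> 'o"
  where "circ p q k \<phi> \<psi> =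
    (if 0 \<le> q \<and> 0 \<le> k \<and> k < p \<and> \<phi> \<in> OS p \<and> \<psi> \<in> OS q
     then sg (k * (q + 1)) (ocomp P (nat p) (nat q) (nat (k + 1)) \<phi> \<psi>) else 0)"

definition rot :: "int \<Rightarrow> int \<Rightarrow> 'n \<Rightarrow> 'n"
  where "rot n k x =
    (if 0 \<le> n \<and> x \<in> NN n then sg (n * k) ((cyc M (nat n) ^^ nat (k mod (n + 1))) x) else 0)"

lemma ins_nat:
  "\<phi> \<in> ospace P p \<Longrightarrow> x \<in> nspace M n \<Longrightarrow> i + p \<le> n + 1 \<Longrightarrow>
    ins (int p) \<phi> (int i) (int n) x = sg (int i * (int p + 1)) (act M p n i \<phi> x)"
  by (auto simp: ins_def)

lemma ins_eq_0:
  "\<not> (0 \<le> p \<and> 0 \<le> i \<and> 0 \<le> n \<and> i + p \<le> n + 1 \<and> \<phi> \<in> OS p \<and> x \<in> NN n) \<Longrightarrow> ins p \<phi> i n x = 0"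
  unfolding ins_def by (rule if_not_P)

lemma ins_valid_cases:
  assumes "0 \<le> p" "0 \<le> i" "0 \<le> n" "i + p \<le> n + 1" "\<phi> \<in> OS p" "x \<in> NN n"
  obtains p' i' n' where "p = int p'" "i = int i'" "n = int n'" "i' + p' \<le> n' + 1"
    "\<phi> \<in> ospace P p'" "x \<in> nspace M n'"
proof -
  have "p = int (nat p)" "i = int (nat i)" "n = int (nat n)" "nat i + nat p \<le> nat n + 1"
    "\<phi> \<in> ospace P (nat p)" "x \<in> nspace M (nat n)"
    using assms by (auto simp: zero_ext_space_def)
  then show thesis by (rule that)
qed

lemma act_linear:
  assumes "i + p \<le> n + 1"
  shows "\<phi> \<in> ospace P p \<Longrightarrow> x \<in> nspace M n \<Longrightarrow> act M p n i \<phi> x \<in> nspace M (n + 1 - p)"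
    and "\<phi> \<in> ospace P p \<Longrightarrow> x \<in> nspace M n \<Longrightarrow> y \<in> nspace M n \<Longrightarrow>
      act M p n i \<phi> (x + y) = act M p n i \<phi> x + act M p n i \<phi> y"
    and "\<phi> \<in> ospace P p \<Longrightarrow> x \<in> nspace M n \<Longrightarrow>
      act M p n i \<phi> (nscale M c x) = nscale M c (act M p n i \<phi> x)"
    and "\<phi> \<in> ospace P p \<Longrightarrow> \<psi> \<in> ospace P p \<Longrightarrow> x \<in> nspace M n \<Longrightarrow>
      act M p n i (\<phi> + \<psi>) x = act M p n i \<phi> x + act M p n i \<psi> x"
    and "\<phi> \<in> ospace P p \<Longrightarrow> x \<in> nspace M n \<Longrightarrow>
      act M p n i (oscale P c \<phi>) x = nscale M c (act M p n i \<phi> x)"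
  using act_bilinear[OF assms] unfolding bilinear_on_def linear_on_def by blast+

lemma ins_in [simp]: "ins p \<phi> i n x \<in> NN (n + 1 - p)"
proof (cases "0 \<le> p \<and> 0 \<le> i \<and> 0 \<le> n \<and> i + p \<le> n + 1 \<and> \<phi> \<in> OS p \<and> x \<in> NN n")
  case True
  then obtain p' i' n' where *: "p = int p'" "i = int i'" "n = int n'" "i' + p' \<le> n' + 1"
    "\<phi> \<in> ospace P p'" "x \<in> nspace M n'" using ins_valid_cases by metis
  then have "n + 1 - p = int (n' + 1 - p')" by auto
  then show ?thesis
    using * act_linear(1)[OF *(4-6)] by (simp add: ins_nat N.subspace_sg nspace_subspace del: of_nat_diff)
qed (simp add: ins_eq_0)

lemma ins_in' [simp]: "m = n + 1 - p \<Longrightarrow> ins p \<phi> i n x \<in> NN m"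
  by simp

lemma ins_scale:
  assumes "x \<in> NN n" shows "ins p \<phi> i n (nscale M c x) = nscale M c (ins p \<phi> i n x)"
proof (cases "0 \<le> p \<and> 0 \<le> i \<and> 0 \<le> n \<and> i + p \<le> n + 1 \<and> \<phi> \<in> OS p \<and> x \<in> NN n")
  case True
  then obtain p' i' n' where *: "p = int p'" "i = int i'" "n = int n'" "i' + p' \<le> n' + 1"
    "\<phi> \<in> ospace P p'" "x \<in> nspace M n'" using ins_valid_cases by metis
  then show ?thesis
    by (simp add: ins_nat act_linear N.scale_sg N.subspace_scale nspace_subspace)
qed (use assms in \<open>simp add: ins_eq_0\<close>)

lemma ins_add:
  assumes "x \<in> NN n" "y \<in> NN n" shows "ins p \<phi> i n (x + y) = ins p \<phi> i n x + ins p \<phi> i n y"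
proof (cases "0 \<le> p \<and> 0 \<le> i \<and> 0 \<le> n \<and> i + p \<le> n + 1 \<and> \<phi> \<in> OS p")
  case True
  then obtain p' i' n' where *: "p = int p'" "i = int i'" "n = int n'" "i' + p' \<le> n' + 1"
    "\<phi> \<in> ospace P p'" "x \<in> nspace M n'" using ins_valid_cases assms by metis
  then have "y \<in> nspace M n'" using assms by simp
  with * show ?thesis
    by (simp add: ins_nat act_linear sg_add N.subspace_add nspace_subspace)
qed (auto simp: ins_eq_0)

lemma ins_0 [simp]: "ins p \<phi> i n 0 = 0"
  using ins_add[of 0 n 0 p \<phi> i] by simp

lemma ins_minus: "ins p \<phi> i n (- x) = - ins p \<phi> i n x"
proof (cases "x \<in> NN n")
  case True
  then show ?thesis using ins_scale[of x n p \<phi> i "-1"] by simp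
next
  case False
  then have "- x \<notin> NN n" using NN_closed(4)[of "-x" n] by auto
  with False show ?thesis by (simp add: ins_eq_0)
qed

lemma ins_sg: "ins p \<phi> i n (sg k x) = sg k (ins p \<phi> i n x)"
  by (simp add: sg_def ins_minus)

lemma ins_diff:
  assumes "x \<in> NN n" "y \<in> NN n" shows "ins p \<phi> i n (x - y) = ins p \<phi> i n x - ins p \<phi> i n y"
  using ins_add[of x n "-y" p \<phi> i] assms by (simp add: ins_minus)

lemma ins_sum:
  "(\<And>k. k \<in> A \<Longrightarrow> f k \<in> NN n) \<Longrightarrow> ins p \<phi> i n (sum f A) = (\<Sum>k\<in>A. ins p \<phi> i n (f k))"
  by (induction A rule: infinite_finite_induct) (auto simp: ins_add)

lemma ins_op_scale:
  assumes "\<phi> \<in> OS p" shows "ins p (oscale P c \<phi>) i n x = nscale M c (ins p \<phi> i n x)"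
proof (cases "0 \<le> p \<and> 0 \<le> i \<and> 0 \<le> n \<and> i + p \<le> n + 1 \<and> x \<in> NN n")
  case True
  then obtain p' i' n' where *: "p = int p'" "i = int i'" "n = int n'" "i' + p' \<le> n' + 1"
    "\<phi> \<in> ospace P p'" "x \<in> nspace M n'" using ins_valid_cases assms by metis
  then show ?thesis
    by (simp add: ins_nat act_linear N.scale_sg O.subspace_scale ospace_subspace)
qed (auto simp: ins_eq_0)

lemma ins_op_add:
  assumes "\<phi> \<in> OS p" "\<psi> \<in> OS p" shows "ins p (\<phi> + \<psi>) i n x = ins p \<phi> i n x + ins p \<psi> i n x"
proof (cases "0 \<le> p \<and> 0 \<le> i \<and> 0 \<le> n \<and> i + p \<le> n + 1 \<and> x \<in> NN n")
  case True
  then obtain p' i' n' where *: "p = int p'" "i = int i'" "n = int n'" "i' + p' \<le> n' + 1"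
    "\<phi> \<in> ospace P p'" "x \<in> nspace M n'" using ins_valid_cases assms by metis
  then have "\<psi> \<in> ospace P p'" using assms by simp
  with * show ?thesis
    by (simp add: ins_nat act_linear sg_add O.subspace_add ospace_subspace)
qed (auto simp: ins_eq_0)

lemma ins_op_0 [simp]: "ins p 0 i n x = 0"
  using ins_op_add[of 0 p 0 i n x] by simp

lemma ins_op_minus: "\<phi> \<in> OS p \<Longrightarrow> ins p (- \<phi>) i n x = - ins p \<phi> i n x"
  using ins_op_scale[of \<phi> p "-1" i n x] by simp

lemma ins_op_sg: "\<phi> \<in> OS p \<Longrightarrow> ins p (sg k \<phi>) i n x = sg k (ins p \<phi> i n x)"
  by (simp add: sg_def ins_op_minus)

lemma ins_op_diff:
  "\<phi> \<in> OS p \<Longrightarrow> \<psi> \<in> OS p \<Longrightarrow> ins p (\<phi> - \<psi>) i n x = ins p \<phi> i n x - ins p \<psi> i n x"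
  using ins_op_add[of \<phi> p "-\<psi>" i n x] by (simp add: ins_op_minus)

lemma ins_op_sum:
  "(\<And>k. k \<in> A \<Longrightarrow> f k \<in> OS p) \<Longrightarrow> ins p (sum f A) i n x = (\<Sum>k\<in>A. ins p (f k) i n x)"
  by (induction A rule: infinite_finite_induct) (auto simp: ins_op_add)

lemma ins_comm:
  assumes "j < i" and m: "m = n + 1 - q"
  shows "ins p \<phi> i m (ins q \<psi> j n x)
    = sg ((p + 1) * (q + 1)) (ins q \<psi> j (n + 1 - p) (ins p \<phi> (i + q - 1) n x))"
proof (cases "0 \<le> p \<and> 0 \<le> q \<and> 0 \<le> j \<and> 0 \<le> n \<and> i + p + q \<le> n + 2 \<and> \<phi> \<in> OS p \<and> \<psi> \<in> OS q \<and> x \<in> NN n")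
  case True
  define p' q' i' j' n' where "p' = nat p" "q' = nat q" "i' = nat i" "j' = nat j" "n' = nat n"
  then have *: "p = int p'" "q = int q'" "i = int i'" "j = int j'" "n = int n'"
    using True assms by auto
  have r: "j' + q' \<le> n' + 1" "i' + p' + q' \<le> n' + 2" "j' < i'" "p' \<le> n' + 1" "q' \<le> n' + 1"
    "j' + q' \<le> n' + 1 - p' + 1" "i' + p' \<le> n' + 1 - q' + 1" "i' + q' - 1 + p' \<le> n' + 1"
    using True assms unfolding * by auto
  have mem: "\<phi> \<in> ospace P p'" "\<psi> \<in> ospace P q'" "x \<in> nspace M n'"
    using True unfolding * by auto
  have d: "n + 1 - q = int (n' + 1 - q')" "n + 1 - p = int (n' + 1 - p')" "i + q - 1 = int (i' + q' - 1)"
    using r unfolding * by auto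
  have "ins p \<phi> i (n + 1 - q) (ins q \<psi> j n x)
      = sg (i * (p + 1) + j * (q + 1)) (act M p' (n' + 1 - q') i' \<phi> (act M q' n' j' \<psi> x))"
    unfolding d unfolding * using r mem act_linear(1)[of j' q' n' \<psi> x]
    by (simp add: ins_nat ins_sg del: of_nat_diff) (simp add: add.commute)
  moreover have "ins q \<psi> j (n + 1 - p) (ins p \<phi> (i + q - 1) n x)
      = sg (j * (q + 1) + (i + q - 1) * (p + 1))
        (act M q' (n' + 1 - p') j' \<psi> (act M p' n' (i' + q' - 1) \<phi> x))"
    unfolding d unfolding * using r mem act_linear(1)[of "i' + q' - 1" p' n' \<phi> x]
    by (simp add: ins_nat ins_sg del: of_nat_diff) (simp add: add.commute)
  ultimately show ?thesis
    unfolding m using act_assoc_left[OF mem r(1-3)] by (auto intro: sg_cong)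
next
  case False
  have "ins p \<phi> i m (ins q \<psi> j n x) = 0"
  proof (cases "ins q \<psi> j n x = 0")
    case nz: False
    then have "0 \<le> q \<and> 0 \<le> j \<and> 0 \<le> n \<and> j + q \<le> n + 1 \<and> \<psi> \<in> OS q \<and> x \<in> NN n"
      using ins_eq_0 by blast
    then show ?thesis using False m by (intro ins_eq_0) auto
  qed simp
  moreover have "ins q \<psi> j (n + 1 - p) (ins p \<phi> (i + q - 1) n x) = 0"
  proof (cases "ins p \<phi> (i + q - 1) n x = 0")
    case nz: False
    then have "0 \<le> p \<and> 0 \<le> n \<and> i + q - 1 + p \<le> n + 1 \<and> \<phi> \<in> OS p \<and> x \<in> NN n"
      using ins_eq_0 by blast
    then show ?thesis using False by (intro ins_eq_0) auto
  qed simp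
  ultimately show ?thesis by simp
qed

lemma ocomp_linear:
  assumes "1 \<le> i" "i \<le> p"
  shows "\<phi> \<in> ospace P p \<Longrightarrow> \<psi> \<in> ospace P q \<Longrightarrow> ocomp P p q i \<phi> \<psi> \<in> ospace P (p + q - 1)"
    and "\<phi> \<in> ospace P p \<Longrightarrow> \<phi>' \<in> ospace P p \<Longrightarrow> \<psi> \<in> ospace P q \<Longrightarrow>
      ocomp P p q i (\<phi> + \<phi>') \<psi> = ocomp P p q i \<phi> \<psi> + ocomp P p q i \<phi>' \<psi>"
    and "\<phi> \<in> ospace P p \<Longrightarrow> \<psi> \<in> ospace P q \<Longrightarrow> \<psi>' \<in> ospace P q \<Longrightarrow>
      ocomp P p q i \<phi> (\<psi> + \<psi>') = ocomp P p q i \<phi> \<psi> + ocomp P p q i \<phi> \<psi>'"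
    and "\<phi> \<in> ospace P p \<Longrightarrow> \<psi> \<in> ospace P q \<Longrightarrow>
      ocomp P p q i (oscale P c \<phi>) \<psi> = oscale P c (ocomp P p q i \<phi> \<psi>)"
    and "\<phi> \<in> ospace P p \<Longrightarrow> \<psi> \<in> ospace P q \<Longrightarrow>
      ocomp P p q i \<phi> (oscale P c \<psi>) = oscale P c (ocomp P p q i \<phi> \<psi>)"
  using ocomp_bilinear[OF assms] unfolding bilinear_on_def linear_on_def by blast+

lemma circ_nat:
  "k < p \<Longrightarrow> \<phi> \<in> ospace P p \<Longrightarrow> \<psi> \<in> ospace P q \<Longrightarrow>
    circ (int p) (int q) (int k) \<phi> \<psi> = sg (int k * (int q + 1)) (ocomp P p q (k + 1) \<phi> \<psi>)"
  by (auto simp: circ_def nat_add_distrib)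

lemma circ_in [simp]: "r = p + q - 1 \<Longrightarrow> circ p q k \<phi> \<psi> \<in> OS r"
proof (cases "0 \<le> q \<and> 0 \<le> k \<and> k < p \<and> \<phi> \<in> OS p \<and> \<psi> \<in> OS q")
  case True
  then have "circ p q k \<phi> \<psi> = sg (k * (q + 1)) (ocomp P (nat p) (nat q) (nat (k + 1)) \<phi> \<psi>)"
    by (simp add: circ_def)
  moreover have "ocomp P (nat p) (nat q) (nat (k + 1)) \<phi> \<psi> \<in> ospace P (nat p + nat q - 1)"
    using True by (intro ocomp_linear(1)) (auto simp: zero_ext_space_def)
  moreover have "ospace P (nat p + nat q - 1) = OS (p + q - 1)"
    using True by (auto simp: zero_ext_space_def nat_add_distrib nat_diff_distrib)
  ultimately show "r = p + q - 1 \<Longrightarrow> ?thesis" by (metis OS_closed(7))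
qed (unfold circ_def, auto)

lemma ins_circ:
  assumes "i \<le> j" "j < i + p" and m: "m = n + 1 - q"
  shows "ins p \<phi> i m (ins q \<psi> j n x) = ins (p + q - 1) (circ p q (j - i) \<phi> \<psi>) i n x"
proof (cases "0 \<le> q \<and> 0 \<le> i \<and> 0 \<le> n \<and> i + p + q \<le> n + 2 \<and> \<phi> \<in> OS p \<and> \<psi> \<in> OS q \<and> x \<in> NN n")
  case True
  define p' q' i' j' n' where "p' = nat p" "q' = nat q" "i' = nat i" "j' = nat j" "n' = nat n"
  then have *: "p = int p'" "q = int q'" "i = int i'" "j = int j'" "n = int n'"
    using True assms by auto
  have r: "j' + q' \<le> n' + 1" "i' + p' + q' \<le> n' + 2" "i' \<le> j'" "j' < i' + p'"
    "i' + p' \<le> n' + 1 - q' + 1" "i' + (p' + q' - 1) \<le> n' + 1" "q' \<le> n' + 1" "j' - i' < p'"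
    using True assms unfolding * by auto
  have mem: "\<phi> \<in> ospace P p'" "\<psi> \<in> ospace P q'" "x \<in> nspace M n'"
    using True unfolding * by auto
  have d: "n + 1 - q = int (n' + 1 - q')" "p + q - 1 = int (p' + q' - 1)" "j - i = int (j' - i')"
    using r unfolding * by auto
  have c: "ocomp P p' q' (j' - i' + 1) \<phi> \<psi> \<in> ospace P (p' + q' - 1)"
    using r mem by (intro ocomp_linear(1)) auto
  then have c': "sg k (ocomp P p' q' (j' - i' + 1) \<phi> \<psi>) \<in> ospace P (p' + q' - 1)" for k
    by (rule O.subspace_sg[OF ospace_subspace])
  have "ins p \<phi> i (n + 1 - q) (ins q \<psi> j n x)
      = sg (i * (p + 1) + j * (q + 1)) (act M p' (n' + 1 - q') i' \<phi> (act M q' n' j' \<psi> x))"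
    unfolding d unfolding * using r mem act_linear(1)[of j' q' n' \<psi> x]
    by (simp add: ins_nat ins_sg del: of_nat_diff) (simp add: add.commute)
  moreover have "ins (p + q - 1) (circ p q (j - i) \<phi> \<psi>) i n x
      = sg ((j - i) * (q + 1)) (ins (p + q - 1) (ocomp P p' q' (j' - i' + 1) \<phi> \<psi>) i n x)"
    unfolding d using r mem c unfolding * by (subst circ_nat) (auto simp: ins_op_sg simp del: of_nat_diff)
  moreover have "ins (p + q - 1) (ocomp P p' q' (j' - i' + 1) \<phi> \<psi>) i n x
      = sg (i * (p + q)) (act M (p' + q' - 1) n' i' (ocomp P p' q' (j' - i' + 1) \<phi> \<psi>) x)"
    unfolding d using r(6) mem c unfolding *
    by (subst ins_nat) (use r in \<open>auto simp: of_nat_diff\<close>)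
  ultimately show ?thesis
    unfolding m using act_assoc_mid[OF mem r(1-4)] by (auto intro!: sg_cong)
next
  case False
  have "ins p \<phi> i m (ins q \<psi> j n x) = 0"
  proof (cases "ins q \<psi> j n x = 0")
    case nz: False
    then have "0 \<le> q \<and> 0 \<le> j \<and> 0 \<le> n \<and> j + q \<le> n + 1 \<and> \<psi> \<in> OS q \<and> x \<in> NN n"
      using ins_eq_0 by blast
    then show ?thesis using False m by (intro ins_eq_0) auto
  qed simp
  moreover have "ins (p + q - 1) (circ p q (j - i) \<phi> \<psi>) i n x = 0"
  proof (cases "circ p q (j - i) \<phi> \<psi> = 0")
    case nz: False
    then have "0 \<le> q \<and> \<phi> \<in> OS p \<and> \<psi> \<in> OS q"
      by (auto simp: circ_def split: if_splits)
    then show ?thesis using False by (intro ins_eq_0) auto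
  qed simp
  ultimately show ?thesis by simp
qed

lemma cyc_in: "x \<in> nspace M n \<Longrightarrow> (cyc M n ^^ k) x \<in> nspace M n"
  using cyc_linear[of n] by (induction k) (auto simp: linear_on_def)

lemma cyc_pow_add: "x \<in> nspace M n \<Longrightarrow> y \<in> nspace M n \<Longrightarrow>
   (cyc M n ^^ k) (x + y) = (cyc M n ^^ k) x + (cyc M n ^^ k) y"
  by (induction k) (use cyc_linear[of n] in \<open>auto simp: linear_on_def cyc_in\<close>)

lemma cyc_pow_scale: "x \<in> nspace M n \<Longrightarrow> (cyc M n ^^ k) (nscale M c x) = nscale M c ((cyc M n ^^ k) x)"
  by (induction k) (use cyc_linear[of n] in \<open>auto simp: linear_on_def cyc_in\<close>)

lemma cyc_pow_mod: "x \<in> nspace M n \<Longrightarrow> (cyc M n ^^ (k mod (n + 1))) x = (cyc M n ^^ k) x"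
proof (induction k rule: less_induct)
  case (less k)
  show ?case
  proof (cases "k < n + 1")
    case False
    then obtain l where l: "k = l + (n + 1)" by (metis add.commute le_Suc_ex not_less)
    have "(cyc M n ^^ k) x = (cyc M n ^^ l) x"
      unfolding l using cyc_power[OF less.prems] by (metis comp_apply funpow_add)
    moreover have "k mod (n + 1) = l mod (n + 1)" by (simp only: l mod_add_self2)
    ultimately show ?thesis using less.IH[of l] less.prems l by simp
  qed simp
qed

lemma rot_nat: "x \<in> nspace M n \<Longrightarrow> rot (int n) (int k) x = sg (int n * int k) ((cyc M n ^^ k) x)"
proof -
  assume x: "x \<in> nspace M n"
  have "nat (int k mod (int n + 1)) = k mod (n + 1)"
    by (metis nat_int of_nat_1 of_nat_add zmod_int)
  then show ?thesis using x cyc_pow_mod[OF x, of k] by (simp add: rot_def)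
qed

lemma rot_in [simp]: "rot n k x \<in> NN n"
  using cyc_in
  by (auto simp: rot_def zero_ext_space_def N.subspace_0[OF nspace_subspace]
      intro!: N.subspace_sg[OF nspace_subspace])

lemma rot_0 [simp]: "rot n k 0 = 0"
  using cyc_pow_scale[of 0 "nat n" _ 0] N.subspace_0[OF nspace_subspace]
  by (auto simp: rot_def)

lemma rot_add: "x \<in> NN n \<Longrightarrow> y \<in> NN n \<Longrightarrow> rot n k (x + y) = rot n k x + rot n k y"
proof (cases "0 \<le> n")
  case True
  assume "x \<in> NN n" "y \<in> NN n"
  moreover from this True have "x \<in> nspace M (nat n)" "y \<in> nspace M (nat n)" by (auto simp: zero_ext_space_def)
  ultimately show ?thesis using True by (auto simp: rot_def cyc_pow_add sg_add)
qed (auto simp: rot_def)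

lemma rot_scale: "x \<in> NN n \<Longrightarrow> rot n k (nscale M c x) = nscale M c (rot n k x)"
proof (cases "0 \<le> n")
  case True
  assume "x \<in> NN n"
  moreover from this True have "x \<in> nspace M (nat n)" by (auto simp: zero_ext_space_def)
  ultimately show ?thesis using True by (auto simp: rot_def cyc_pow_scale N.scale_sg)
qed (auto simp: rot_def)

lemma rot_minus: "rot n k (- x) = - rot n k x"
proof (cases "x \<in> NN n")
  case True
  then show ?thesis using rot_scale[of x n k "-1"] by simp
next
  case False
  then have "- x \<notin> NN n" using NN_closed(4)[of "-x" n] by auto
  with False show ?thesis by (simp add: rot_def)
qed

lemma rot_sg: "rot n k (sg j x) = sg j (rot n k x)"
  by (simp add: sg_def rot_minus)

lemma rot_diff: "x \<in> NN n \<Longrightarrow> y \<in> NN n \<Longrightarrow> rot n k (x - y) = rot n k x - rot n k y"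
  using rot_add[of x n "-y" k] by (simp add: rot_minus)

lemma rot_sum: "(\<And>i. i \<in> A \<Longrightarrow> f i \<in> NN n) \<Longrightarrow> rot n k (sum f A) = (\<Sum>i\<in>A. rot n k (f i))"
  by (induction A rule: infinite_finite_induct) (auto simp: rot_add)

lemma rot_id [simp]: "x \<in> NN n \<Longrightarrow> rot n 0 x = x"
  by (auto simp: rot_def zero_ext_space_def split: if_splits)

lemma rot_period:
  assumes "even (n * (j - k))" "j mod (n + 1) = k mod (n + 1)"
  shows "rot n j x = rot n k x"
  using assms by (auto simp: rot_def sg_def algebra_simps)

lemma rot_rot [simp]: "rot n j (rot n k x) = rot n (j + k) x"
proof (cases "0 \<le> n \<and> x \<in> NN n")
  case True
  define m where "m = nat n"
  have n: "n = int m" using True m_def by auto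
  have x: "x \<in> nspace M m" using True n by simp
  have per: "rot n k x = rot n (k mod (n + 1)) x" for k x
  proof (rule rot_period)
    have "k - k mod (n + 1) = (n + 1) * (k div (n + 1))" by (simp add: minus_mod_eq_mult_div)
    then show "even (n * (k - k mod (n + 1)))" by simp
  qed simp
  have "rot n j (rot n k x) = rot (int m) (int (nat (j mod (n+1)))) (rot (int m) (int (nat (k mod (n+1)))) x)"
    using True by (subst per[of k], subst per[of j]) (simp add: n)
  also have "\<dots> = rot n (j mod (n + 1) + k mod (n + 1)) x"
  proof -
    have "j mod (n + 1) + k mod (n + 1) = int (nat (j mod (n + 1)) + nat (k mod (n + 1)))"
      using True by simp
    then show ?thesis unfolding n
      by (simp only: rot_nat rot_sg x cyc_in) (simp add: rot_nat x cyc_in funpow_add algebra_simps)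
  qed
  also have "\<dots> = rot n (j + k) x"
    by (subst per, subst (2) per) (simp add: mod_add_eq)
  finally show ?thesis .
next
  case False
  then have "rot n k x = 0" "rot n (j + k) x = 0" unfolding rot_def by (rule if_not_P)+
  then show ?thesis by simp
qed

lemma rot_full: "x \<in> NN n \<Longrightarrow> rot n (n + 1) x = x"
  using rot_period[of n "n + 1" 0] by simp

lemma rot_ins1:
  assumes "0 \<le> i" "i + p \<le> n" and m: "m = n + 1 - p"
  shows "rot m 1 (ins p \<phi> i n x) = ins p \<phi> (i + 1) n (rot n 1 x)"
proof (cases "0 \<le> p \<and> 0 \<le> n \<and> \<phi> \<in> OS p \<and> x \<in> NN n")
  case True
  define p' i' n' where "p' = nat p" "i' = nat i" "n' = nat n"
  then have *: "p = int p'" "i = int i'" "n = int n'"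
    using True assms by auto
  have r: "i' + p' \<le> n'" using assms * by auto
  then have d: "m = int (n' + 1 - p')" using m * by auto
  have mem: "\<phi> \<in> ospace P p'" "x \<in> nspace M n'" using True * by auto
  have "rot m 1 (ins p \<phi> i n x) = sg (i * (p + 1)) (rot (int (n' + 1 - p')) (int 1) (act M p' n' i' \<phi> x))"
    unfolding d unfolding * using r mem by (simp add: ins_nat rot_sg)
  also have "\<dots> = sg (i * (p + 1) + (n + 1 - p)) (cyc M (n' + 1 - p') (act M p' n' i' \<phi> x))"
    using r mem act_linear(1)[of i' p' n'] by (subst rot_nat) (auto simp: * of_nat_diff intro!: sg_cong)
  also have "\<dots> = sg (i * (p + 1) + (n + 1 - p)) (act M p' n' (i' + 1) \<phi> (cyc M n' x))"
    using cyc_act[OF mem r] by simp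
  also have "\<dots> = sg ((i + 1) * (p + 1) + n) (act M p' n' (i' + 1) \<phi> (cyc M n' x))"
    by (rule sg_cong) auto
  also have "\<dots> = sg n (ins (int p') \<phi> (int (i' + 1)) (int n') (cyc M n' x))"
    using r mem cyc_in[of x n' 1] by (subst ins_nat) (auto simp: * algebra_simps)
  also have "\<dots> = ins p \<phi> (i + 1) n (rot n (int 1) x)"
    unfolding * by (subst rot_nat[OF mem(2)]) (simp add: ins_sg add.commute)
  finally show ?thesis by simp
next
  case False
  have a: "ins p \<phi> i n x = 0" by (rule ins_eq_0) (use False in auto)
  have "ins p \<phi> (i + 1) n (rot n 1 x) = 0"
  proof (cases "0 \<le> n \<and> x \<in> NN n")
    case True
    then show ?thesis using False by (intro ins_eq_0) auto
  next
    case False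
    then have "rot n 1 x = 0" unfolding rot_def by (rule if_not_P)
    then show ?thesis by simp
  qed
  with a show ?thesis by simp
qed

lemma rot_ins:
  assumes "0 \<le> i" "0 \<le> k" "i + k + p \<le> n + 1" and m: "m = n + 1 - p"
  shows "rot m k (ins p \<phi> i n x) = ins p \<phi> (i + k) n (rot n k x)"
  using assms(2,3)
proof (induction k rule: int_ge_induct)
  case base
  then show ?case
    by (cases "x \<in> NN n") (auto simp: ins_eq_0 rot_def m)
next
  case (step k)
  then have "rot m 1 (rot m k (ins p \<phi> i n x)) = rot m 1 (ins p \<phi> (i + k) n (rot n k x))" by simp
  also have "\<dots> = ins p \<phi> (i + k + 1) n (rot n 1 (rot n k x))"
    using step assms by (intro rot_ins1) auto
  finally show ?case by (simp add: add_ac)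
qed

lemma rot_ins_wrap:
  assumes "0 \<le> p" "p \<le> n + 1" "i = n + 1 - p" and m: "m = n + 1 - p"
  shows "rot m 1 (ins p \<phi> i n x) = ins p \<phi> 0 n (rot n p x)"
proof -
  let ?y = "rot n (- i) x"
  have "ins p \<phi> i n x = rot m i (ins p \<phi> 0 n ?y)" if "x \<in> NN n"
    using rot_ins[of 0 i p n m \<phi> ?y] assms that by simp
  moreover have ?thesis if "x \<notin> NN n"
  proof -
    have "ins p \<phi> i n x = 0" "rot n p x = 0" using that by (simp_all add: rot_def ins_eq_0)
    then show ?thesis by simp
  qed
  moreover have "rot m (1 + i) (ins p \<phi> 0 n ?y) = ins p \<phi> 0 n ?y"
    using rot_full[of "ins p \<phi> 0 n ?y" m] assms by (simp add: add.commute)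
  moreover have "?y = rot n p x"
  proof (rule rot_period)
    show "even (n * (- i - p))" using assms by simp
    have "- i = p + (-1) * (n + 1)" using assms by simp
    then show "- i mod (n + 1) = p mod (n + 1)" by (metis mod_mult_self1)
  qed
  ultimately show ?thesis by (metis rot_rot)
qed

section \<open>The differentials of the cyclic module\<close>

abbreviation mu :: "int \<Rightarrow> int \<Rightarrow> 'n \<Rightarrow> 'n" where "mu \<equiv> ins 2 (omult P)"

abbreviation un :: "int \<Rightarrow> int \<Rightarrow> 'n \<Rightarrow> 'n" where "un \<equiv> ins 0 (opoint P)"

lemma omult_OS [simp]: "omult P \<in> OS 2"
  using omult_in by (simp add: zero_ext_space_def)

lemma opoint_OS [simp]: "opoint P \<in> OS 0"
  using opoint_in by (simp add: zero_ext_space_def)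

lemma mu_mu: "m = n - 1 \<Longrightarrow> mu a m (mu (a + 1) n x) = - mu a m (mu a n x)"
proof -
  assume m: "m = n - 1"
  have "circ 2 2 1 (omult P) (omult P) = - circ 2 2 0 (omult P) (omult P)"
    using omult_assoc by (simp add: circ_def sg_def)
  then show ?thesis
    using ins_circ[of a "a + 1" 2 m n 2 "omult P" "omult P" x]
      ins_circ[of a a 2 m n 2 "omult P" "omult P" x] m
    by (simp add: ins_op_minus)
qed

lemma ins_ounit: "0 \<le> a \<Longrightarrow> a \<le> n \<Longrightarrow> x \<in> NN n \<Longrightarrow> ins 1 (ounit P) a n x = x"
  using ounit_in act_unit[of x "nat n" "nat a"]
  by (simp add: ins_def zero_ext_space_def sg_def)

lemma mu_un: "0 \<le> a \<Longrightarrow> a \<le> n \<Longrightarrow> x \<in> NN n \<Longrightarrow> mu a (n + 1) (un a n x) = x"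
proof -
  assume *: "0 \<le> a" "a \<le> n" "x \<in> NN n"
  have "circ 2 0 0 (omult P) (opoint P) = ounit P"
    using omult_opoint_left by (simp add: circ_def)
  then show ?thesis using ins_circ[of a a 2 "n + 1" n 0 "omult P" "opoint P" x] *
    by (simp add: ins_ounit)
qed

lemma mu_un': "0 \<le> a \<Longrightarrow> a \<le> n \<Longrightarrow> x \<in> NN n \<Longrightarrow> mu a (n + 1) (un (a + 1) n x) = - x"
proof -
  assume *: "0 \<le> a" "a \<le> n" "x \<in> NN n"
  have "circ 2 0 1 (omult P) (opoint P) = - ounit P"
    using omult_opoint_right by (simp add: circ_def sg_def)
  moreover have "ounit P \<in> OS 1" using ounit_in by (simp add: zero_ext_space_def)
  ultimately show ?thesis using ins_circ[of a "a + 1" 2 "n + 1" n 0 "omult P" "opoint P" x] *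
    by (simp add: ins_ounit ins_op_minus)
qed

text \<open>
  In the usual notation, \<^term>\<open>bp\<close> is \<open>b'\<close> and \<open>nrm n (n + 1)\<close> is the norm \<open>N\<close>.  The partial
  norms are what the Cartan homotopies are made of.
\<close>

definition bp :: "int \<Rightarrow> 'n \<Rightarrow> 'n"
  where "bp n x = (\<Sum>l\<in>{0..n-1}. mu l n x)"

definition bd :: "int \<Rightarrow> 'n \<Rightarrow> 'n"
  where "bd n x = bp n x + mu 0 n (rot n 1 x)"

definition nrm :: "int \<Rightarrow> int \<Rightarrow> 'n \<Rightarrow> 'n"
  where "nrm n i x = (\<Sum>j\<in>{0..i-1}. rot n j x)"

lemma bp_in [simp]: "m = n - 1 \<Longrightarrow> bp n x \<in> NN m"
  by (simp add: bp_def)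

lemma bd_in [simp]: "m = n - 1 \<Longrightarrow> bd n x \<in> NN m"
  by (simp add: bd_def)

lemma nrm_in [simp]: "nrm n i x \<in> NN n"
  by (simp add: nrm_def)

lemma bp_add: "x \<in> NN n \<Longrightarrow> y \<in> NN n \<Longrightarrow> bp n (x + y) = bp n x + bp n y"
  by (simp add: bp_def ins_add sum.distrib)

lemma bd_add: "x \<in> NN n \<Longrightarrow> y \<in> NN n \<Longrightarrow> bd n (x + y) = bd n x + bd n y"
  by (simp add: bd_def bp_add rot_add ins_add)

lemma bp_minus: "bp n (- x) = - bp n x"
  by (simp add: bp_def ins_minus sum_negf)

lemma bd_minus: "bd n (- x) = - bd n x"
  by (simp add: bd_def bp_minus rot_minus ins_minus)

lemma bp_diff: "x \<in> NN n \<Longrightarrow> y \<in> NN n \<Longrightarrow> bp n (x - y) = bp n x - bp n y"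
  by (simp add: bp_def ins_diff sum_subtractf)

lemma bd_diff: "x \<in> NN n \<Longrightarrow> y \<in> NN n \<Longrightarrow> bd n (x - y) = bd n x - bd n y"
  by (simp add: bd_def bp_diff rot_diff ins_diff)

lemma bd_0 [simp]: "bd n 0 = 0"
  by (simp add: bd_def bp_def)

lemma bd_sg: "bd n (sg k x) = sg k (bd n x)"
  by (simp add: sg_def bd_minus)

lemma bp_sum: "(\<And>k. k \<in> A \<Longrightarrow> f k \<in> NN n) \<Longrightarrow> bp n (sum f A) = (\<Sum>k\<in>A. bp n (f k))"
  by (induction A rule: infinite_finite_induct) (simp_all add: bp_add, simp_all add: bp_def)

lemma bd_scale: "x \<in> NN n \<Longrightarrow> bd n (nscale M c x) = nscale M c (bd n x)"
  by (simp add: bd_def bp_def ins_scale rot_scale N.scale_sum_right N.scale_right_distrib)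

lemma nrm_add: "x \<in> NN n \<Longrightarrow> y \<in> NN n \<Longrightarrow> nrm n i (x + y) = nrm n i x + nrm n i y"
  by (simp add: nrm_def rot_add sum.distrib)

lemma nrm_minus: "nrm n i (- x) = - nrm n i x"
  by (simp add: nrm_def rot_minus sum_negf)

lemma nrm_scale: "x \<in> NN n \<Longrightarrow> nrm n i (nscale M c x) = nscale M c (nrm n i x)"
  by (simp add: nrm_def rot_scale N.scale_sum_right)

lemma nrm_Suc: "0 \<le> i \<Longrightarrow> nrm n (i + 1) x = nrm n i x + rot n i x"
  by (simp add: nrm_def sum_int_last)

lemma nrm_rec: "0 \<le> i \<Longrightarrow> x \<in> NN n \<Longrightarrow> nrm n (i + 1) x = x + rot n 1 (nrm n i x)"
  using sum_int_shift[of "\<lambda>j. rot n j x" 1 0 "i - 1"]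
  by (simp add: nrm_def sum_int_head rot_sum add.commute)

lemma nrm_0 [simp]: "nrm n 0 x = 0"
  by (simp add: nrm_def)

lemma rot_nrm [simp]: "x \<in> NN n \<Longrightarrow> rot n k (nrm n (n + 1) x) = nrm n (n + 1) x"
proof (cases "0 \<le> n")
  case True
  assume x: "x \<in> NN n"
  have 1: "rot n 1 (nrm n (n + 1) x) = nrm n (n + 1) x" if x: "x \<in> NN n" for x
    using nrm_rec[of "n + 1" x n] nrm_Suc[of "n + 1" n x] rot_full[OF x] True x by simp
  have nonneg: "rot n k (nrm n (n + 1) x) = nrm n (n + 1) x" if "0 \<le> k" for k
    using that
  proof (induction k rule: int_ge_induct)
    case (step k)
    have "rot n (k + 1) (nrm n (n + 1) x) = rot n 1 (rot n k (nrm n (n + 1) x))"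
      by (simp add: add.commute)
    with step 1[OF x] show ?case by (simp del: rot_rot)
  qed simp
  show ?thesis
  proof (cases "0 \<le> k")
    case False
    then have "rot n k (nrm n (n + 1) x) = rot n k (rot n (- k) (nrm n (n + 1) x))"
      using nonneg[of "- k"] by simp
    then show ?thesis by simp
  qed (rule nonneg)
qed (auto simp: nrm_def rot_def)

lemma nrm_rot [simp]: "x \<in> NN n \<Longrightarrow> nrm n (n + 1) (rot n k x) = nrm n (n + 1) x"
proof -
  assume x: "x \<in> NN n"
  have "nrm n (n + 1) (rot n k x) = rot n k (nrm n (n + 1) x)"
    by (simp add: nrm_def rot_sum add.commute)
  with x show ?thesis by simp
qed

lemma rot_bd:
  assumes "0 \<le> k" "k \<le> n - 1" and m: "m = n - 1"
  shows "rot m k (bd n x) =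
    (\<Sum>l\<in>{k..n-1}. mu l n (rot n k x)) + (\<Sum>l\<in>{0..k}. mu l n (rot n (k + 1) x))"
  using assms(1,2)
proof (induction k rule: int_ge_induct)
  case base
  have "mu l n x = mu l n (rot n 0 x)" for l
    by (cases "x \<in> NN n") (auto simp: rot_def ins_eq_0)
  then show ?case using base by (simp add: bd_def bp_def m)
next
  case (step k)
  have "rot m 1 (mu l n y) = mu (l + 1) n (rot n 1 y)" if "0 \<le> l" "l \<le> n - 2" for l y
    using that by (intro rot_ins1) (auto simp: m)
  moreover have "rot m 1 (mu (n - 1) n y) = mu 0 n (rot n 2 y)" for y
    using step by (intro rot_ins_wrap) (auto simp: m)
  moreover have "rot m (k + 1) (bd n x) = rot m 1 (rot m k (bd n x))"
    by (simp add: add.commute)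
  moreover have "\<dots> = (\<Sum>l\<in>{k..n-1}. rot m 1 (mu l n (rot n k x))) + (\<Sum>l\<in>{0..k}. rot m 1 (mu l n (rot n (k + 1) x)))"
    using step by (simp add: rot_add rot_sum m)
  ultimately have "rot m (k + 1) (bd n x) = (\<Sum>l\<in>{k..n-2}. mu (l + 1) n (rot n (k + 1) x))
     + mu 0 n (rot n (k + 2) x) + (\<Sum>l\<in>{0..k}. mu (l + 1) n (rot n (k + 2) x))"
    using step by (simp add: sum_int_last[of k "n - 1"] add.commute)
  also have "\<dots> = (\<Sum>l\<in>{k+1..n-1}. mu l n (rot n (k + 1) x)) + (\<Sum>l\<in>{0..k+1}. mu l n (rot n (k + 2) x))"
    using step sum_int_shift[of "\<lambda>l. mu l n (rot n (k + 1) x)" 1 k "n - 2"]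
      sum_int_shift[of "\<lambda>l. mu l n (rot n (k + 2) x)" 1 0 k]
    by (simp add: sum_int_head[of 0 "k + 1"])
  finally show ?case by (simp add: add.commute)
qed

lemma nrm_bd:
  assumes "0 \<le> i" "i \<le> n" and m: "m = n - 1"
  shows "nrm m i (bd n x) =
    (\<Sum>l\<in>{0..i-1}. mu l n (nrm n (i + 1) x)) + (\<Sum>l\<in>{i..n-1}. mu l n (nrm n i x))"
  using assms(1,2)
proof (induction i rule: int_ge_induct)
  case base
  then show ?case by simp
next
  case (step i)
  have s: "nrm n (i + 2) x = nrm n i x + rot n i x + rot n (i + 1) x"
    "nrm n (i + 1) x = nrm n i x + rot n i x"
    using step nrm_Suc[of "i + 1" n x] nrm_Suc[of i n x] by (simp_all add: add.commute)
  have "nrm m (i + 1) (bd n x) = nrm m i (bd n x) + rot m i (bd n x)"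
    using step by (simp add: nrm_Suc)
  also have "\<dots> = (\<Sum>l\<in>{0..i-1}. mu l n (nrm n (i + 1) x)) + (\<Sum>l\<in>{i..n-1}. mu l n (nrm n i x))
     + ((\<Sum>l\<in>{i..n-1}. mu l n (rot n i x)) + (\<Sum>l\<in>{0..i}. mu l n (rot n (i + 1) x)))"
    using step rot_bd[of i n m x] m by simp
  also have "\<dots> = (\<Sum>l\<in>{0..i}. mu l n (nrm n (i + 2) x)) + (\<Sum>l\<in>{i+1..n-1}. mu l n (nrm n (i + 1) x))"
    unfolding s using step
    by (simp add: sum_int_head[of i "n - 1"] sum_int_last[of 0 i] ins_add sum.distrib algebra_simps)
  finally show ?case by (simp add: add.commute)
qed

lemma bp_nrm: "x \<in> NN n \<Longrightarrow> m = n - 1 \<Longrightarrow> nrm m n (bd n x) = bp n (nrm n (n + 1) x)"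
  using nrm_bd[of n n m x] by (cases "0 \<le> n") (auto simp: bp_def nrm_def)

lemma bp_rot:
  assumes "0 < n" and m: "m = n - 1"
  shows "bd n x - bd n (rot n 1 x) = bp n x - rot m 1 (bp n x)"
proof -
  have "rot m 1 (bp n x) = (\<Sum>l\<in>{0..n-1}. rot m 1 (mu l n x))"
    by (simp add: bp_def rot_sum m)
  also have "\<dots> = (\<Sum>l\<in>{0..n-2}. rot m 1 (mu l n x)) + rot m 1 (mu (n - 1) n x)"
    using assms by (simp add: sum_int_last)
  also have "rot m 1 (mu (n - 1) n x) = mu 0 n (rot n 2 x)"
    using assms by (intro rot_ins_wrap) auto
  also have "(\<Sum>l\<in>{0..n-2}. rot m 1 (mu l n x)) = (\<Sum>l\<in>{0..n-2}. mu (l + 1) n (rot n 1 x))"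
    using m by (intro sum.cong) (auto intro!: rot_ins1)
  also have "\<dots> = (\<Sum>l\<in>{1..n-1}. mu l n (rot n 1 x))"
    using sum_int_shift[of "\<lambda>l. mu l n (rot n 1 x)" 1 0 "n - 2"] by simp
  finally show ?thesis
    using assms by (simp add: bd_def bp_def sum_int_head[of 0 "n - 1" "\<lambda>l. mu l n (rot n 1 x)"])
qed

lemma bp_un: "x \<in> NN n \<Longrightarrow> bp (n + 1) (un 0 n x) + un 0 (n - 1) (bp n x) = x"
proof (cases "0 \<le> n")
  case True
  assume x: "x \<in> NN n"
  have "mu (l + 1) (n + 1) (un 0 n x) = - un 0 (n - 1) (mu l n x)" if "0 \<le> l" for l
    using that by (subst ins_comm) (auto simp: sg_def)
  then have "(\<Sum>l\<in>{0..n-1}. mu (l + 1) (n + 1) (un 0 n x)) = - un 0 (n - 1) (bp n x)"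
    by (simp add: bp_def ins_sum sum_negf)
  then have "bp (n + 1) (un 0 n x) = x - un 0 (n - 1) (bp n x)"
    using sum_int_shift[of "\<lambda>l. mu l (n + 1) (un 0 n x)" 1 0 "n - 1"] True x
    by (simp add: bp_def sum_int_head[of 0 n] mu_un)
  then show ?thesis by simp
qed (auto simp: zero_ext_space_def bp_def)

lemma bd_bd: "m = n - 1 \<Longrightarrow> bd m (bd n x) = 0"
proof (cases "2 \<le> n \<and> x \<in> NN n")
  case True
  assume m: "m = n - 1"
  let ?t = "rot n 1 x"
  have shift: "(\<Sum>l\<in>{1..n-2}. mu 0 m (mu (l + 1) n ?t)) = (\<Sum>l\<in>{2..n-1}. mu 0 m (mu l n ?t))"
    using sum_int_shift[of "\<lambda>l. mu 0 m (mu l n ?t)" 1 1 "n - 2"] by simp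
  have comm: "mu l m (mu j n y) = - mu j m (mu (l + 1) n y)" if "j < l" for l j y
    using that m by (subst ins_comm) (auto simp: sg_def add.commute)
  have r: "rot m 1 (bd n x) = (\<Sum>l\<in>{1..n-1}. mu l n ?t) + (mu 0 n (rot n 2 x) + mu 1 n (rot n 2 x))"
    using rot_bd[of 1 n m x] m True by (simp add: sum_int_head[of 0 1])
  have "mu 0 m (rot m 1 (bd n x)) = mu 0 m (mu 1 n ?t) + (\<Sum>l\<in>{2..n-1}. mu 0 m (mu l n ?t))"
    unfolding r using m True mu_mu[of m n 0 "rot n 2 x"]
    by (simp add: ins_add ins_sum sum_int_head[of 1 "n - 1"])
  moreover have "bp m (mu 0 n ?t) = mu 0 m (mu 0 n ?t) - (\<Sum>l\<in>{2..n-1}. mu 0 m (mu l n ?t))"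
    unfolding shift[symmetric] using m True comm
    by (simp add: bp_def sum_int_head[of 0 "n - 2"] sum_negf)
  moreover have "bp m (bp n x) = 0"
  proof -
    let ?f = "\<lambda>l j. mu l m (mu j n x)"
    have *: "(\<Sum>j\<in>{0..k+1}. \<Sum>l\<in>{0..k}. ?f l j) = 0" if "-1 \<le> k" for k
      using that
    proof (induction k rule: int_ge_induct)
      case base
      then show ?case by simp
    next
      case (step k)
      have "(\<Sum>j\<in>{0..k+2}. \<Sum>l\<in>{0..k+1}. ?f l j) =
        (\<Sum>j\<in>{0..k+2}. (\<Sum>l\<in>{0..k}. ?f l j) + ?f (k + 1) j)"
        using step by (intro sum.cong) (auto simp: sum_int_last[of 0 "k + 1"])
      also have "\<dots> = (\<Sum>l\<in>{0..k}. ?f l (k + 2)) + (\<Sum>j\<in>{0..k+2}. ?f (k + 1) j)"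
        using step by (simp add: sum.distrib sum_int_last[of 0 "k + 2"] add.commute[of 1 k])
      also have "(\<Sum>j\<in>{0..k+2}. ?f (k + 1) j) = (\<Sum>j\<in>{0..k}. ?f (k + 1) j) + ?f (k + 1) (k + 1) + ?f (k + 1) (k + 2)"
        using step sum_int_last[of 0 "k + 2" "?f (k + 1)"] sum_int_last[of 0 "k + 1" "?f (k + 1)"]
        by (simp add: add.commute[of 1 k])
      also have "?f (k + 1) (k + 2) = - ?f (k + 1) (k + 1)"
        using mu_mu[of m n "k + 1" x] m by (simp add: add.commute)
      also have "(\<Sum>j\<in>{0..k}. ?f (k + 1) j) = - (\<Sum>j\<in>{0..k}. ?f j (k + 2))"
        using comm by (auto simp: add.commute simp flip: sum_negf intro!: sum.cong)
      finally show ?case using step.IH by (simp add: add.commute)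
    qed
    have "bp m (bp n x) = (\<Sum>j\<in>{0..n-1}. \<Sum>l\<in>{0..n-2}. ?f l j)"
      using m by (simp add: bp_sum bp_def[of n]) (simp add: bp_def)
    with *[of "n - 2"] True show ?thesis by simp
  qed
  moreover have "bd m (bd n x) = bp m (bp n x) + bp m (mu 0 n ?t) + mu 0 m (rot m 1 (bd n x))"
    unfolding bd_def[of m "bd n x"] using m by (simp add: bd_def[of n x] bp_add)
  ultimately show ?thesis using mu_mu[of m n 0 ?t] m by simp
next
  case False
  assume m: "m = n - 1"
  have "bd m y = 0" if "m \<le> 0" for y
    using that by (auto simp: bd_def bp_def ins_eq_0)
  moreover have "bd n x = 0" if "x \<notin> NN n"
    using that by (simp add: bd_def bp_def ins_eq_0 rot_def)
  ultimately show ?thesis using False m by fastforce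
qed

definition BB :: "int \<Rightarrow> 'n \<Rightarrow> 'n"
  where "BB n x = (let y = un 0 n (nrm n (n + 1) x) in y - rot (n + 1) 1 y)"

lemma BB_in [simp]: "m = n + 1 \<Longrightarrow> BB n x \<in> NN m"
  by (simp add: BB_def Let_def)

lemma BB_add: "x \<in> NN n \<Longrightarrow> y \<in> NN n \<Longrightarrow> BB n (x + y) = BB n x + BB n y"
  by (simp add: BB_def Let_def nrm_add ins_add rot_add)

lemma BB_minus: "BB n (- x) = - BB n x"
  by (simp add: BB_def Let_def nrm_minus ins_minus rot_minus)

lemma BB_diff: "x \<in> NN n \<Longrightarrow> y \<in> NN n \<Longrightarrow> BB n (x - y) = BB n x - BB n y"
  using BB_add[of x n "- y"] by (simp add: BB_minus)

lemma BB_0 [simp]: "BB n 0 = 0"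
  by (simp add: BB_def nrm_def)

lemma BB_sg: "BB n (sg k x) = sg k (BB n x)"
  by (simp add: sg_def BB_minus)

lemma BB_scale: "x \<in> NN n \<Longrightarrow> BB n (nscale M c x) = nscale M c (BB n x)"
  by (simp add: BB_def Let_def nrm_scale ins_scale rot_scale N.scale_right_diff_distrib)

lemma BB_rot: "x \<in> NN n \<Longrightarrow> BB n (x - rot n 1 x) = 0"
  by (simp add: BB_def nrm_add[of x n "- rot n 1 x", simplified] nrm_minus)

lemma BB_BB: "m = n + 1 \<Longrightarrow> BB m (BB n x) = 0"
  using BB_rot[of "un 0 n (nrm n (n + 1) x)" m] by (simp add: BB_def[of n] Let_def)

lemma bd_one_minus_rot:
  assumes "m = n - 1" "x \<in> NN n"
  shows "bd n (x - rot n 1 x) = bp n x - rot m 1 (bp n x)"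
proof (cases "0 < n")
  case True
  then show ?thesis using bp_rot[of n m x] assms by (simp add: bd_diff)
next
  case False
  then show ?thesis using assms by (simp add: bd_def bp_def ins_eq_0)
qed

lemma bd_BB:
  assumes x: "x \<in> NN n"
  shows "bd (n + 1) (BB n x) = - BB (n - 1) (bd n x)"
proof -
  let ?y = "nrm n (n + 1) x"
  have "bd (n + 1) (BB n x) = bp (n + 1) (un 0 n ?y) - rot n 1 (bp (n + 1) (un 0 n ?y))"
    by (simp add: BB_def Let_def bd_one_minus_rot)
  also have "bp (n + 1) (un 0 n ?y) = ?y - un 0 (n - 1) (bp n ?y)"
    using bp_un[of ?y n] by (simp add: algebra_simps)
  also have "bp n ?y = nrm (n - 1) n (bd n x)"
    using x by (simp add: bp_nrm)
  finally show ?thesis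
    using x by (simp add: BB_def Let_def rot_diff)
qed

text \<open>\<open>t s\<^sub>-\<^sub>1 N\<close> is null-homotopic; hence \<open>B\<close> is homotopic to \<open>s\<^sub>-\<^sub>1 N\<close> without normalisation.\<close>

lemma bd_un_un:
  assumes x: "x \<in> NN n" and y: "y = nrm n (n + 1) x"
  shows "bd (n + 2) (un 1 (n + 1) (un 1 n y))
    = un 1 n (un 1 (n - 1) (nrm (n - 1) n (bd n x))) - rot (n + 1) 1 (un 0 n y)"
proof (cases "0 \<le> n")
  case True
  have yN: "y \<in> NN n" using y by simp
  let ?w = "un 1 (n + 1) (un 1 n y)"
  have w2: "un 1 (n + 1) (un 1 n y) = - un 2 (n + 1) (un 1 n y)"
    using ins_comm[of 1 2 "n + 1" n 0 0 "opoint P" "opoint P" y] by (simp add: sg_def)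
  have m0: "mu 0 (n + 2) ?w = - un 1 n y"
    using mu_un'[of 0 "n + 1" "un 1 n y"] True by (simp add: add.commute)
  have m1: "mu 1 (n + 2) ?w = un 1 n y"
    using mu_un[of 1 "n + 1" "un 1 n y"] True by (simp add: add.commute)
  have mc: "mu l m (un 1 k z) = - un 1 (k - 1) (mu (l - 1) k z)" if "1 < l" "m = k + 1" for l m k z
    using that by (subst ins_comm) (auto simp: sg_def)
  have m3: "mu (l + 2) (n + 2) ?w = un 1 n (un 1 (n - 1) (mu l n y))" if "1 \<le> l" for l
    using that by (simp add: mc ins_minus)
  have shift: "(\<Sum>l\<in>{3..n+1}. mu l (n + 2) ?w) = un 1 n (un 1 (n - 1) (\<Sum>l\<in>{1..n-1}. mu l n y))"
    using sum_int_shift[of "\<lambda>l. mu l (n + 2) ?w" 2 1 "n - 1"]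
    by (simp add: m3 ins_sum add.commute[of 1 n])
  have r: "rot (n + 1) 1 (un 0 n y) = un 1 n y"
    using True yN x by (simp add: rot_ins1 y)
  show ?thesis
  proof (cases "0 < n")
    case n: True
    have m2: "mu 2 (n + 2) ?w = - un 1 n y"
      using mu_un[of 2 "n + 1" "un 1 n y"] n by (simp add: w2 ins_minus add.commute[of 2 n])
    have "rot (n + 2) 1 ?w = un 2 (n + 1) (un 2 n y)"
      using n x y by (simp add: rot_ins1)
    then have "mu 0 (n + 2) (rot (n + 2) 1 ?w) = un 1 n (un 1 (n - 1) (mu 0 n y))"
      using ins_comm[of 0 1 n "n + 1" 2 0 "opoint P" "omult P" "un 2 n y"]
        ins_comm[of 0 1 "n - 1" n 2 0 "opoint P" "omult P" y]
      by (simp add: sg_def ins_minus add.commute)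
    moreover have "bp (n + 2) ?w = mu 0 (n + 2) ?w + mu 1 (n + 2) ?w + mu 2 (n + 2) ?w + (\<Sum>l\<in>{3..n+1}. mu l (n + 2) ?w)"
      using n by (simp add: bp_def sum_int_head[of 0 "n + 1"] sum_int_head[of 1 "n + 1"] sum_int_head[of 2 "n + 1"] add.commute[of 1 n])
    moreover have "bp n y = mu 0 n y + (\<Sum>l\<in>{1..n-1}. mu l n y)"
      using n by (simp add: bp_def sum_int_head)
    ultimately show ?thesis
      unfolding bd_def[of "n + 2"] bp_nrm[OF x refl] y[symmetric] shift r m0 m1 m2
      by (simp add: ins_add)
  next
    case False
    then have n: "n = 0" using True by simp
    have "rot 1 1 (un 1 0 y) = un 0 0 y"
      using rot_ins_wrap[of 0 0 1 1 "opoint P" y] yN n by simp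
    then have "rot 2 1 ?w = un 2 1 (un 0 0 y)"
      using rot_ins1[of 1 0 1 2 "opoint P" "un 1 0 y"] n by simp
    moreover have "mu 0 2 (un 2 1 (un 0 0 y)) = - un 1 0 (mu 0 1 (un 0 0 y))"
      using ins_comm[of 0 1 0 1 2 0 "opoint P" "omult P" "un 0 0 y"] by (simp add: sg_def)
    moreover have "mu 0 1 (un 0 0 y) = y"
      using mu_un[of 0 0 y] yN n by simp
    moreover have "bd 0 x = 0" by (simp add: bd_def bp_def ins_eq_0)
    ultimately show ?thesis
      using m0 m1 r n by (simp add: bd_def[of 2] bp_def[of 2] simp_from_to)
  qed
next
  case False
  then show ?thesis using x y by (auto simp: zero_ext_space_def nrm_def)
qed

section \<open>Cocycles and the cap product\<close>

text \<open>
  The condition \<open>\<delta>\<phi> = 0\<close> as it is seen by the module.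
\<close>

definition cocyc :: "int \<Rightarrow> 'o \<Rightarrow> bool"
  where "cocyc p \<phi> \<longleftrightarrow> 0 \<le> p \<and> \<phi> \<in> OS p \<and>
    (\<forall>a n x. mu a (n + 1 - p) (ins p \<phi> a n x) + mu a (n + 1 - p) (ins p \<phi> (a + 1) n x)
      = sg (p + 1) (\<Sum>l\<in>{a..a+p-1}. ins p \<phi> a (n - 1) (mu l n x)))"

lemma mu_ins:
  "j < l \<Longrightarrow> m = n + 1 - p \<Longrightarrow> mu l m (ins p \<phi> j n x) = sg (p + 1) (ins p \<phi> j (n - 1) (mu (l + p - 1) n x))"
  by (subst ins_comm) (auto intro: sg_cong)

lemma ins_mu:
  "l < k \<Longrightarrow> m = n - 1 \<Longrightarrow> ins p \<phi> k m (mu l n x) = sg (p + 1) (mu l (n + 1 - p) (ins p \<phi> (k + 1) n x))"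
  by (subst ins_comm) (auto simp: add.commute[of 1] intro: sg_cong)

text \<open>
  A summation by parts behind all three homotopies: \<^term>\<open>y\<close> is constant for the commutativity of the cup
  product, and consists of the partial norms for the two Cartan formulas.
\<close>

lemma leibniz:
  assumes c: "cocyc q \<psi>" and y: "\<And>k. y k \<in> NN n" and m: "- 1 \<le> m" and r: "r = n + 1 - q"
  shows "(\<Sum>k\<in>{a..a+m+1}. \<Sum>l\<in>{a..a+m}. mu l r (ins q \<psi> k n (y k))) =
    sg (q + 1) (\<Sum>k\<in>{a..a+m}. ins q \<psi> k (n - 1)
      ((\<Sum>l\<in>{a..k-1}. mu l n (y (k + 1))) + (\<Sum>l\<in>{k..a+m+q-1}. mu l n (y k))))
    + (\<Sum>k\<in>{a..a+m}. mu k r (ins q \<psi> (k + 1) n (y (k + 1) - y k)))"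
  using m
proof (induction m rule: int_ge_induct)
  case base
  then show ?case by simp
next
  case (step m)
  have q: "0 \<le> q" using c by (simp add: cocyc_def)
  define K where "K = a + m + 1"
  have K: "a + (m + 1) + 1 = K + 1" "a + (m + 1) = K" "a + m = K - 1" "a + m + 1 = K" "a \<le> K"
    using step by (auto simp: K_def)
  let ?f = "\<lambda>k l. mu l r (ins q \<psi> k n (y k))"
  let ?g = "\<lambda>k u. ins q \<psi> k (n - 1)
      ((\<Sum>l\<in>{a..k-1}. mu l n (y (k + 1))) + (\<Sum>l\<in>{k..u}. mu l n (y k)))"
  have "(\<Sum>k\<in>{a..K+1}. \<Sum>l\<in>{a..K}. ?f k l) = (\<Sum>k\<in>{a..K}. (\<Sum>l\<in>{a..K-1}. ?f k l) + ?f k K) + (\<Sum>l\<in>{a..K}. ?f (K + 1) l)"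
    using K by (simp add: sum_int_last[of a "K + 1"] sum_int_last[of a K "\<lambda>l. mu l r _"])
  also have "\<dots> = (\<Sum>k\<in>{a..K}. \<Sum>l\<in>{a..K-1}. ?f k l) + (\<Sum>k\<in>{a..K-1}. ?f k K) + ?f K K
      + (\<Sum>l\<in>{a..K-1}. ?f (K + 1) l) + ?f (K + 1) K"
    using K by (simp add: sum.distrib sum_int_last[of a K "\<lambda>k. ?f k K"] sum_int_last[of a K "\<lambda>l. ?f (K + 1) l"])
  also have "(\<Sum>k\<in>{a..K-1}. ?f k K) = sg (q + 1) (\<Sum>k\<in>{a..K-1}. ins q \<psi> k (n - 1) (mu (K + q - 1) n (y k)))"
    using r unfolding sg_sum by (intro sum.cong refl mu_ins) auto
  also have "(\<Sum>l\<in>{a..K-1}. ?f (K + 1) l) = sg (q + 1) (ins q \<psi> K (n - 1) (\<Sum>l\<in>{a..K-1}. mu l n (y (K + 1))))"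
    using r by (auto simp: ins_sum sg_sum ins_mu intro!: sum.cong)
  finally have L: "(\<Sum>k\<in>{a..K+1}. \<Sum>l\<in>{a..K}. ?f k l) =
    (\<Sum>k\<in>{a..K}. \<Sum>l\<in>{a..K-1}. ?f k l) + sg (q + 1) (\<Sum>k\<in>{a..K-1}. ins q \<psi> k (n - 1) (mu (K + q - 1) n (y k)))
     + ?f K K + sg (q + 1) (ins q \<psi> K (n - 1) (\<Sum>l\<in>{a..K-1}. mu l n (y (K + 1)))) + ?f (K + 1) K" .
  have "?g k (K + q - 1) = ?g k (K - 1 + q - 1) + ins q \<psi> k (n - 1) (mu (K + q - 1) n (y k))"
    if "k \<in> {a..K-1}" for k
    using that q by (simp add: sum_int_last[of k "K + q - 1"] ins_add algebra_simps)
  then have "(\<Sum>k\<in>{a..K}. ?g k (K + q - 1)) = (\<Sum>k\<in>{a..K-1}. ?g k (K - 1 + q - 1))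
     + (\<Sum>k\<in>{a..K-1}. ins q \<psi> k (n - 1) (mu (K + q - 1) n (y k))) + ?g K (K + q - 1)"
    using K by (simp add: sum_int_last[of a K] sum.distrib)
  moreover have "?g K (K + q - 1) = ins q \<psi> K (n - 1) (\<Sum>l\<in>{a..K-1}. mu l n (y (K + 1)))
      + (\<Sum>l\<in>{K..K+q-1}. ins q \<psi> K (n - 1) (mu l n (y K)))"
    by (simp add: ins_add ins_sum)
  moreover have "sg (q + 1) (\<Sum>l\<in>{K..K+q-1}. ins q \<psi> K (n - 1) (mu l n (y K))) =
      ?f K K + mu K r (ins q \<psi> (K + 1) n (y K))"
    using c r by (simp add: cocyc_def)
  moreover have "mu K r (ins q \<psi> (K + 1) n (y (K + 1) - y K)) = ?f (K + 1) K - mu K r (ins q \<psi> (K + 1) n (y K))"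
    using y r by (simp add: ins_diff)
  ultimately show ?case
    using step.IH K unfolding K L
    by (simp add: sg_add sum_int_last[of a K "\<lambda>k. mu k r (ins q \<psi> (k + 1) n (y (k + 1) - y k))"])
qed

text \<open>
  \<open>(-1)\<^sup>p\<^sup>-\<^sup>1 i\<^sub>\<phi>\<close>, the sign being that of the insertion at position \<open>1\<close>.
\<close>

definition scap :: "int \<Rightarrow> 'o \<Rightarrow> int \<Rightarrow> 'n \<Rightarrow> 'n"
  where "scap p \<phi> n x = mu 0 (n + 1 - p) (ins p \<phi> 1 n x)"

lemma scap_in [simp]: "m = n - p \<Longrightarrow> scap p \<phi> n x \<in> NN m"
  by (simp add: scap_def)

lemma scap_add: "x \<in> NN n \<Longrightarrow> y \<in> NN n \<Longrightarrow> scap p \<phi> n (x + y) = scap p \<phi> n x + scap p \<phi> n y"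
  by (simp add: scap_def ins_add)

lemma scap_diff: "x \<in> NN n \<Longrightarrow> y \<in> NN n \<Longrightarrow> scap p \<phi> n (x - y) = scap p \<phi> n x - scap p \<phi> n y"
  by (simp add: scap_def ins_diff)

lemma scap_0 [simp]: "scap p \<phi> n 0 = 0"
  by (simp add: scap_def)

lemma scap_sg: "scap p \<phi> n (sg k x) = sg k (scap p \<phi> n x)"
  by (simp add: scap_def ins_sg)

lemma scap_minus: "scap p \<phi> n (- x) = - scap p \<phi> n x"
  by (simp add: scap_def ins_minus)

lemma scap_eq_0: "n < p \<Longrightarrow> scap p \<phi> n x = 0"
  by (simp add: scap_def ins_eq_0)

lemma bd_scap:
  assumes p: "0 \<le> p" and m: "m = n - p"
  shows "bd m (scap p \<phi> n x) = sg p (scap p \<phi> (n - 1) (bd n x))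
    - mu 0 m (mu 1 (n + 1 - p) (ins p \<phi> 1 n x) + mu 1 (n + 1 - p) (ins p \<phi> 2 n x)
      - sg (p + 1) (\<Sum>l\<in>{1..p}. ins p \<phi> 1 (n - 1) (mu l n x)))"
proof (cases "p < n")
  case True
  let ?r = "n + 1 - p" let ?t = "rot n 1 x"
  have i: "scap p \<phi> (n - 1) z = mu 0 m (ins p \<phi> 1 (n - 1) z)" for z
    by (simp add: scap_def m algebra_simps)
  have "mu l m (mu 0 ?r (ins p \<phi> 1 n x)) = - sg (p + 1) (mu 0 m (ins p \<phi> 1 (n - 1) (mu (l + p) n x)))"
    if "1 \<le> l" for l
  proof -
    have "mu l m (mu 0 ?r (ins p \<phi> 1 n x)) = - mu 0 m (mu (l + 1) ?r (ins p \<phi> 1 n x))"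
      using that m by (subst ins_comm) (auto simp: sg_def algebra_simps)
    then show ?thesis using that by (simp add: mu_ins ins_sg)
  qed
  then have "(\<Sum>l\<in>{1..m-1}. mu l m (mu 0 ?r (ins p \<phi> 1 n x)))
      = - sg (p + 1) (mu 0 m (ins p \<phi> 1 (n - 1) (\<Sum>l\<in>{1..m-1}. mu (l + p) n x)))"
    by (simp add: sum_negf sg_sum ins_sum m)
  also have "(\<Sum>l\<in>{1..m-1}. mu (l + p) n x) = (\<Sum>l\<in>{p+1..n-1}. mu l n x)"
    using sum_int_shift[of "\<lambda>l. mu l n x" p 1 "m - 1"] m by (simp add: add.commute)
  finally have a: "bp m (scap p \<phi> n x) = - mu 0 m (mu 1 ?r (ins p \<phi> 1 n x))
      - sg (p + 1) (mu 0 m (ins p \<phi> 1 (n - 1) (\<Sum>l\<in>{p+1..n-1}. mu l n x)))"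
    using True m mu_mu[of m ?r 0 "ins p \<phi> 1 n x"]
    by (simp add: bp_def scap_def sum_int_head[of 0 "n - p - 1"])
  have "rot m 1 (scap p \<phi> n x) = mu 1 ?r (ins p \<phi> 2 n ?t)"
    using True p m by (simp add: scap_def rot_ins1)
  then have "mu 0 m (rot m 1 (scap p \<phi> n x)) = - mu 0 m (mu 0 ?r (ins p \<phi> 2 n ?t))"
    using mu_mu[of m ?r 0 "ins p \<phi> 2 n ?t"] m by simp
  also have "\<dots> = - sg (p + 1) (mu 0 m (ins p \<phi> 1 (n - 1) (mu 0 n ?t)))"
    by (simp add: ins_mu ins_sg)
  finally have b: "mu 0 m (rot m 1 (scap p \<phi> n x)) = - sg (p + 1) (mu 0 m (ins p \<phi> 1 (n - 1) (mu 0 n ?t)))" .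
  have "bd n x = mu 0 n x + (\<Sum>l\<in>{1..p}. mu l n x) + (\<Sum>l\<in>{p+1..n-1}. mu l n x) + mu 0 n ?t"
    using True p sum_int_split[of 1 "p + 1" "n - 1" "\<lambda>l. mu l n x"]
    by (simp add: bd_def bp_def sum_int_head[of 0 "n - 1"] add.assoc)
  moreover have "mu 0 m (ins p \<phi> 1 (n - 1) (mu 0 n x)) = - sg (p + 1) (mu 0 m (mu 1 ?r (ins p \<phi> 2 n x)))"
    using mu_mu[of m ?r 0 "ins p \<phi> 2 n x"] m by (simp add: ins_mu ins_sg sg_minus)
  ultimately have c: "scap p \<phi> (n - 1) (bd n x) = - sg (p + 1) (mu 0 m (mu 1 ?r (ins p \<phi> 2 n x)))
     + mu 0 m (ins p \<phi> 1 (n - 1) (\<Sum>l\<in>{1..p}. mu l n x))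
     + mu 0 m (ins p \<phi> 1 (n - 1) (\<Sum>l\<in>{p+1..n-1}. mu l n x)) + mu 0 m (ins p \<phi> 1 (n - 1) (mu 0 n ?t))"
    unfolding i using m by (simp add: ins_add)
  show ?thesis
    unfolding bd_def[of m] a b c using m
    by (auto simp: ins_diff ins_add ins_minus ins_sg ins_sum sg_add sg_minus sg_def)
next
  case False
  have "bd m y = 0" for y using False m by (auto simp: bd_def bp_def ins_eq_0)
  moreover have "mu 0 m y = 0" for y using False m by (intro ins_eq_0) auto
  moreover have "scap p \<phi> (n - 1) z = 0" for z using False by (intro scap_eq_0) auto
  ultimately show ?thesis by simp
qed

lemma bd_scap_cocyc:
  assumes c: "cocyc p \<phi>" and m: "m = n - p"
  shows "bd m (scap p \<phi> n x) = sg p (scap p \<phi> (n - 1) (bd n x))"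
proof -
  have "mu 1 (n + 1 - p) (ins p \<phi> 1 n x) + mu 1 (n + 1 - p) (ins p \<phi> (1 + 1) n x)
      = sg (p + 1) (\<Sum>l\<in>{1..1+p-1}. ins p \<phi> 1 (n - 1) (mu l n x))"
    using c unfolding cocyc_def by blast
  then show ?thesis using c by (simp add: bd_scap[OF _ m] cocyc_def)
qed

definition brace :: "int \<Rightarrow> int \<Rightarrow> 'o \<Rightarrow> 'o \<Rightarrow> 'o"
  where "brace p q \<phi> \<psi> = (\<Sum>k\<in>{0..p-1}. circ p q k \<phi> \<psi>)"

lemma brace_in [simp]: "r = p + q - 1 \<Longrightarrow> brace p q \<phi> \<psi> \<in> OS r"
  by (simp add: brace_def)

lemma ins_brace:
  assumes "r = p + q - 1" and "m = n + 1 - q"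
  shows "ins r (brace p q \<phi> \<psi>) a n x = (\<Sum>k\<in>{a..a+p-1}. ins p \<phi> a m (ins q \<psi> k n x))"
proof -
  have "ins r (brace p q \<phi> \<psi>) a n x = (\<Sum>k\<in>{0..p-1}. ins p \<phi> a m (ins q \<psi> (k + a) n x))"
    unfolding brace_def using assms by (simp add: ins_op_sum ins_circ)
  then show ?thesis
    using sum_int_shift[of "\<lambda>k. ins p \<phi> a m (ins q \<psi> k n x)" a 0 "p - 1"]
    by (simp add: add.commute add_diff_eq)
qed

definition dact :: "int \<Rightarrow> 'o \<Rightarrow> int \<Rightarrow> int \<Rightarrow> 'n \<Rightarrow> 'n"
  where "dact p \<phi> a n x = mu a (n + 1 - p) (ins p \<phi> a n x) + mu a (n + 1 - p) (ins p \<phi> (a + 1) n x)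
      - sg (p + 1) (\<Sum>l\<in>{a..a+p-1}. ins p \<phi> a (n - 1) (mu l n x))"

text \<open>Gerstenhaber's homotopy for the commutativity of the cup product.\<close>

lemma dact_brace:
  assumes f: "cocyc p \<phi>" and g: "cocyc q \<psi>" and r: "r = p + q - 1"
  shows "dact r (brace p q \<phi> \<psi>) a n x =
    - mu a (n + 1 - r) (ins p \<phi> a (n + 1 - q) (ins q \<psi> (a + p) n x))
    - sg ((p + 1) * (q + 1)) (mu a (n + 1 - r) (ins q \<psi> a (n + 1 - p) (ins p \<phi> (a + q) n x)))"
proof (cases "x \<in> NN n")
  case x: True
  have p: "0 \<le> p" and q: "0 \<le> q" using f g by (auto simp: cocyc_def)
  let ?m = "n + 1 - q" let ?k = "n + 1 - r"
  let ?P = "\<lambda>k. ins q \<psi> k n x"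
  let ?G = "ins r (brace p q \<phi> \<psi>)"
  have d: "?m + 1 - p = ?k" "?m - 1 = n - 1 + 1 - q" using r by auto
  have "mu a ?k (ins p \<phi> a ?m z) + mu a ?k (ins p \<phi> (a + 1) ?m z)
      = sg (p + 1) (\<Sum>l\<in>{a..a+p-1}. ins p \<phi> a (?m - 1) (mu l ?m z))" for z
    using f unfolding cocyc_def d[symmetric] by blast
  then have "(\<Sum>k\<in>{a..a+p}. mu a ?k (ins p \<phi> a ?m (?P k))) + (\<Sum>k\<in>{a..a+p}. mu a ?k (ins p \<phi> (a + 1) ?m (?P k)))
      = sg (p + 1) (ins p \<phi> a (?m - 1) (\<Sum>k\<in>{a..a+p}. \<Sum>l\<in>{a..a+p-1}. mu l ?m (?P k)))"
    by (simp add: ins_sum sg_sum flip: sum.distrib)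
  also have "(\<Sum>k\<in>{a..a+p}. \<Sum>l\<in>{a..a+p-1}. mu l ?m (?P k))
      = sg (q + 1) (\<Sum>k\<in>{a..a+p-1}. ins q \<psi> k (n - 1) (\<Sum>l\<in>{a..a+p+q-2}. mu l n x))"
  proof -
    have "(\<Sum>l\<in>{a..k-1}. mu l n x) + (\<Sum>l\<in>{k..a+(p-1)+q-1}. mu l n x) = (\<Sum>l\<in>{a..a+p+q-2}. mu l n x)"
      if "k \<in> {a..a+p-1}" for k
      using that q sum_int_split[of a k "a+p+q-2" "\<lambda>l. mu l n x"] by (simp add: algebra_simps)
    then have "(\<Sum>k\<in>{a..a+(p-1)}. ins q \<psi> k (n - 1)
        ((\<Sum>l\<in>{a..k-1}. mu l n x) + (\<Sum>l\<in>{k..a+(p-1)+q-1}. mu l n x)))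
      = (\<Sum>k\<in>{a..a+p-1}. ins q \<psi> k (n - 1) (\<Sum>l\<in>{a..a+p+q-2}. mu l n x))"
      by (intro sum.cong) auto
    then show ?thesis
      using leibniz[OF g, of "\<lambda>_. x" n "p - 1" ?m a] p x by (simp add: add_diff_eq)
  qed
  also have "sg (p + 1) (ins p \<phi> a (?m - 1) \<dots>) = sg (r + 1) (\<Sum>l\<in>{a..a+r-1}. ?G a (n - 1) (mu l n x))"
  proof -
    have a: "a + r - 1 = a + p + q - 2" using r by simp
    have "(\<Sum>l\<in>{a..a+r-1}. ?G a (n - 1) (mu l n x)) = ?G a (n - 1) (\<Sum>l\<in>{a..a+p+q-2}. mu l n x)"
      unfolding a by (simp add: ins_sum)
    also have "\<dots> = ins p \<phi> a (?m - 1) (\<Sum>k\<in>{a..a+p-1}. ins q \<psi> k (n - 1) (\<Sum>l\<in>{a..a+p+q-2}. mu l n x))"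
      by (subst ins_brace[OF r, of "?m - 1"], simp, rule ins_sum[symmetric]) simp
    finally show ?thesis by (auto simp: ins_sg r intro!: sg_cong)
  qed
  finally have 1: "(\<Sum>k\<in>{a..a+p}. mu a ?k (ins p \<phi> a ?m (?P k))) + (\<Sum>k\<in>{a..a+p}. mu a ?k (ins p \<phi> (a + 1) ?m (?P k)))
      = sg (r + 1) (\<Sum>l\<in>{a..a+r-1}. ?G a (n - 1) (mu l n x))" .
  have 2: "mu a ?k (?G a n x) = (\<Sum>k\<in>{a..a+p-1}. mu a ?k (ins p \<phi> a ?m (?P k)))"
    "mu a ?k (?G (a + 1) n x) = (\<Sum>k\<in>{a+1..a+p}. mu a ?k (ins p \<phi> (a + 1) ?m (?P k)))"
    using r d by (simp_all add: ins_brace[OF r refl] ins_sum add.commute[of 1])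
  have 3: "ins p \<phi> (a + 1) ?m (?P a) = sg ((p + 1) * (q + 1)) (ins q \<psi> a (n + 1 - p) (ins p \<phi> (a + q) n x))"
    by (subst ins_comm) auto
  show ?thesis
    unfolding dact_def 2 1[symmetric]
    using p by (simp add: sum_int_last[of a "a + p" "\<lambda>k. mu a ?k (ins p \<phi> a ?m (?P k))"]
        sum_int_head[of a "a + p" "\<lambda>k. mu a ?k (ins p \<phi> (a + 1) ?m (?P k))"] 3 ins_sg)
next
  case False
  then have "ins p' \<phi>' i n x = 0" for p' \<phi>' i by (simp add: ins_eq_0)
  then show ?thesis by (simp add: dact_def)
qed

lemma cocyc_dact: "cocyc p \<phi> \<longleftrightarrow> 0 \<le> p \<and> \<phi> \<in> OS p \<and> (\<forall>a n x. dact p \<phi> a n x = 0)"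
  by (simp add: cocyc_def dact_def)

lemma dact_in [simp]: "m = n - p \<Longrightarrow> dact p \<phi> a n x \<in> NN m"
  by (simp add: dact_def)

lemma bd_scap_dact:
  assumes m: "m = n - p"
  shows "bd m (scap p \<phi> n x) = sg p (scap p \<phi> (n - 1) (bd n x)) - mu 0 m (dact p \<phi> 1 n x)"
proof (cases "0 \<le> p")
  case True
  then show ?thesis using m by (simp add: bd_scap dact_def)
next
  case False
  then show ?thesis by (simp add: scap_def dact_def ins_eq_0[of p])
qed

lemma scap_scap:
  "scap p \<phi> (n - q) (scap q \<psi> n x) =
    - sg (p + 1 + (p + 1) * (q + 1)) (mu 0 (n + 1 - q - p) (mu 1 (n + 2 - q - p)
      (ins q \<psi> 1 (n + 1 - p) (ins p \<phi> (q + 1) n x))))"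
proof -
  have d: "n - q + 1 - p = n + 1 - q - p" "n + 1 - q + 1 - p = n + 2 - q - p" by auto
  have "ins p \<phi> 1 (n - q) (mu 0 (n + 1 - q) (ins q \<psi> 1 n x))
      = sg (p + 1) (mu 0 (n + 2 - q - p) (ins p \<phi> 2 (n + 1 - q) (ins q \<psi> 1 n x)))"
    using ins_mu[of 0 1 "n - q" "n + 1 - q" p \<phi> "ins q \<psi> 1 n x"] unfolding d by simp
  moreover have "ins p \<phi> 2 (n + 1 - q) (ins q \<psi> 1 n x)
      = sg ((p + 1) * (q + 1)) (ins q \<psi> 1 (n + 1 - p) (ins p \<phi> (q + 1) n x))"
    by (subst ins_comm) (auto simp: add.commute)
  ultimately show ?thesis
    using mu_mu[of "n + 1 - q - p" "n + 2 - q - p" 0 "ins q \<psi> 1 (n + 1 - p) (ins p \<phi> (q + 1) n x)"]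
    unfolding scap_def d by (simp add: ins_sg sg_minus)
qed

lemma scap_commute:
  assumes f: "cocyc p \<phi>" and g: "cocyc q \<psi>" and x: "bd n x = 0"
  shows "scap p \<phi> (n - q) (scap q \<psi> n x) - sg (p * q) (scap q \<psi> (n - p) (scap p \<phi> n x))
    = - sg (p + 1) (bd (n + 1 - p - q) (scap (p + q - 1) (brace p q \<phi> \<psi>) n x))"
proof -
  define A where "A = mu 0 (n + 1 - p - q) (mu 1 (n + 2 - p - q) (ins p \<phi> 1 (n + 1 - q) (ins q \<psi> (p + 1) n x)))"
  define C where "C = mu 0 (n + 1 - q - p) (mu 1 (n + 2 - q - p) (ins q \<psi> 1 (n + 1 - p) (ins p \<phi> (q + 1) n x)))"
  have d: "n + 1 - q - p = n + 1 - p - q" "n + 2 - q - p = n + 2 - p - q" "n + 1 - (p + q - 1) = n + 2 - p - q"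
    by auto
  have "dact (p + q - 1) (brace p q \<phi> \<psi>) 1 n x =
    - mu 1 (n + 2 - p - q) (ins p \<phi> 1 (n + 1 - q) (ins q \<psi> (p + 1) n x))
    - sg ((p + 1) * (q + 1)) (mu 1 (n + 2 - p - q) (ins q \<psi> 1 (n + 1 - p) (ins p \<phi> (q + 1) n x)))"
    using dact_brace[OF f g refl, of 1 n x] by (simp only: d add.commute[of 1])
  then have "mu 0 (n + 1 - p - q) (dact (p + q - 1) (brace p q \<phi> \<psi>) 1 n x) = - A - sg ((p + 1) * (q + 1)) C"
    by (simp add: A_def C_def d ins_diff ins_minus ins_sg)
  then have "bd (n + 1 - p - q) (scap (p + q - 1) (brace p q \<phi> \<psi>) n x) = A + sg ((p + 1) * (q + 1)) C"
    using bd_scap_dact[of "n + 1 - p - q" n "p + q - 1" "brace p q \<phi> \<psi>" x] x by simp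
  moreover have "scap p \<phi> (n - q) (scap q \<psi> n x) = - sg (p + 1 + (p + 1) * (q + 1)) C"
    by (simp only: scap_scap C_def)
  moreover have "scap q \<psi> (n - p) (scap p \<phi> n x) = - sg (q + 1 + (p + 1) * (q + 1)) A"
    by (simp only: scap_scap A_def mult.commute)
  ultimately show ?thesis
    by (cases "even p"; cases "even q") (simp_all add: sg_def)
qed

definition gerst :: "int \<Rightarrow> int \<Rightarrow> 'o \<Rightarrow> 'o \<Rightarrow> 'o"
  where "gerst p q \<phi> \<psi> = brace q p \<psi> \<phi> - sg ((p + 1) * (q + 1)) (brace p q \<phi> \<psi>)"

lemma gerst_in: "gerst p q \<phi> \<psi> \<in> OS (p + q - 1)"
  by (simp add: gerst_def)

lemma dact_op_diff: "\<phi> \<in> OS p \<Longrightarrow> \<psi> \<in> OS p \<Longrightarrow> dact p (\<phi> - \<psi>) a n x = dact p \<phi> a n x - dact p \<psi> a n x"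
  by (simp add: dact_def ins_op_diff ins_diff sum_subtractf sg_diff)

lemma dact_op_sg: "\<phi> \<in> OS p \<Longrightarrow> dact p (sg k \<phi>) a n x = sg k (dact p \<phi> a n x)"
  by (simp add: dact_def ins_op_sg ins_sg sg_sum sg_add sg_diff add.commute)

lemma cocyc_gerst:
  assumes f: "cocyc p \<phi>" and g: "cocyc q \<psi>" and pq: "0 < p + q"
  shows "cocyc (p + q - 1) (gerst p q \<phi> \<psi>)"
  unfolding cocyc_dact
proof (intro conjI allI)
  fix a n x
  show "dact (p + q - 1) (gerst p q \<phi> \<psi>) a n x = 0"
    unfolding gerst_def
    by (subst dact_op_diff, simp, simp, subst dact_op_sg, simp, subst dact_brace[OF g f], simp,
        subst dact_brace[OF f g], simp) (cases "even p"; cases "even q"; simp add: sg_def)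
qed (use pq gerst_in in auto)

section \<open>The Cartan formulas\<close>

definition ext_deg :: "int \<Rightarrow> 'n \<Rightarrow> 'n"
  where "ext_deg n y = un 0 n y - rot (n + 1) 1 (un 0 n y)"

lemma ext_deg_in [simp]: "m = n + 1 \<Longrightarrow> ext_deg n y \<in> NN m"
  by (simp add: ext_deg_def)

lemma BB_ext_deg: "BB n x = ext_deg n (nrm n (n + 1) x)"
  by (simp add: BB_def ext_deg_def Let_def)

lemma bd_ext_deg:
  "y \<in> NN n \<Longrightarrow> bd (n + 1) (ext_deg n y) = y - rot n 1 y - ext_deg (n - 1) (bp n y)"
proof -
  assume y: "y \<in> NN n"
  have "bp (n + 1) (un 0 n y) = y - un 0 (n - 1) (bp n y)"
    using bp_un[OF y] by (simp add: algebra_simps)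
  then show ?thesis
    using y by (simp add: ext_deg_def bd_one_minus_rot rot_diff)
qed

text \<open>
  Insertions of \<open>\<phi>\<close> after the letter \<open>x\<^sub>0\<close>, over all rotations of \<open>x\<close>: in \<open>nrm n i x\<close> the
  letter \<open>x\<^sub>0\<close> is at a position before \<open>i\<close>.
\<close>

definition Cartan_sum :: "int \<Rightarrow> 'o \<Rightarrow> int \<Rightarrow> 'n \<Rightarrow> 'n"
  where "Cartan_sum p \<phi> n x = (\<Sum>i\<in>{0..n+1-p}. ins p \<phi> i n (nrm n i x))"

lemma Cartan_sum_in [simp]: "m = n + 1 - p \<Longrightarrow> Cartan_sum p \<phi> n x \<in> NN m"
  by (simp add: Cartan_sum_def)

lemma bp_Cartan_sum:
  assumes c: "cocyc p \<phi>" and x: "x \<in> NN n"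
  shows "bp (n + 1 - p) (Cartan_sum p \<phi> n x)
    = sg (p + 1) (Cartan_sum p \<phi> (n - 1) (bd n x)) + nrm (n - p) (n - p + 1) (scap p \<phi> n x)"
proof (cases "p \<le> n + 1")
  case True
  let ?m = "n - p" let ?r = "n + 1 - p"
  have p: "0 \<le> p" using c by (simp add: cocyc_def)
  have d: "n + 1 - p - 1 = ?m" "?m + 1 - 1 = ?m" "n - 1 + 1 - p = ?m" by auto
  have "bp ?r (Cartan_sum p \<phi> n x) = (\<Sum>k\<in>{0..0+?m+1}. \<Sum>l\<in>{0..0+?m}. mu l ?r (ins p \<phi> k n (nrm n k x)))"
    by (simp add: Cartan_sum_def bp_sum) (simp add: bp_def algebra_simps)
  also have "\<dots> = sg (p + 1) (\<Sum>k\<in>{0..0+?m}. ins p \<phi> k (n - 1)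
      ((\<Sum>l\<in>{0..k-1}. mu l n (nrm n (k + 1) x)) + (\<Sum>l\<in>{k..0+?m+p-1}. mu l n (nrm n k x))))
    + (\<Sum>k\<in>{0..0+?m}. mu k ?r (ins p \<phi> (k + 1) n (nrm n (k + 1) x - nrm n k x)))"
    by (rule leibniz[OF c]) (use True in auto)
  also have "(\<Sum>k\<in>{0..0+?m}. ins p \<phi> k (n - 1)
      ((\<Sum>l\<in>{0..k-1}. mu l n (nrm n (k + 1) x)) + (\<Sum>l\<in>{k..0+?m+p-1}. mu l n (nrm n k x))))
     = Cartan_sum p \<phi> (n - 1) (bd n x)"
    unfolding Cartan_sum_def d using p by (intro sum.cong) (auto simp: nrm_bd)
  also have "(\<Sum>k\<in>{0..0+?m}. mu k ?r (ins p \<phi> (k + 1) n (nrm n (k + 1) x - nrm n k x)))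
     = (\<Sum>k\<in>{0..?m}. rot ?m k (scap p \<phi> n x))"
  proof (rule sum.cong)
    fix k assume k: "k \<in> {0..?m}"
    have "rot ?m k (scap p \<phi> n x) = mu (0 + k) ?r (rot ?r k (ins p \<phi> 1 n x))"
      unfolding scap_def by (rule rot_ins) (use k in auto)
    also have "rot ?r k (ins p \<phi> 1 n x) = ins p \<phi> (k + 1) n (rot n k x)"
      using k rot_ins[of 1 k p n ?r \<phi> x] by (simp add: add.commute)
    finally show "mu k ?r (ins p \<phi> (k + 1) n (nrm n (k + 1) x - nrm n k x)) = rot ?m k (scap p \<phi> n x)"
      using k by (simp add: nrm_Suc)
  qed simp
  finally show ?thesis by (simp add: nrm_def)
next
  case False
  then have "bp (n + 1 - p) y = 0" "Cartan_sum p \<phi> (n - 1) y = 0" "scap p \<phi> n y = 0" for y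
    by (auto simp: bp_def Cartan_sum_def scap_eq_0)
  then show ?thesis by (simp add: nrm_def)
qed

text \<open>
  The Lie derivative; in the second summand \<open>\<phi>\<close> wraps around \<open>x\<^sub>0\<close>.
\<close>

definition Lie_chain :: "int \<Rightarrow> 'o \<Rightarrow> int \<Rightarrow> 'n \<Rightarrow> 'n"
  where "Lie_chain p \<phi> n x = (\<Sum>i\<in>{1..n+1-p}. ins p \<phi> i n x) + ins p \<phi> 0 n (nrm n p x)"

lemma Cartan_sum_rot:
  assumes p: "0 \<le> p" and x: "x \<in> NN n"
  shows "Cartan_sum p \<phi> n x - rot (n + 1 - p) 1 (Cartan_sum p \<phi> n x) = Lie_chain p \<phi> n x - ins p \<phi> 0 n (nrm n (n + 1) x)"
proof (cases "p \<le> n")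
  case True
  let ?m = "n + 1 - p"
  have "rot ?m 1 (Cartan_sum p \<phi> n x) = (\<Sum>i\<in>{0..n-p}. rot ?m 1 (ins p \<phi> i n (nrm n i x)))
      + rot ?m 1 (ins p \<phi> ?m n (nrm n ?m x))"
    using True by (simp add: Cartan_sum_def rot_sum rot_add sum_int_last[of 0 ?m])
  also have "rot ?m 1 (ins p \<phi> ?m n (nrm n ?m x)) = ins p \<phi> 0 n (nrm n (n + 1) x) - ins p \<phi> 0 n (nrm n p x)"
  proof -
    have "rot n p (nrm n ?m x) = (\<Sum>j\<in>{p..n}. rot n j x)"
      using sum_int_shift[of "\<lambda>j. rot n j x" p 0 "n - p"] by (simp add: nrm_def rot_sum add.commute)
    then have "nrm n (n + 1) x = nrm n p x + rot n p (nrm n ?m x)"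
      using True p sum_int_split[of 0 p n "\<lambda>j. rot n j x"] by (simp add: nrm_def)
    then show ?thesis
      using True p by (simp add: rot_ins_wrap ins_add)
  qed
  also have "(\<Sum>i\<in>{0..n-p}. rot ?m 1 (ins p \<phi> i n (nrm n i x)))
      = (\<Sum>i\<in>{0..n-p}. ins p \<phi> (i + 1) n (nrm n (i + 1) x - x))"
  proof (rule sum.cong)
    fix i assume i: "i \<in> {0..n-p}"
    then have "rot n 1 (nrm n i x) = nrm n (i + 1) x - x" using nrm_rec[of i x n] x by simp
    moreover have "rot ?m 1 (ins p \<phi> i n (nrm n i x)) = ins p \<phi> (i + 1) n (rot n 1 (nrm n i x))"
      using i by (intro rot_ins1) auto
    ultimately show "rot ?m 1 (ins p \<phi> i n (nrm n i x)) = ins p \<phi> (i + 1) n (nrm n (i + 1) x - x)"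
      by simp
  qed simp
  also have "\<dots> = (\<Sum>i\<in>{1..?m}. ins p \<phi> i n (nrm n i x)) - (\<Sum>i\<in>{1..?m}. ins p \<phi> i n x)"
    using sum_int_shift[of "\<lambda>i. ins p \<phi> i n (nrm n i x - x)" 1 0 "n - p"] x
    by (simp add: ins_diff sum_subtractf algebra_simps)
  finally show ?thesis
    using True by (simp add: Lie_chain_def Cartan_sum_def[of p \<phi> n x] sum_int_head[of 0 ?m])
next
  case False
  then have "nrm n (n + 1) x = nrm n p x" if "p = n + 1" using that by simp
  moreover have "ins p \<phi> 0 n y = 0" if "p \<noteq> n + 1" for y
    using False that by (intro ins_eq_0) auto
  ultimately show ?thesis
    using False by (cases "p = n + 1") (auto simp: Cartan_sum_def Lie_chain_def)
qed

lemma scap_un: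
  assumes "y \<in> NN n"
  shows "scap p \<phi> (n + 1) (un 0 n y) = sg (p + 1) (ins p \<phi> 0 n y)"
proof (cases "p \<le> n + 1")
  case True
  have "ins p \<phi> 1 (n + 1) (un 0 n y) = sg (p + 1) (un 0 (n + 1 - p) (ins p \<phi> 0 n y))"
    by (subst ins_comm) auto
  then show ?thesis
    using True mu_un[of 0 "n + 1 - p" "ins p \<phi> 0 n y"] by (simp add: scap_def ins_sg algebra_simps)
qed (simp add: scap_eq_0 ins_eq_0)

lemma Cartan:
  assumes c: "cocyc p \<phi>" and x: "x \<in> NN n" "bd n x = 0"
  shows "\<exists>y\<in>NN (n + 2 - p). Lie_chain p \<phi> n x
    = BB (n - p) (scap p \<phi> n x) + sg (p + 1) (scap p \<phi> (n + 1) (BB n x)) + bd (n + 2 - p) y"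
proof -
  have p: "0 \<le> p" using c by (simp add: cocyc_def)
  let ?s = "un 0 n (nrm n (n + 1) x)"
  let ?W = "un 1 (n + 1) (un 1 n (nrm n (n + 1) x))"
  let ?m = "n + 1 - p"
  have d: "?m + 1 = n + 2 - p" "?m - 1 = n - p" by auto
  have "Cartan_sum p \<phi> (n - 1) 0 = 0" by (simp add: Cartan_sum_def nrm_def)
  then have "bp ?m (Cartan_sum p \<phi> n x) = nrm (n - p) (n - p + 1) (scap p \<phi> n x)"
    using bp_Cartan_sum[OF c x(1)] x(2) by simp
  then have "bd (n + 2 - p) (ext_deg ?m (Cartan_sum p \<phi> n x)) = Lie_chain p \<phi> n x - ins p \<phi> 0 n (nrm n (n + 1) x) - BB (n - p) (scap p \<phi> n x)"
    using bd_ext_deg[of "Cartan_sum p \<phi> n x" ?m] Cartan_sum_rot[OF p x(1), of \<phi>] unfolding d BB_ext_deg by simp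
  moreover have "ins p \<phi> 0 n (nrm n (n + 1) x) = sg (p + 1) (scap p \<phi> (n + 1) ?s)"
    by (simp add: scap_un)
  moreover have "scap p \<phi> (n + 1) ?s = scap p \<phi> (n + 1) (BB n x) + scap p \<phi> (n + 1) (rot (n + 1) 1 ?s)"
    by (simp add: BB_def Let_def flip: scap_add)
  moreover have "rot (n + 1) 1 ?s = - bd (n + 2) ?W"
    using bd_un_un[OF x(1) refl] x(2) by (simp add: nrm_def)
  moreover have "scap p \<phi> (n + 1) (bd (n + 2) ?W) = sg p (bd (n + 2 - p) (scap p \<phi> (n + 2) ?W))"
    using bd_scap_cocyc[OF c, of "n + 2 - p" "n + 2" ?W] by (simp add: add.commute)
  ultimately have "Lie_chain p \<phi> n x = BB (n - p) (scap p \<phi> n x) + sg (p + 1) (scap p \<phi> (n + 1) (BB n x))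
      + bd (n + 2 - p) (ext_deg ?m (Cartan_sum p \<phi> n x) + scap p \<phi> (n + 2) ?W)"
    by (auto simp: scap_minus bd_add sg_def)
  then show ?thesis by (intro bexI[of _ "ext_deg ?m (Cartan_sum p \<phi> n x) + scap p \<phi> (n + 2) ?W"]) auto
qed

text \<open>
  Here \<open>\<phi>\<close> wraps around \<open>x\<^sub>0\<close>, and \<open>\<psi>\<close> is inserted into \<open>\<phi>\<close> after \<open>x\<^sub>0\<close>.
\<close>

definition bracket_homotopy :: "int \<Rightarrow> 'o \<Rightarrow> int \<Rightarrow> 'o \<Rightarrow> int \<Rightarrow> 'n \<Rightarrow> 'n"
  where "bracket_homotopy p \<phi> q \<psi> n x = (\<Sum>k\<in>{0..p-1}. ins p \<phi> 0 (n + 1 - q) (ins q \<psi> k n (nrm n k x)))"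

lemma bracket_homotopy_in [simp]: "m = n + 2 - p - q \<Longrightarrow> bracket_homotopy p \<phi> q \<psi> n x \<in> NN m"
  by (simp add: bracket_homotopy_def)

lemma scap_Lie_chain:
  assumes f: "cocyc p \<phi>" and g: "cocyc q \<psi>" and x: "x \<in> NN n" "bd n x = 0"
  shows "scap q \<psi> (n + 1 - p) (Lie_chain p \<phi> n x) - sg (p + 1 + (p + 1) * (q + 1)) (Lie_chain p \<phi> (n - q) (scap q \<psi> n x))
    = scap (p + q - 1) (gerst p q \<phi> \<psi>) n x - sg ((p + 1) * (q + 1)) (bd (n + 2 - p - q) (bracket_homotopy p \<phi> q \<psi> n x))"
proof (cases "p + q \<le> n + 1")
  case False
  define m where "m = n + 1 - p - q"
  have "NN m = {0}" using False m_def by (intro NN_neg) auto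
  moreover have "scap q \<psi> (n + 1 - p) (Lie_chain p \<phi> n x) \<in> NN m" "Lie_chain p \<phi> (n - q) (scap q \<psi> n x) \<in> NN m"
    "scap (p + q - 1) (gerst p q \<phi> \<psi>) n x \<in> NN m" "bd (n + 2 - p - q) (bracket_homotopy p \<phi> q \<psi> n x) \<in> NN m"
    by (simp_all add: m_def Lie_chain_def)
  ultimately show ?thesis by simp
next
  case True
  have p: "0 \<le> p" and q: "0 \<le> q" using f g by (auto simp: cocyc_def)
  let ?r = "n + 1 - q" let ?t = "n + 2 - p - q" let ?m = "n + 1 - p - q"
  let ?N = "\<lambda>k. nrm n k x"
  let ?P = "\<lambda>k y. ins q \<psi> k n y"
  let ?s = "(p + 1) * (q + 1)"
  have Iq: "scap q \<psi> (n + 1 - p) z = mu 0 ?t (ins q \<psi> 1 (n + 1 - p) z)" for z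
  proof -
    have "n + 1 - p + 1 - q = ?t" by simp
    then show ?thesis by (simp only: scap_def)
  qed
  have Ir: "scap (p + q - 1) \<chi> n x = mu 0 ?t (ins (p + q - 1) \<chi> 1 n x)" for \<chi>
  proof -
    have "n + 1 - (p + q - 1) = ?t" by simp
    then show ?thesis by (simp only: scap_def)
  qed
  have d: "?r + 1 - p = ?t" "?t - 1 = ?m" "n - 1 + 1 - q = n - q" "n - q + 1 - p = ?m" "n + 1 - p + 1 - q = ?t" by auto
  have F: "mu 0 ?t (ins p \<phi> 0 ?r z) + mu 0 ?t (ins p \<phi> 1 ?r z)
      = sg (p + 1) (ins p \<phi> 0 (n - q) (\<Sum>l\<in>{0..p-1}. mu l ?r z))" for z
  proof -
    have "mu 0 (?r + 1 - p) (ins p \<phi> 0 ?r z) + mu 0 (?r + 1 - p) (ins p \<phi> (0 + 1) ?r z)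
      = sg (p + 1) (\<Sum>l\<in>{0..0+p-1}. ins p \<phi> 0 (?r - 1) (mu l ?r z))"
      using f unfolding cocyc_def by blast
    then show ?thesis unfolding d by (simp add: ins_sum)
  qed
  have Z: "(\<Sum>k\<in>{0..p}. mu 0 ?t (ins p \<phi> 0 ?r (?P k (?N k)))) + (\<Sum>k\<in>{0..p}. mu 0 ?t (ins p \<phi> 1 ?r (?P k (?N k))))
    = sg (p + 1) (ins p \<phi> 0 (n - q) (\<Sum>k\<in>{0..p}. \<Sum>l\<in>{0..p-1}. mu l ?r (?P k (?N k))))"
    by (simp add: F ins_sum sg_sum flip: sum.distrib)
  have Z1: "(\<Sum>k\<in>{0..p}. mu 0 ?t (ins p \<phi> 0 ?r (?P k (?N k))))
     = mu 0 ?t (bracket_homotopy p \<phi> q \<psi> n x) + sg ?s (scap q \<psi> (n + 1 - p) (ins p \<phi> 0 n (?N p)))"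
  proof -
    have "ins p \<phi> 0 ?r (?P p (?N p)) = sg ?s (ins q \<psi> 1 (n + 1 - p) (ins p \<phi> 0 n (?N p)))"
      using ins_comm[of 0 1 "n + 1 - p" n p q \<psi> \<phi> "?N p"] by (simp add: mult.commute)
    then show ?thesis
      using p by (simp add: sum_int_last bracket_homotopy_def ins_sum ins_add Iq ins_sg)
  qed
  have Z2: "(\<Sum>k\<in>{0..p}. mu 0 ?t (ins p \<phi> 1 ?r (?P k (?N k))))
     = scap (p + q - 1) (brace p q \<phi> \<psi>) n x + mu 0 ?t (rot ?t 1 (bracket_homotopy p \<phi> q \<psi> n x))"
  proof -
    have "rot ?t 1 (ins p \<phi> 0 ?r (?P k (?N k))) = ins p \<phi> 1 ?r (?P (k + 1) (?N (k + 1) - x))"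
      if k: "k \<in> {0..p-1}" for k
    proof -
      have "rot ?t 1 (ins p \<phi> 0 ?r (?P k (?N k))) = ins p \<phi> 1 ?r (rot ?r 1 (?P k (?N k)))"
        using True rot_ins1[of 0 p ?r ?t] by (simp add: d)
      also have "rot ?r 1 (?P k (?N k)) = ?P (k + 1) (rot n 1 (?N k))"
        using True k by (intro rot_ins1) auto
      also have "rot n 1 (?N k) = ?N (k + 1) - x" using nrm_rec[of k x n] x k by simp
      finally show ?thesis .
    qed
    then have "rot ?t 1 (bracket_homotopy p \<phi> q \<psi> n x) = (\<Sum>k\<in>{0..p-1}. ins p \<phi> 1 ?r (?P (k + 1) (?N (k + 1) - x)))"
      by (simp add: bracket_homotopy_def rot_sum d)
    also have "\<dots> = (\<Sum>k\<in>{1..p}. ins p \<phi> 1 ?r (?P k (?N k))) - (\<Sum>k\<in>{1..p}. ins p \<phi> 1 ?r (?P k x))"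
      using sum_int_shift[of "\<lambda>k. ins p \<phi> 1 ?r (?P k (?N k - x))" 1 0 "p - 1"] x
      by (simp add: ins_diff sum_subtractf)
    also have "(\<Sum>k\<in>{1..p}. ins p \<phi> 1 ?r (?P k x)) = ins (p + q - 1) (brace p q \<phi> \<psi>) 1 n x"
      by (simp add: ins_brace)
    finally have "mu 0 ?t (rot ?t 1 (bracket_homotopy p \<phi> q \<psi> n x)) = mu 0 ?t (\<Sum>k\<in>{1..p}. ins p \<phi> 1 ?r (?P k (?N k)))
        - mu 0 ?t (ins (p + q - 1) (brace p q \<phi> \<psi>) 1 n x)"
      by (simp add: ins_diff)
    moreover have "(\<Sum>k\<in>{0..p}. mu 0 ?t (ins p \<phi> 1 ?r (?P k (?N k)))) = mu 0 ?t (\<Sum>k\<in>{1..p}. ins p \<phi> 1 ?r (?P k (?N k)))"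
      using p by (simp add: sum_int_head ins_sum)
    ultimately show ?thesis by (simp add: Ir)
  qed
  have Z3: "ins p \<phi> 0 (n - q) (\<Sum>k\<in>{0..p}. \<Sum>l\<in>{0..p-1}. mu l ?r (?P k (?N k)))
     = - sg (p + 1) (\<Sum>l\<in>{1..?t-1}. mu l ?t (bracket_homotopy p \<phi> q \<psi> n x)) + ins p \<phi> 0 (n - q) (nrm (n - q) p (scap q \<psi> n x))"
  proof -
    have W: "(\<Sum>k\<in>{0..0+(p-1)+1}. \<Sum>l\<in>{0..0+(p-1)}. mu l ?r (?P k (?N k)))
       = sg (q + 1) (\<Sum>k\<in>{0..0+(p-1)}. ins q \<psi> k (n - 1)
          ((\<Sum>l\<in>{0..k-1}. mu l n (?N (k + 1))) + (\<Sum>l\<in>{k..0+(p-1)+q-1}. mu l n (?N k))))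
       + (\<Sum>k\<in>{0..0+(p-1)}. mu k ?r (ins q \<psi> (k + 1) n (?N (k + 1) - ?N k)))"
      by (rule leibniz[OF g]) (use p in auto)
    have Y: "(\<Sum>k\<in>{0..0+(p-1)}. mu k ?r (ins q \<psi> (k + 1) n (?N (k + 1) - ?N k))) = nrm (n - q) p (scap q \<psi> n x)"
    proof -
      have "nrm (n - q) p (scap q \<psi> n x) = (\<Sum>k\<in>{0..p-1}. rot (n - q) k (scap q \<psi> n x))"
        by (simp add: nrm_def)
      also have "\<dots> = (\<Sum>k\<in>{0..0+(p-1)}. mu k ?r (ins q \<psi> (k + 1) n (?N (k + 1) - ?N k)))"
      proof (rule sum.cong)
      fix k assume k: "k \<in> {0..0+(p-1)}"
      have "rot (n - q) k (scap q \<psi> n x) = mu (0 + k) ?r (rot ?r k (ins q \<psi> 1 n x))"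
        unfolding scap_def by (rule rot_ins) (use k True in auto)
      also have "rot ?r k (ins q \<psi> 1 n x) = ins q \<psi> (k + 1) n (rot n k x)"
        using k True rot_ins[of 1 k q n ?r \<psi> x] by (simp add: add.commute)
      finally show "rot (n - q) k (scap q \<psi> n x) = mu k ?r (ins q \<psi> (k + 1) n (?N (k + 1) - ?N k))"
        using k by (simp add: nrm_Suc)
      qed simp
      finally show ?thesis ..
    qed
    have X: "(\<Sum>k\<in>{0..0+(p-1)}. ins q \<psi> k (n - 1)
          ((\<Sum>l\<in>{0..k-1}. mu l n (?N (k + 1))) + (\<Sum>l\<in>{k..0+(p-1)+q-1}. mu l n (?N k))))
      = - (\<Sum>k\<in>{0..p-1}. \<Sum>l\<in>{p+q-1..n-1}. ins q \<psi> k (n - 1) (mu l n (?N k)))"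
      unfolding sum_negf[symmetric]
    proof (rule sum.cong)
      fix k assume k: "k \<in> {0..p-1}"
      have "0 = nrm (n - 1) k (bd n x)" using x(2) by (simp add: nrm_def)
      also have "\<dots> = (\<Sum>l\<in>{0..k-1}. mu l n (?N (k + 1))) + (\<Sum>l\<in>{k..n-1}. mu l n (?N k))"
        using k True q by (intro nrm_bd) auto
      also have "(\<Sum>l\<in>{k..n-1}. mu l n (?N k)) = (\<Sum>l\<in>{k..p+q-2}. mu l n (?N k)) + (\<Sum>l\<in>{p+q-1..n-1}. mu l n (?N k))"
        using k True q sum_int_split[of k "p + q - 1" "n - 1" "\<lambda>l. mu l n (?N k)"] by simp
      finally have "(\<Sum>l\<in>{0..k-1}. mu l n (?N (k + 1))) + (\<Sum>l\<in>{k..p+q-2}. mu l n (?N k)) = - (\<Sum>l\<in>{p+q-1..n-1}. mu l n (?N k))"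
        by (simp add: algebra_simps eq_neg_iff_add_eq_0)
      moreover have "0 + (p - 1) + q - 1 = p + q - 2" by simp
      ultimately show "ins q \<psi> k (n - 1) ((\<Sum>l\<in>{0..k-1}. mu l n (?N (k + 1))) + (\<Sum>l\<in>{k..0+(p-1)+q-1}. mu l n (?N k)))
        = (\<Sum>l\<in>{p+q-1..n-1}. - ins q \<psi> k (n - 1) (mu l n (?N k)))"
        by (simp only: ins_minus) (simp add: ins_sum sum_negf)
    qed simp
    have "ins p \<phi> 0 (n - q) (\<Sum>k\<in>{0..p}. \<Sum>l\<in>{0..p-1}. mu l ?r (?P k (?N k)))
      = - sg (q + 1) (\<Sum>k\<in>{0..p-1}. \<Sum>l\<in>{p+q-1..n-1}. ins p \<phi> 0 (n - q) (ins q \<psi> k (n - 1) (mu l n (?N k))))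
        + ins p \<phi> 0 (n - q) (nrm (n - q) p (scap q \<psi> n x))"
      using W unfolding X Y by (simp add: ins_diff ins_add ins_minus ins_sg ins_sum sg_minus)
    also have "(\<Sum>k\<in>{0..p-1}. \<Sum>l\<in>{p+q-1..n-1}. ins p \<phi> 0 (n - q) (ins q \<psi> k (n - 1) (mu l n (?N k))))
      = (\<Sum>k\<in>{0..p-1}. \<Sum>l\<in>{1..?t-1}. sg (p + q) (mu l ?t (ins p \<phi> 0 ?r (?P k (?N k)))))"
    proof (rule sum.cong)
      fix k assume k: "k \<in> {0..p-1}"
      have "(\<Sum>l\<in>{p+q-1..n-1}. ins p \<phi> 0 (n - q) (ins q \<psi> k (n - 1) (mu l n (?N k))))
        = (\<Sum>l\<in>{1..?t-1}. ins p \<phi> 0 (n - q) (ins q \<psi> k (n - 1) (mu (l + (p + q - 2)) n (?N k))))"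
        using sum_int_shift[of "\<lambda>l. ins p \<phi> 0 (n - q) (ins q \<psi> k (n - 1) (mu l n (?N k)))" "p + q - 2" 1 "?t - 1"]
        by (simp add: algebra_simps)
      also have "\<dots> = (\<Sum>l\<in>{1..?t-1}. sg (p + q) (mu l ?t (ins p \<phi> 0 ?r (?P k (?N k)))))"
      proof (rule sum.cong)
        fix l assume l: "l \<in> {1..?t-1}"
        have "mu l ?t (ins p \<phi> 0 ?r (?P k (?N k))) = sg (p + 1) (ins p \<phi> 0 (?r - 1) (mu (l + p - 1) ?r (?P k (?N k))))"
          using l by (intro mu_ins) (auto simp: d)
        also have "mu (l + p - 1) ?r (?P k (?N k)) = sg (q + 1) (ins q \<psi> k (n - 1) (mu (l + p - 1 + q - 1) n (?N k)))"
          using l k by (intro mu_ins) auto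
        finally have "mu l ?t (ins p \<phi> 0 ?r (?P k (?N k)))
          = sg (p + q) (ins p \<phi> 0 (n - q) (ins q \<psi> k (n - 1) (mu (l + (p + q - 2)) n (?N k))))"
          by (auto simp: ins_sg algebra_simps intro!: sg_cong)
        then show "ins p \<phi> 0 (n - q) (ins q \<psi> k (n - 1) (mu (l + (p + q - 2)) n (?N k)))
          = sg (p + q) (mu l ?t (ins p \<phi> 0 ?r (?P k (?N k))))" by simp
      qed simp
      finally show "(\<Sum>l\<in>{p+q-1..n-1}. ins p \<phi> 0 (n - q) (ins q \<psi> k (n - 1) (mu l n (?N k))))
        = (\<Sum>l\<in>{1..?t-1}. sg (p + q) (mu l ?t (ins p \<phi> 0 ?r (?P k (?N k)))))" .
    qed simp
    also have "\<dots> = sg (p + q) (\<Sum>l\<in>{1..?t-1}. mu l ?t (bracket_homotopy p \<phi> q \<psi> n x))"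
      by (subst sum.swap) (simp add: bracket_homotopy_def ins_sum sg_sum d)
    finally show ?thesis by (auto simp: sg_def)
  qed
  have b: "bd ?t (bracket_homotopy p \<phi> q \<psi> n x) = mu 0 ?t (bracket_homotopy p \<phi> q \<psi> n x) + (\<Sum>l\<in>{1..?t-1}. mu l ?t (bracket_homotopy p \<phi> q \<psi> n x))
     + mu 0 ?t (rot ?t 1 (bracket_homotopy p \<phi> q \<psi> n x))"
    using True sum_int_head[of 0 "?t - 1" "\<lambda>l. mu l ?t (bracket_homotopy p \<phi> q \<psi> n x)"]
    by (simp add: bd_def bp_def)
  have wrapped: "bd ?t (bracket_homotopy p \<phi> q \<psi> n x) + sg ?s (scap q \<psi> (n + 1 - p) (ins p \<phi> 0 n (?N p)))
      + scap (p + q - 1) (brace p q \<phi> \<psi>) n x = sg (p + 1) (ins p \<phi> 0 (n - q) (nrm (n - q) p (scap q \<psi> n x)))"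
    using Z unfolding Z1 Z2 Z3 b by (simp add: sg_add sg_diff sg_minus algebra_simps)
  have unwrapped: "sg (p + 1 + ?s) (\<Sum>i\<in>{1..n-q+1-p}. ins p \<phi> i (n - q) (scap q \<psi> n x))
      = scap q \<psi> (n + 1 - p) (\<Sum>i\<in>{1..n+1-p}. ins p \<phi> i n x) - scap (p + q - 1) (brace q p \<psi> \<phi>) n x"
  proof -
    have "ins p \<phi> i (n - q) (scap q \<psi> n x) = sg (p + 1 + ?s) (mu 0 ?t (ins q \<psi> 1 (n + 1 - p) (ins p \<phi> (i + q) n x)))"
      if "1 \<le> i" for i
    proof -
      have "ins p \<phi> i (n - q) (scap q \<psi> n x) = sg (p + 1) (mu 0 (?r + 1 - p) (ins p \<phi> (i + 1) ?r (ins q \<psi> 1 n x)))"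
        unfolding scap_def using that by (intro ins_mu) auto
      also have "ins p \<phi> (i + 1) ?r (ins q \<psi> 1 n x) = sg ?s (ins q \<psi> 1 (n + 1 - p) (ins p \<phi> (i + 1 + q - 1) n x))"
        using that by (intro ins_comm) auto
      finally show ?thesis unfolding d by (simp add: ins_sg)
    qed
    then have "sg (p + 1 + ?s) (\<Sum>i\<in>{1..n-q+1-p}. ins p \<phi> i (n - q) (scap q \<psi> n x))
        = (\<Sum>i\<in>{1..n-q+1-p}. mu 0 ?t (ins q \<psi> 1 (n + 1 - p) (ins p \<phi> (i + q) n x)))"
      by (simp add: sg_sum)
    also have "\<dots> = (\<Sum>i\<in>{q+1..n+1-p}. mu 0 ?t (ins q \<psi> 1 (n + 1 - p) (ins p \<phi> i n x)))"
      using sum_int_shift[of "\<lambda>i. mu 0 ?t (ins q \<psi> 1 (n + 1 - p) (ins p \<phi> i n x))" q 1 "n-q+1-p"]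
      by (simp add: algebra_simps)
    finally have "sg (p + 1 + ?s) (\<Sum>i\<in>{1..n-q+1-p}. ins p \<phi> i (n - q) (scap q \<psi> n x))
      = (\<Sum>i\<in>{q+1..n+1-p}. mu 0 ?t (ins q \<psi> 1 (n + 1 - p) (ins p \<phi> i n x)))" .
    moreover have "scap q \<psi> (n + 1 - p) (\<Sum>i\<in>{1..n+1-p}. ins p \<phi> i n x)
      = (\<Sum>i\<in>{1..n+1-p}. mu 0 ?t (ins q \<psi> 1 (n + 1 - p) (ins p \<phi> i n x)))"
      by (simp add: Iq ins_sum)
    moreover have "scap (p + q - 1) (brace q p \<psi> \<phi>) n x
      = (\<Sum>i\<in>{1..q}. mu 0 ?t (ins q \<psi> 1 (n + 1 - p) (ins p \<phi> i n x)))"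
      by (simp add: Ir ins_brace[of _ q p "n + 1 - p"] ins_sum)
    ultimately show ?thesis
      using True q sum_int_split[of 1 "q + 1" "n + 1 - p" "\<lambda>i. mu 0 ?t (ins q \<psi> 1 (n + 1 - p) (ins p \<phi> i n x))"] by simp
  qed
  have g1: "scap (p + q - 1) (gerst p q \<phi> \<psi>) n x = scap (p + q - 1) (brace q p \<psi> \<phi>) n x - sg ?s (scap (p + q - 1) (brace p q \<phi> \<psi>) n x)"
    by (simp add: gerst_def scap_def ins_op_diff ins_op_sg ins_diff ins_sg)
  have g2: "scap q \<psi> (n + 1 - p) (Lie_chain p \<phi> n x) = scap q \<psi> (n + 1 - p) (\<Sum>i\<in>{1..n+1-p}. ins p \<phi> i n x)
      + scap q \<psi> (n + 1 - p) (ins p \<phi> 0 n (?N p))"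
    by (simp add: Lie_chain_def scap_add)
  have w: "sg ?s (bd ?t (bracket_homotopy p \<phi> q \<psi> n x)) + scap q \<psi> (n + 1 - p) (ins p \<phi> 0 n (?N p))
      + sg ?s (scap (p + q - 1) (brace p q \<phi> \<psi>) n x)
      = sg (p + 1 + ?s) (ins p \<phi> 0 (n - q) (nrm (n - q) p (scap q \<psi> n x)))"
  proof -
    have "sg ?s (sg ?s y) = y" "sg ?s (sg (p + 1) y) = sg (p + 1 + ?s) y" for y :: 'n
      by (simp, simp only: sg_sg add.commute)
    then show ?thesis using arg_cong[OF wrapped, of "sg ?s"] by (simp only: sg_add)
  qed
  show ?thesis
    unfolding g1 g2 Lie_chain_def[of p \<phi> "n - q"] sg_add unwrapped w[symmetric] by simp
qed

section \<open>Operators on homology\<close>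

definition bounds :: "int \<Rightarrow> 'n set"
  where "bounds n = bd (n + 1) ` NN (n + 1)"

definition hom :: "int \<Rightarrow> 'n \<Rightarrow> 'n \<Rightarrow> bool"
  where "hom n x y \<longleftrightarrow> x - y \<in> bounds n"

lemma bimI: "m = n + 1 \<Longrightarrow> y \<in> NN m \<Longrightarrow> bd m y \<in> bounds n"
  by (simp add: bounds_def)

lemma bounds_subspace: "N.subspace (bounds n)"
  unfolding N.subspace_def
proof (intro conjI ballI allI)
  show "0 \<in> bounds n" using bimI[of "n + 1" n 0] by simp
next
  fix x y assume "x \<in> bounds n" "y \<in> bounds n"
  then show "x + y \<in> bounds n" by (auto simp: bounds_def bd_add[symmetric])
next
  fix c x assume "x \<in> bounds n"
  then show "nscale M c x \<in> bounds n" by (auto simp: bounds_def bd_scale[symmetric])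
qed

lemmas bounds_closed [simp] = N.subspace_0[OF bounds_subspace] N.subspace_add[OF bounds_subspace]
  N.subspace_diff[OF bounds_subspace] N.subspace_neg[OF bounds_subspace] N.subspace_sg[OF bounds_subspace]
  N.subspace_scale[OF bounds_subspace]

lemma bounds_cycle: "x \<in> bounds n \<Longrightarrow> x \<in> NN n \<and> bd n x = 0"
  by (auto simp: bounds_def bd_bd)

lemma hom_refl [simp]: "hom n x x"
  by (simp add: hom_def)

lemma hom_sym: "hom n x y \<Longrightarrow> hom n y x"
  using bounds_closed(4)[of "x - y" n] by (simp add: hom_def)

lemma hom_trans [trans]: "hom n x y \<Longrightarrow> hom n y z \<Longrightarrow> hom n x z"
  using bounds_closed(2)[of "x - y" n "y - z"] by (simp add: hom_def)

lemma hom_add: "hom n x y \<Longrightarrow> hom n x' y' \<Longrightarrow> hom n (x + x') (y + y')"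
  using bounds_closed(2)[of "x - y" n "x' - y'"] by (simp add: hom_def algebra_simps)

lemma hom_diff: "hom n x y \<Longrightarrow> hom n x' y' \<Longrightarrow> hom n (x - x') (y - y')"
  using bounds_closed(3)[of "x - y" n "x' - y'"] by (simp add: hom_def algebra_simps)

lemma hom_sg: "hom n x y \<Longrightarrow> hom n (sg k x) (sg k y)"
  using bounds_closed(5)[of "x - y" n k] by (simp add: hom_def sg_diff)

lemma hom_0_iff: "hom n x 0 \<longleftrightarrow> x \<in> bounds n"
  by (simp add: hom_def)

lemma hom_BB:
  assumes "hom n x y" "x \<in> NN n" "y \<in> NN n" and m: "m = n + 1"
  shows "hom m (BB n x) (BB n y)"
proof -
  obtain h where h: "h \<in> NN (n + 1)" "x - y = bd (n + 1) h"
    using assms by (auto simp: hom_def bounds_def)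
  have "BB n x - BB n y = BB n (x - y)" using assms by (simp add: BB_diff)
  also have "\<dots> = bd (n + 2) (- BB (n + 1) h)"
    using bd_BB[OF h(1)] h by (simp add: bd_minus add.commute)
  also have "\<dots> \<in> bounds (n + 1)" by (intro bimI) auto
  finally show ?thesis by (simp add: hom_def m)
qed

definition capn :: "int \<Rightarrow> 'o \<Rightarrow> int \<Rightarrow> 'n \<Rightarrow> 'n"
  where "capn p \<phi> n x = sg (p + 1) (scap p \<phi> n x)"

lemma capn_in [simp]: "m = n - p \<Longrightarrow> capn p \<phi> n x \<in> NN m"
  by (simp add: capn_def)

lemma capn_add: "x \<in> NN n \<Longrightarrow> y \<in> NN n \<Longrightarrow> capn p \<phi> n (x + y) = capn p \<phi> n x + capn p \<phi> n y"
  by (simp add: capn_def scap_add sg_add)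

lemma capn_diff: "x \<in> NN n \<Longrightarrow> y \<in> NN n \<Longrightarrow> capn p \<phi> n (x - y) = capn p \<phi> n x - capn p \<phi> n y"
  by (simp add: capn_def scap_diff sg_diff)

lemma capn_sg: "capn p \<phi> n (sg k x) = sg k (capn p \<phi> n x)"
  by (simp add: capn_def scap_sg add.commute)

lemma capn_scale: "x \<in> NN n \<Longrightarrow> capn p \<phi> n (nscale M c x) = nscale M c (capn p \<phi> n x)"
  by (simp add: capn_def scap_def ins_scale N.scale_sg)

lemma capn_0 [simp]: "capn p \<phi> n 0 = 0"
  by (simp add: capn_def)

lemma capn_op_0 [simp]: "capn p 0 n x = 0"
  by (simp add: capn_def scap_def)

lemma capn_op_add: "\<phi> \<in> OS p \<Longrightarrow> \<psi> \<in> OS p \<Longrightarrow> capn p (\<phi> + \<psi>) n x = capn p \<phi> n x + capn p \<psi> n x"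
  by (simp add: capn_def scap_def ins_op_add ins_add sg_add)

lemma capn_neg: "p < 0 \<Longrightarrow> capn p \<phi> n x = 0"
  by (simp add: capn_def scap_def ins_eq_0)

lemma bd_capn:
  assumes "cocyc p \<phi>" "m = n - p"
  shows "bd m (capn p \<phi> n x) = sg p (capn p \<phi> (n - 1) (bd n x))"
  using bd_scap_cocyc[OF assms, of x] by (simp add: capn_def bd_sg add_ac)

lemma capn_hom:
  assumes c: "cocyc p \<phi>" and "hom n x y" "x \<in> NN n" "y \<in> NN n" and m: "m = n - p"
  shows "hom m (capn p \<phi> n x) (capn p \<phi> n y)"
proof -
  obtain h where h: "h \<in> NN (n + 1)" "x - y = bd (n + 1) h"
    using assms by (auto simp: hom_def bounds_def)
  have "capn p \<phi> n x - capn p \<phi> n y = capn p \<phi> n (bd (n + 1) h)"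
    using assms by (simp add: h(2)[symmetric] capn_diff)
  also have "\<dots> = bd (n + 1 - p) (sg p (capn p \<phi> (n + 1) h))"
    using bd_capn[OF c refl, of "n + 1" h] by (simp add: bd_sg)
  also have "\<dots> \<in> bounds m" using m by (intro bimI) auto
  finally show ?thesis by (simp add: hom_def)
qed

lemma capn_commute:
  assumes "cocyc p \<phi>" "cocyc q \<psi>" "bd n x = 0" and m: "m = n - p - q"
  shows "hom m (capn p \<phi> (n - q) (capn q \<psi> n x)) (sg (p * q) (capn q \<psi> (n - p) (capn p \<phi> n x)))"
proof -
  have "scap p \<phi> (n - q) (scap q \<psi> n x) - sg (p * q) (scap q \<psi> (n - p) (scap p \<phi> n x)) \<in> bounds m"
    unfolding scap_commute[OF assms(1-3)]
    using m by (intro bounds_closed bimI) auto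
  then have "sg (p + q) (scap p \<phi> (n - q) (scap q \<psi> n x) - sg (p * q) (scap q \<psi> (n - p) (scap p \<phi> n x))) \<in> bounds m"
    by simp
  moreover have "capn p \<phi> (n - q) (capn q \<psi> n x) = sg (p + q) (scap p \<phi> (n - q) (scap q \<psi> n x))"
    "capn q \<psi> (n - p) (capn p \<phi> n x) = sg (p + q) (scap q \<psi> (n - p) (scap p \<phi> n x))"
    by (auto simp: capn_def scap_sg intro!: sg_cong)
  ultimately show ?thesis by (simp add: hom_def sg_diff add.commute)
qed

definition Lie :: "int \<Rightarrow> 'o \<Rightarrow> int \<Rightarrow> 'n \<Rightarrow> 'n"
  where "Lie p \<phi> n x = BB (n - p) (capn p \<phi> n x) - sg p (capn p \<phi> (n + 1) (BB n x))"

lemma Lie_in [simp]: "m = n + 1 - p \<Longrightarrow> Lie p \<phi> n x \<in> NN m"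
  by (simp add: Lie_def)

lemma Lie_Lie_chain:
  assumes "cocyc p \<phi>" "x \<in> NN n" "bd n x = 0" and m: "m = n + 1 - p"
  shows "hom m (Lie p \<phi> n x) (sg (p + 1) (Lie_chain p \<phi> n x))"
proof -
  obtain y where y: "y \<in> NN (n + 2 - p)" "Lie_chain p \<phi> n x
    = BB (n - p) (scap p \<phi> n x) + sg (p + 1) (scap p \<phi> (n + 1) (BB n x)) + bd (n + 2 - p) y"
    using Cartan[OF assms(1-3)] by blast
  then have "Lie p \<phi> n x - sg (p + 1) (Lie_chain p \<phi> n x) = - sg (p + 1) (bd (n + 2 - p) y)"
    by (auto simp: Lie_def capn_def BB_minus sg_def)
  also have "\<dots> \<in> bounds m" using m y by (intro bounds_closed bimI) auto
  finally show ?thesis by (simp add: hom_def)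
qed

lemma Lie_chain_sg: "Lie_chain p \<phi> n (sg k x) = sg k (Lie_chain p \<phi> n x)"
  by (simp add: Lie_chain_def sg_def ins_minus nrm_minus sum_negf)

lemma Lie_chain_in [simp]: "m = n + 1 - p \<Longrightarrow> Lie_chain p \<phi> n x \<in> NN m"
  by (simp add: Lie_chain_def)

lemma Lie_capn:
  assumes f: "cocyc p \<phi>" and g: "cocyc q \<psi>" and x: "x \<in> NN n" "bd n x = 0" and m: "m = n + 1 - p - q"
  shows "hom m (Lie p \<phi> (n - q) (capn q \<psi> n x))
    (sg ((p + 1) * q) (capn q \<psi> (n + 1 - p) (Lie p \<phi> n x) - capn (p + q - 1) (gerst p q \<phi> \<psi>) n x))"
proof -
  let ?s = "(p + 1) * (q + 1)"
  let ?T = "bd (n + 2 - p - q) (bracket_homotopy p \<phi> q \<psi> n x)"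
  have "hom m (Lie p \<phi> (n - q) (capn q \<psi> n x)) (sg (p + 1) (Lie_chain p \<phi> (n - q) (capn q \<psi> n x)))"
    using bd_capn[OF g refl, of n x] x by (intro Lie_Lie_chain[OF f]) (auto simp: m)
  also have "sg (p + 1) (Lie_chain p \<phi> (n - q) (capn q \<psi> n x)) = sg (p + q) (Lie_chain p \<phi> (n - q) (scap q \<psi> n x))"
    by (auto simp: capn_def Lie_chain_sg intro!: sg_cong)
  also have "\<dots> = sg ((p + 1) * q) (capn q \<psi> (n + 1 - p) (sg (p + 1) (Lie_chain p \<phi> n x))
      - capn (p + q - 1) (gerst p q \<phi> \<psi>) n x) + sg (q + 1) ?T"
  proof -
    have a: "scap (p + q - 1) (gerst p q \<phi> \<psi>) n x = scap q \<psi> (n + 1 - p) (Lie_chain p \<phi> n x)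
      - sg (p + 1 + ?s) (Lie_chain p \<phi> (n - q) (scap q \<psi> n x)) + sg ?s ?T"
      using scap_Lie_chain[OF f g x] by simp
    show ?thesis unfolding capn_def scap_sg a
      by (cases "even p"; cases "even q") (simp_all add: sg_def)
  qed
  also have "hom m \<dots> (sg ((p + 1) * q) (capn q \<psi> (n + 1 - p) (Lie p \<phi> n x)
      - capn (p + q - 1) (gerst p q \<phi> \<psi>) n x) + 0)"
  proof (intro hom_add hom_sg hom_diff hom_refl capn_hom[OF g])
    show "hom (n + 1 - p) (sg (p + 1) (Lie_chain p \<phi> n x)) (Lie p \<phi> n x)"
      by (rule hom_sym[OF Lie_Lie_chain[OF f x refl]])
    show "hom m (sg (q + 1) ?T) 0"
      unfolding hom_0_iff using m by (intro bounds_closed bimI) auto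
  qed (auto simp: m)
  finally show ?thesis by simp
qed

lemma hom_cong_minus: "hom n x y \<Longrightarrow> hom n (- x) (- y)"
  using hom_diff[of n 0 0 x y] by simp

text \<open>
  The hypotheses hold for classes in the image of \<open>\<pi>\<close>, for which the seven-term relation
  thus loses its first order terms.  As \<open>\<beta>\<close> kills the left-hand side, applying \<open>\<beta>\<close> gives the Jacobi identity.
\<close>

lemma second_order:
  assumes f: "cocyc p \<phi>" and g: "cocyc q \<psi>" and h: "cocyc r \<chi>"
    and z: "\<zeta> \<in> NN d" "bd d \<zeta> = 0" and B: "hom (d + 1) (BB d \<zeta>) 0"
    and Bf: "hom (d - p + 1) (BB (d - p) (capn p \<phi> d \<zeta>)) 0"
    and Bg: "hom (d - q + 1) (BB (d - q) (capn q \<psi> d \<zeta>)) 0"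
    and Bh: "hom (d - r + 1) (BB (d - r) (capn r \<chi> d \<zeta>)) 0"
    and m: "m = d + 1 - p - q - r"
  shows "hom m (BB (d - p - q - r) (capn p \<phi> (d - q - r) (capn q \<psi> (d - r) (capn r \<chi> d \<zeta>))))
    (sg p (capn p \<phi> (d + 1 - q - r) (BB (d - q - r) (capn q \<psi> (d - r) (capn r \<chi> d \<zeta>))))
      + sg ((p + q + 1) * r) (capn r \<chi> (d + 1 - p - q) (BB (d - p - q) (capn p \<phi> (d - q) (capn q \<psi> d \<zeta>))))
      + sg ((p + 1) * q) (capn q \<psi> (d + 1 - p - r) (BB (d - p - r) (capn p \<phi> (d - r) (capn r \<chi> d \<zeta>)))))"
    (is "hom m ?BABC (sg p ?A + sg _ ?C + sg _ ?D)")
proof -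
  let ?x = "capn r \<chi> d \<zeta>" and ?k = "p + q - 1"
  have x: "?x \<in> NN (d - r)" "bd (d - r) ?x = 0"
    using bd_capn[OF h refl, of d \<zeta>] z by auto
  have Lie0: "hom (d + 1 - p - q) (Lie p \<phi> (d - q) (capn q \<psi> d \<zeta>)) (BB (d - p - q) (capn p \<phi> (d - q) (capn q \<psi> d \<zeta>)))"
    if "cocyc q \<psi>" and Bg: "hom (d - q + 1) (BB (d - q) (capn q \<psi> d \<zeta>)) 0" for q \<psi>
  proof -
    have "hom (d + 1 - p - q) (Lie p \<phi> (d - q) (capn q \<psi> d \<zeta>))
      (BB (d - q - p) (capn p \<phi> (d - q) (capn q \<psi> d \<zeta>)) - sg p (capn p \<phi> (d - q + 1) 0))"
      unfolding Lie_def by (intro hom_diff hom_sg hom_refl capn_hom[OF f] Bg) auto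
    then show ?thesis by (simp add: algebra_simps)
  qed
  have Liez: "hom (d + 1 - p) (Lie p \<phi> d \<zeta>) 0"
  proof -
    have "hom (d + 1 - p) (Lie p \<phi> d \<zeta>) (0 - sg p (capn p \<phi> (d + 1) 0))"
      unfolding Lie_def using Bf by (intro hom_diff hom_sg capn_hom[OF f] B) (auto simp: algebra_simps)
    then show ?thesis by simp
  qed
  let ?g = "capn ?k (gerst p q \<phi> \<psi>)"
  have gz: "hom (d + 1 - p - q) (?g d \<zeta>) (- sg ((p + 1) * q) (BB (d - p - q) (capn p \<phi> (d - q) (capn q \<psi> d \<zeta>))))"
  proof -
    let ?l = "Lie p \<phi> (d - q) (capn q \<psi> d \<zeta>)" and ?n = "d + 1 - p - q"
    have "hom ?n ?l (sg ((p + 1) * q) (capn q \<psi> (d + 1 - p) (Lie p \<phi> d \<zeta>) - ?g d \<zeta>))"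
      by (rule Lie_capn[OF f g z refl])
    also have "hom ?n \<dots> (sg ((p + 1) * q) (capn q \<psi> (d + 1 - p) 0 - ?g d \<zeta>))"
      by (intro hom_sg hom_diff hom_refl capn_hom[OF g] Liez) auto
    finally have "hom ?n ?l (- sg ((p + 1) * q) (?g d \<zeta>))" by (simp add: sg_minus)
    from hom_sg[OF hom_cong_minus[OF this], of "(p + 1) * q"]
    have "hom ?n (?g d \<zeta>) (sg ((p + 1) * q) (- ?l))"
      by (simp add: hom_sym)
    also have "hom ?n \<dots> (sg ((p + 1) * q) (- BB (d - p - q) (capn p \<phi> (d - q) (capn q \<psi> d \<zeta>))))"
      by (intro hom_sg hom_cong_minus Lie0 g Bg)
    finally show ?thesis by (simp add: sg_minus)
  qed
  have gx: "hom m (?g (d - r) ?x) (sg (?k * r) (capn r \<chi> (d - ?k) (?g d \<zeta>)))"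
  proof (cases "0 < p + q")
    case True
    then show ?thesis
      using capn_commute[OF cocyc_gerst[OF f g True] h z(2), of m] m by simp
  next
    case False
    then have "?k < 0" by simp
    then show ?thesis by (simp add: capn_neg)
  qed
  also have "hom m \<dots> (sg (?k * r) (capn r \<chi> (d + 1 - p - q)
      (- sg ((p + 1) * q) (BB (d - p - q) (capn p \<phi> (d - q) (capn q \<psi> d \<zeta>))))))"
  proof -
    have e: "d - ?k = d + 1 - p - q" by simp
    show ?thesis unfolding e using gz m by (intro hom_sg capn_hom[OF h]) auto
  qed
  also have "\<dots> = - sg ((p + 1) * q + (p + q + 1) * r) ?C"
  proof -
    have "capn r \<chi> n (- y) = - capn r \<chi> n y" for n y using capn_sg[of r \<chi> n 1 y] by (simp add: sg_def)
    then show ?thesis by (auto simp: capn_sg sg_minus intro!: sg_cong)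
  qed
  finally have gx': "hom m (?g (d - r) ?x) (- sg ((p + 1) * q + (p + q + 1) * r) ?C)" .
  have "hom m (Lie p \<phi> (d - r - q) (capn q \<psi> (d - r) ?x))
    (sg ((p + 1) * q) (capn q \<psi> (d - r + 1 - p) (Lie p \<phi> (d - r) ?x) - ?g (d - r) ?x))"
    using m by (intro Lie_capn[OF f g x]) auto
  also have "hom m \<dots> (sg ((p + 1) * q) (?D - (- sg ((p + 1) * q + (p + q + 1) * r) ?C)))"
  proof (intro hom_sg hom_diff gx')
    have e: "d - r + 1 - p = d + 1 - p - r" by simp
    show "hom m (capn q \<psi> (d - r + 1 - p) (Lie p \<phi> (d - r) ?x)) ?D"
      unfolding e using Lie0[OF h Bh] m by (intro capn_hom[OF g]) auto
  qed
  also have "\<dots> = sg ((p + q + 1) * r) ?C + sg ((p + 1) * q) ?D"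
    by (simp add: sg_add) (auto intro: sg_cong)
  finally have "hom m (Lie p \<phi> (d - r - q) (capn q \<psi> (d - r) ?x) + sg p ?A) (sg ((p + q + 1) * r) ?C + sg ((p + 1) * q) ?D + sg p ?A)"
    by (rule hom_add[OF _ hom_refl])
  moreover have "Lie p \<phi> (d - r - q) (capn q \<psi> (d - r) ?x) + sg p ?A = ?BABC"
  proof -
    have e: "d - r - q = d - q - r" "d - q - r - p = d - p - q - r" "d - q - r + 1 = d + 1 - q - r" by auto
    show ?thesis unfolding Lie_def e by simp
  qed
  ultimately show ?thesis by (simp add: algebra_simps)
qed

lemma bounds_diff_closed [simp]: "diff_closed (bounds n)"
  by (simp add: diff_closed_def)

lemma bdiff_eq: "x \<in> NN k \<Longrightarrow> zero_ext_map (bdiff P M) k x = bd k x"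
proof (cases "0 < k")
  case True
  assume "x \<in> NN k"
  with True obtain n where n: "k = int n" "0 < n" and x: "x \<in> nspace M n"
    by (metis NN_nat nat_0_le order_less_imp_le of_nat_0_less_iff)
  have r: "rot (int n) 1 x = sg (int n) (cyc M n x)"
    using rot_nat[OF x, of 1] by simp
  have c: "cyc M n x \<in> nspace M n" using cyc_in[OF x, of 1] by simp
  have m: "ins 2 (omult P) (int i) (int n) y = sg (int i) (act M 2 n i (omult P) y)"
    if "i < n" "y \<in> nspace M n" for i y
    using ins_nat[of "omult P" 2 y n i] that omult_in by (auto intro: sg_cong)
  have "bd k x = (\<Sum>i<n. mu (int i) k x) + mu 0 k (rot k 1 x)"
    by (simp add: bd_def bp_def n sum_int_nat)
  also have "(\<Sum>i<n. mu (int i) k x) = (\<Sum>i<n. nscale M ((-1) ^ i) (face P M n i x))"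
    using x by (intro sum.cong) (auto simp: n m face_def N.scale_sign)
  also have "mu 0 k (rot k 1 x) = nscale M ((-1) ^ n) (face P M n n x)"
    using m[of 0 "cyc M n x"] n c by (simp add: r ins_sg face_def N.scale_sign)
  finally show ?thesis
    using n by (simp add: zero_ext_map_def bdiff_def lessThan_Suc_atMost[symmetric])
next
  case False
  then show ?thesis by (auto simp: zero_ext_map_def bdiff_def bd_def bp_def ins_eq_0)
qed

lemma Connes_eq: "x \<in> NN k \<Longrightarrow> zero_ext_map (Connes_B P M) k x = BB k x"
proof (cases "0 \<le> k")
  case True
  assume "x \<in> NN k"
  with True obtain n where n: "k = int n" and x: "x \<in> nspace M n"
    by (metis NN_nat nat_0_le)
  have "nrm k (k + 1) x = (\<Sum>i<n+1. rot k (int i) x)"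
    unfolding nrm_def n using sum_int_nat[of "\<lambda>j. rot (int n) j x" "n + 1"] by (simp add: add.commute)
  also have "\<dots> = cyc_norm M n x"
    unfolding cyc_norm_def by (rule sum.cong) (auto simp: n rot_nat x N.scale_sign mult.commute)
  finally have N: "nrm k (k + 1) x = cyc_norm M n x" .
  have "cyc_norm M n x \<in> nspace M n" using N nrm_in[of k "k + 1" x] n by simp
  then have s: "un 0 k (cyc_norm M n x) = extra_degeneracy P M n (cyc_norm M n x)"
    using ins_nat[of "opoint P" 0 "cyc_norm M n x" n 0] opoint_in n by (simp add: extra_degeneracy_def)
  have "NN (k + 1) = nspace M (n + 1)" using NN_nat[of "n + 1"] n by (simp only: of_nat_add of_nat_1)
  with s have e: "extra_degeneracy P M n (cyc_norm M n x) \<in> nspace M (n + 1)"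
    using ins_in[of 0 "opoint P" 0 k "cyc_norm M n x"] by simp
  have k1: "k + 1 = int (n + 1)" using n by simp
  have "rot (k + 1) 1 (extra_degeneracy P M n (cyc_norm M n x))
      = nscale M ((-1) ^ (n + 1)) (cyc M (n + 1) (extra_degeneracy P M n (cyc_norm M n x)))"
    unfolding k1 using rot_nat[OF e, of 1, unfolded of_nat_1]
    by (simp add: N.scale_sign del: power_Suc of_nat_add)
  then show ?thesis
    unfolding BB_def N s Let_def using n by (simp add: Connes_B_def Let_def zero_ext_map_def)
next
  case False
  assume "x \<in> NN k"
  with False show ?thesis by (simp add: zero_ext_map_def NN_neg)
qed

lemma nboundaries_eq: "nboundaries P M k = bounds k"
  unfolding boundaries_def bounds_def by (auto simp: bdiff_eq intro!: image_cong)

lemma nhomology_eq: "nhomology P M k = coset (bounds k) ` {x \<in> NN k. bd k x = 0}"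
  unfolding nhomology_def homology_def nboundaries_eq cycles_def
  by (intro arg_cong[of _ _ "image _"]) (auto simp: bdiff_eq)

abbreviation odel :: "int \<Rightarrow> 'o \<Rightarrow> 'o" where "odel \<equiv> zero_ext_map (odelta P)"

lemma odel_eq:
  assumes p: "0 \<le> p" and f: "\<phi> \<in> OS p"
  shows "odel p \<phi> = brace 2 p (omult P) \<phi> - sg (p + 1) (brace p 2 \<phi> (omult P))"
proof -
  from p f obtain n where n: "p = int n" and f: "\<phi> \<in> ospace P n"
    by (metis OS_nat nat_0_le)
  have "brace 2 p (omult P) \<phi> = circ 2 p 0 (omult P) \<phi> + circ 2 p 1 (omult P) \<phi>"
    by (simp add: brace_def simp_from_to)
  also have "\<dots> = ocomp P 2 n 1 (omult P) \<phi> + sg (p + 1) (ocomp P 2 n 2 (omult P) \<phi>)"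
    using circ_nat[of 0 2 "omult P" \<phi> n] circ_nat[of 1 2 "omult P" \<phi> n] f omult_in n
    by (simp add: numeral_2_eq_2)
  finally have a: "brace 2 p (omult P) \<phi> = \<dots>" .
  have "brace p 2 \<phi> (omult P) = (\<Sum>k<n. circ p 2 (int k) \<phi> (omult P))"
    unfolding brace_def n by (rule sum_int_nat)
  also have "\<dots> = (\<Sum>k<n. sg (int k) (ocomp P n 2 (k + 1) \<phi> (omult P)))"
    using f omult_in circ_nat[of _ n \<phi> "omult P" 2] n by (intro sum.cong) (auto intro: sg_cong)
  also have "\<dots> = (\<Sum>i\<in>{1..n}. sg (int (n - i)) (ocomp P n 2 (n - i + 1) \<phi> (omult P)))"
    by (rule sum.reindex_bij_witness[of _ "\<lambda>i. n - i" "\<lambda>k. n - k"]) auto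
  finally have b: "brace p 2 \<phi> (omult P) = \<dots>" .
  have "odelta P n \<phi> = ocomp P 2 n 1 (omult P) \<phi>
    + (\<Sum>i\<in>{1..n}. sg (int i) (ocomp P n 2 (n - i + 1) \<phi> (omult P))) + sg (p + 1) (ocomp P 2 n 2 (omult P) \<phi>)"
    by (simp add: odelta_def O.scale_sign n add.commute del: power_Suc)
  moreover have "(\<Sum>i\<in>{1..n}. sg (int i) (ocomp P n 2 (n - i + 1) \<phi> (omult P))) = - sg (p + 1) (brace p 2 \<phi> (omult P))"
    unfolding b sg_sum sum_negf[symmetric] by (intro sum.cong) (auto simp: sg_def n)
  ultimately show ?thesis unfolding a using p n by (simp add: zero_ext_map_def)
qed

lemma odel_in: "\<phi> \<in> OS p \<Longrightarrow> r = p + 1 \<Longrightarrow> odel p \<phi> \<in> OS r"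
  by (cases "0 \<le> p") (simp add: odel_eq, simp add: zero_ext_map_def)

lemma ins_del:
  assumes p: "0 \<le> p" and f: "\<phi> \<in> OS p" and r: "r = p + 1"
  shows "ins r (odel p \<phi>) a n x = dact p \<phi> a n x"
proof -
  have "ins r (brace 2 p (omult P) \<phi>) a n x = mu a (n + 1 - p) (ins p \<phi> a n x) + mu a (n + 1 - p) (ins p \<phi> (a + 1) n x)"
  proof -
    have "{a..a+2-1} = {a, a + 1}" by auto
    then show ?thesis using r by (subst ins_brace[of r 2 p "n + 1 - p"]) auto
  qed
  moreover have "ins r (brace p 2 \<phi> (omult P)) a n x = (\<Sum>l\<in>{a..a+p-1}. ins p \<phi> a (n - 1) (mu l n x))"
    using r by (subst ins_brace[of r p 2 "n - 1"]) auto
  ultimately show ?thesis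
    using r by (simp add: odel_eq[OF p f] ins_op_diff ins_op_sg dact_def)
qed

lemma cocyc_iff_del: "0 \<le> p \<Longrightarrow> \<phi> \<in> OS p \<Longrightarrow> odel p \<phi> = 0 \<Longrightarrow> cocyc p \<phi>"
  using ins_del[of p \<phi> "p + 1"] by (simp add: cocyc_dact)

lemma capn_odel:
  assumes f: "\<phi> \<in> OS (k - 1)" and x: "bd n x = 0"
  shows "capn k (odel (k - 1) \<phi>) n x \<in> bounds (n - k)"
proof (cases "1 \<le> k")
  case True
  have d: "n + 1 - k = n - (k - 1)" by simp
  have "capn k (odel (k - 1) \<phi>) n x = sg (k + 1) (mu 0 (n - (k - 1)) (dact (k - 1) \<phi> 1 n x))"
    unfolding capn_def scap_def d using True f by (simp add: ins_del)
  also have "mu 0 (n - (k - 1)) (dact (k - 1) \<phi> 1 n x) = - bd (n - (k - 1)) (scap (k - 1) \<phi> n x)"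
    using bd_scap_dact[of "n - (k - 1)" n "k - 1" \<phi> x] x by simp
  also have "sg (k + 1) \<dots> \<in> bounds (n - k)"
    by (intro bounds_closed bimI) auto
  finally show ?thesis .
qed (simp add: zero_ext_map_def)

lemma ocup_eq:
  assumes "0 \<le> k" "0 \<le> l" "\<phi> \<in> OS k" "\<psi> \<in> OS l"
  shows "ocup P (nat k) (nat l) \<phi> \<psi> = sg (k + 1) (circ (k + 1) l 0 (circ 2 k 1 (omult P) \<phi>) \<psi>)"
proof -
  from assms obtain k' l' where n: "k = int k'" "l = int l'" and f: "\<phi> \<in> ospace P k'" "\<psi> \<in> ospace P l'"
    by (metis OS_nat nat_0_le)
  have a: "circ 2 k 1 (omult P) \<phi> = sg (k + 1) (ocomp P 2 k' 2 (omult P) \<phi>)"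
    using circ_nat[of 1 2 "omult P" \<phi> k'] f omult_in n by (simp add: numeral_2_eq_2)
  have "circ 2 k 1 (omult P) \<phi> \<in> ospace P (k' + 1)"
  proof -
    have "OS (k + 1) = ospace P (k' + 1)" using OS_nat[of "k' + 1"] n by (simp only: of_nat_add of_nat_1)
    then show ?thesis using circ_in[of "k + 1" 2 k 1 "omult P" \<phi>] by simp
  qed
  from circ_nat[OF _ this f(2), of 0]
  have b: "circ (k + 1) l 0 (circ 2 k 1 (omult P) \<phi>) \<psi> = ocomp P (k' + 1) l' 1 (circ 2 k 1 (omult P) \<phi>) \<psi>"
    using n by (simp add: add.commute)
  have "ocomp P 2 k' 2 (omult P) \<phi> \<in> ospace P (k' + 1)"
    using ocomp_linear(1)[of 2 2 "omult P" \<phi> k'] omult_in f by (simp add: add.commute)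
  then have "ocomp P (k' + 1) l' 1 (sg j (ocomp P 2 k' 2 (omult P) \<phi>)) \<psi> = sg j (ocomp P (k' + 1) l' 1 (ocomp P 2 k' 2 (omult P) \<phi>) \<psi>)" for j
    using ocomp_linear(4)[of 1 "k' + 1" "ocomp P 2 k' 2 (omult P) \<phi>" \<psi> l' "-1"] f by (auto simp: sg_def)
  then show ?thesis unfolding b unfolding a using n by (simp add: ocup_def)
qed

lemma capn_ocup:
  assumes "0 \<le> k" "0 \<le> l" "\<phi> \<in> OS k" "\<psi> \<in> OS l"
  shows "capn (k + l) (ocup P (nat k) (nat l) \<phi> \<psi>) n x = capn k \<phi> (n - l) (capn l \<psi> n x)"
proof -
  have c2: "ins 2 (omult P) 1 (n + 2 - k - l) (ins k \<phi> 2 (n + 1 - l) y) = ins (k + 1) (circ 2 k 1 (omult P) \<phi>) 1 (n + 1 - l) y" for y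
    using ins_circ[of 1 2 2 "n + 2 - k - l" "n + 1 - l" k "omult P" \<phi> y]
    by (simp add: add.commute[of 1 k])
  have "ins (k + l) (circ (k + 1) l 0 (circ 2 k 1 (omult P) \<phi>) \<psi>) 1 n x
      = ins (k + 1) (circ 2 k 1 (omult P) \<phi>) 1 (n + 1 - l) (ins l \<psi> 1 n x)"
    using ins_circ[of 1 1 "k + 1" "n + 1 - l" n l "circ 2 k 1 (omult P) \<phi>" \<psi> x] assms by simp
  also have "\<dots> = mu 1 (n + 2 - k - l) (ins k \<phi> 2 (n + 1 - l) (ins l \<psi> 1 n x))"
    by (rule c2[symmetric])
  also have "ins k \<phi> 2 (n + 1 - l) (ins l \<psi> 1 n x) = sg ((k + 1) * (l + 1)) (ins l \<psi> 1 (n + 1 - k) (ins k \<phi> (l + 1) n x))"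
    by (subst ins_comm) (auto simp: add.commute)
  finally have e: "ins (k + l) (circ (k + 1) l 0 (circ 2 k 1 (omult P) \<phi>) \<psi>) 1 n x
    = sg ((k + 1) * (l + 1)) (mu 1 (n + 2 - l - k) (ins l \<psi> 1 (n + 1 - k) (ins k \<phi> (l + 1) n x)))"
    by (simp add: ins_sg algebra_simps)
  have "scap (k + l) (ocup P (nat k) (nat l) \<phi> \<psi>) n x
    = sg (k + 1 + (k + 1) * (l + 1)) (mu 0 (n + 1 - l - k) (mu 1 (n + 2 - l - k) (ins l \<psi> 1 (n + 1 - k) (ins k \<phi> (l + 1) n x))))"
  proof -
    have d: "n + 1 - (k + l) = n + 1 - l - k" by simp
    show ?thesis
      unfolding scap_def d ocup_eq[OF assms] by (simp add: ins_op_sg e ins_sg)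
  qed
  also have "\<dots> = - scap k \<phi> (n - l) (scap l \<psi> n x)"
    by (simp add: scap_scap)
  finally show ?thesis
    by (cases "even k"; cases "even l") (simp_all add: capn_def scap_sg sg_def scap_minus)
qed

lemma ocup_in:
  assumes "0 \<le> k" "0 \<le> l" "\<phi> \<in> OS k" "\<psi> \<in> OS l"
  shows "ocup P (nat k) (nat l) \<phi> \<psi> \<in> OS (k + l)"
  unfolding ocup_eq[OF assms] by (intro OS_closed circ_in) simp

lemma cap_eq:
  assumes "\<phi> \<in> OS m" "\<zeta> \<in> nspace M d"
  shows "cap P M d \<zeta> m \<phi> = capn m \<phi> (int d) \<zeta>"
proof (cases "0 \<le> m \<and> m \<le> int d")
  case True
  with assms(1) obtain n where n: "m = int n" "n \<le> d" and f: "\<phi> \<in> ospace P n"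
    by (metis OS_nat nat_0_le of_nat_le_iff)
  have z: "act M n d 1 \<phi> \<zeta> \<in> nspace M (d + 1 - n)"
    using n f assms by (intro act_linear) auto
  have "ins m \<phi> 1 (int d) \<zeta> = sg (m + 1) (act M n d 1 \<phi> \<zeta>)"
    using ins_nat[of \<phi> n \<zeta> d 1] n f assms by simp
  moreover have "ins 2 (omult P) 0 (int d + 1 - m) (act M n d 1 \<phi> \<zeta>) = act M 2 (d + 1 - n) 0 (omult P) (act M n d 1 \<phi> \<zeta>)"
  proof -
    have "int d + 1 - m = int (d + 1 - n)" using n by simp
    then show ?thesis
      using ins_nat[of "omult P" 2 "act M n d 1 \<phi> \<zeta>" "d + 1 - n" 0] z n omult_in
      by (simp del: of_nat_diff)
  qed
  moreover have "act M 2 (d + 1 - n) 0 (omult P) (act M n d 1 \<phi> \<zeta>) = act M (n + 1) d 0 (ocomp P 2 n 2 (omult P) \<phi>) \<zeta>"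
    using act_assoc_mid[OF omult_in f assms(2), of 1 0] n by (simp add: numeral_2_eq_2)
  ultimately show ?thesis
    using n by (simp add: cap_def capn_def scap_def ins_sg)
next
  case False
  then show ?thesis by (auto simp: cap_def capn_def scap_def ins_eq_0)
qed

section \<open>Negative cyclic homology\<close>

lemma nc_spaceD: "f \<in> nc_space M p \<Longrightarrow> f j \<in> NN (p + 2 * int j)"
  by (simp add: nc_space_def)

lemma nc_diff_eq:
  "f \<in> nc_space M p \<Longrightarrow> nc_diff P M p f j =
    bd (p + 2 * int j) (f j) + (case j of 0 \<Rightarrow> 0 | Suc i \<Rightarrow> BB (p + 2 * int i) (f i))"
  by (cases j) (simp_all only: nc_diff_def bdiff_eq[OF nc_spaceD] Connes_eq[OF nc_spaceD] nat.case)

lemma nc_space_0: "f \<in> nc_space M p \<Longrightarrow> f 0 \<in> NN p"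
  using nc_spaceD[of f p 0] by simp

lemma nc_space_closed:
  "f \<in> nc_space M p \<Longrightarrow> g \<in> nc_space M p \<Longrightarrow> f - g \<in> nc_space M p"
  "f \<in> nc_space M p \<Longrightarrow> g \<in> nc_space M p \<Longrightarrow> f + g \<in> nc_space M p"
  "f \<in> nc_space M p \<Longrightarrow> nc_scale M c f \<in> nc_space M p"
  "0 \<in> nc_space M p"
  by (auto simp: nc_space_def nc_scale_def)

lemma nc_diff_linear:
  assumes "f \<in> nc_space M p"
  shows "g \<in> nc_space M p \<Longrightarrow> nc_diff P M p (f - g) = nc_diff P M p f - nc_diff P M p g"
    and "g \<in> nc_space M p \<Longrightarrow> nc_diff P M p (f + g) = nc_diff P M p f + nc_diff P M p g"
    and "nc_diff P M p (nc_scale M c f) = nc_scale M c (nc_diff P M p f)"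
proof -
  note [simp] = nc_spaceD[OF assms] nc_space_0[OF assms]
  show "nc_diff P M p (f - g) = nc_diff P M p f - nc_diff P M p g" if g: "g \<in> nc_space M p"
  proof (rule ext)
    fix j
    note [simp] = nc_spaceD[OF g] nc_space_0[OF g]
    show "nc_diff P M p (f - g) j = (nc_diff P M p f - nc_diff P M p g) j"
      using assms g by (cases j) (simp_all add: nc_diff_eq nc_space_closed bd_diff BB_diff del: of_nat_Suc)
  qed
  show "nc_diff P M p (f + g) = nc_diff P M p f + nc_diff P M p g" if g: "g \<in> nc_space M p"
  proof (rule ext)
    fix j
    note [simp] = nc_spaceD[OF g] nc_space_0[OF g]
    show "nc_diff P M p (f + g) j = (nc_diff P M p f + nc_diff P M p g) j"
      using assms g by (cases j) (simp_all add: nc_diff_eq nc_space_closed bd_add BB_add del: of_nat_Suc)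
  qed
  show "nc_diff P M p (nc_scale M c f) = nc_scale M c (nc_diff P M p f)"
  proof (rule ext)
    fix j
    show "nc_diff P M p (nc_scale M c f) j = nc_scale M c (nc_diff P M p f) j"
      using assms by (cases j)
        (simp_all add: nc_diff_eq nc_space_closed nc_scale_def[of M c] bd_scale BB_scale N.scale_right_distrib
                   nc_space_closed(3)[of f p c, unfolded nc_scale_def] del: of_nat_Suc)
  qed
qed

abbreviation ncb :: "int \<Rightarrow> (nat \<Rightarrow> 'n) set" where "ncb \<equiv> nc_boundaries P M"

lemma ncb_eq: "ncb p = nc_diff P M (p + 1) ` nc_space M (p + 1)"
  by (simp add: boundaries_def)

lemma ncb_diff_closed [simp]: "diff_closed (ncb p)"
  unfolding diff_closed_def ncb_eq
proof (intro conjI ballI)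
  have "nc_diff P M (p + 1) 0 = 0"
    using nc_diff_linear(1)[of 0 "p + 1" 0] nc_space_closed(4) by simp
  then show "0 \<in> nc_diff P M (p + 1) ` nc_space M (p + 1)"
    using nc_space_closed(4)[of "p + 1"] by (metis image_eqI)
qed (auto simp: nc_diff_linear[symmetric] intro!: imageI nc_space_closed)

lemma ncb_closed:
  "f \<in> ncb p \<Longrightarrow> nc_scale M c f \<in> ncb p"
  "f \<in> ncb p \<Longrightarrow> g \<in> ncb p \<Longrightarrow> f + g \<in> ncb p"
  "0 \<in> ncb p"
proof -
  show "f \<in> ncb p \<Longrightarrow> nc_scale M c f \<in> ncb p"
    unfolding ncb_eq by (auto simp: nc_diff_linear[symmetric] intro!: imageI nc_space_closed)
  show "f \<in> ncb p \<Longrightarrow> g \<in> ncb p \<Longrightarrow> f + g \<in> ncb p"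
    unfolding ncb_eq by (auto simp: nc_diff_linear[symmetric] intro!: imageI nc_space_closed)
  show "0 \<in> ncb p" using ncb_diff_closed by (simp add: diff_closed_def)
qed

lemma nc_scale_linear:
  "nc_scale M c (f + g) = nc_scale M c f + nc_scale M c g"
  "nc_scale M c (f - g) = nc_scale M c f - nc_scale M c g"
  by (auto simp: nc_scale_def N.scale_right_distrib N.scale_right_diff_distrib)

lemma nc_homology_scale_coset:
  "nc_homology_scale P M p c (coset (ncb p) f) = coset (ncb p) (nc_scale M c f)"
  unfolding nc_homology_scale_def
  by (rule induced_coset) (auto simp: nc_scale_linear ncb_closed)

lemma nc_homology_add_coset:
  "nc_homology_add P M p (coset (ncb p) f) (coset (ncb p) g) = coset (ncb p) (f + g)"
  unfolding nc_homology_add_def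
proof (rule induced2_coset)
  fix s t assume "s \<in> ncb p" "t \<in> ncb p"
  moreover have "f + s + (g + t) - (f + g) = s + t" by simp
  ultimately show "f + s + (g + t) - (f + g) \<in> ncb p" by (simp add: ncb_closed)
qed (auto simp: ncb_closed)

definition ncyc :: "int \<Rightarrow> (nat \<Rightarrow> 'n) set"
  where "ncyc p = {f \<in> nc_space M p. nc_diff P M p f = 0}"

lemma nc_homology_ncyc: "nc_homology P M p = coset (ncb p) ` ncyc p"
  by (simp add: nc_homology_def homology_def cycles_def ncyc_def)

lemma ncyc_closed: "f \<in> ncyc p \<Longrightarrow> g \<in> ncyc p \<Longrightarrow> f + g \<in> ncyc p" "f \<in> ncyc p \<Longrightarrow> nc_scale M c f \<in> ncyc p"
  by (auto simp: ncyc_def nc_space_closed nc_diff_linear) (simp add: nc_scale_def fun_eq_iff)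

lemma ncycD:
  assumes "f \<in> ncyc p"
  shows "f 0 \<in> NN p" "bd p (f 0) = 0" "hom (p + 1) (BB p (f 0)) 0"
proof -
  have f: "f \<in> nc_space M p" "nc_diff P M p f = 0" using assms by (auto simp: ncyc_def)
  show "f 0 \<in> NN p" using nc_spaceD[OF f(1), of 0] by simp
  have 0: "nc_diff P M p f j = 0" for j using f(2) by (simp add: fun_eq_iff)
  show "bd p (f 0) = 0" using 0[of 0] by (simp only: nc_diff_eq[OF f(1)]) simp
  have "BB p (f 0) = bd (p + 2) (- f 1)"
    using 0[of 1] by (simp only: nc_diff_eq[OF f(1)]) (simp add: bd_minus eq_neg_iff_add_eq_0 add.commute)
  also have "\<dots> \<in> bounds (p + 1)"
    using nc_spaceD[OF f(1), of 1] by (intro bimI) auto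
  finally show "hom (p + 1) (BB p (f 0)) 0" by (simp add: hom_0_iff)
qed

lemma Connes_pi_coset:
  "Connes_pi P M p (coset (ncb p) f) = coset (bounds p) (f 0)"
  unfolding Connes_pi_def nboundaries_eq
proof (rule induced_coset)
  fix s assume "s \<in> ncb p"
  then obtain h where h: "h \<in> nc_space M (p + 1)" "s = nc_diff P M (p + 1) h" by (auto simp: ncb_eq)
  then have "s 0 = bd (p + 1) (h 0)" by (simp add: nc_diff_eq)
  moreover have "h 0 \<in> NN (p + 1)" using nc_spaceD[OF h(1), of 0] by simp
  ultimately show "(f + s) 0 - f 0 \<in> bounds p" by (simp add: bimI)
qed (auto simp: ncb_closed)

definition const_series :: "'n \<Rightarrow> nat \<Rightarrow> 'n"
  where "const_series y = (\<lambda>j. if j = 0 then y else 0)"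

lemma const_series_linear:
  "const_series (x + y) = const_series x + const_series y" "const_series (x - y) = const_series x - const_series y"
  "const_series (nscale M c x) = nc_scale M c (const_series x)" "const_series x 0 = x"
  by (auto simp: const_series_def nc_scale_def)

lemma const_series_in: "y \<in> NN p \<Longrightarrow> const_series y \<in> nc_space M p"
  by (auto simp: const_series_def nc_space_def)

lemma nc_diff_const_series: "y \<in> NN p \<Longrightarrow> BB p y = 0 \<Longrightarrow> nc_diff P M p (const_series y) = const_series (bd p y)"
  by (rule ext, simp add: nc_diff_eq const_series_in split: nat.split) (auto simp: const_series_def)

lemma const_series_BB_cycle: "y \<in> NN p \<Longrightarrow> bd p y = 0 \<Longrightarrow> m = p + 1 \<Longrightarrow> const_series (BB p y) \<in> ncyc m"
  unfolding ncyc_def using nc_diff_const_series[of "BB p y" "p + 1"] bd_BB[of y p]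
  by (simp add: BB_BB const_series_in) (simp add: const_series_def fun_eq_iff)

lemma const_series_BB_bounds: "u \<in> bounds p \<Longrightarrow> m = p + 1 \<Longrightarrow> const_series (BB p u) \<in> ncb m"
proof -
  assume "u \<in> bounds p" and m: "m = p + 1"
  then obtain h where h: "h \<in> NN (p + 1)" "u = bd (p + 1) h" by (auto simp: bounds_def)
  have "BB p u = bd (p + 2) (- BB (p + 1) h)"
    using bd_BB[OF h(1)] h by (simp add: bd_minus add.commute)
  then have "const_series (BB p u) = nc_diff P M (m + 1) (const_series (- BB (p + 1) h))"
    using m by (subst nc_diff_const_series) (auto simp: BB_minus BB_BB add.commute)
  then show ?thesis unfolding ncb_eq using m by (auto intro!: imageI const_series_in)
qed

lemma const_series_BB_hom: "hom p x y \<Longrightarrow> x \<in> NN p \<Longrightarrow> y \<in> NN p \<Longrightarrow> m = p + 1 \<Longrightarrow>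
    coset (ncb m) (const_series (BB p x)) = coset (ncb m) (const_series (BB p y))"
  using const_series_BB_bounds[of "x - y" p m]
  by (simp add: coset_eq_iff hom_def BB_diff flip: const_series_linear)

lemma Connes_beta_coset:
  assumes "x \<in> NN p" "m = p + 1"
  shows "Connes_beta P M p (coset (bounds p) x) = coset (ncb m) (const_series (BB p x))"
proof -
  have "Connes_beta P M p (coset (bounds p) x)
    = coset (ncb m) (\<lambda>j. if j = 0 then zero_ext_map (Connes_B P M) p x else 0)"
    unfolding Connes_beta_def assms(2)
  proof (rule induced_coset)
    fix s assume s: "s \<in> bounds p"
    then have "s \<in> NN p" using bounds_cycle by blast
    then have "(\<lambda>j. if j = 0 then zero_ext_map (Connes_B P M) p (x + s) else 0) -
        (\<lambda>j. if j = 0 then zero_ext_map (Connes_B P M) p x else 0) = const_series (BB p s)"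
      using assms by (auto simp: Connes_eq BB_add const_series_def)
    then show "(\<lambda>j. if j = 0 then zero_ext_map (Connes_B P M) p (x + s) else 0) -
        (\<lambda>j. if j = 0 then zero_ext_map (Connes_B P M) p x else 0) \<in> ncb (p + 1)"
      using const_series_BB_bounds[OF s refl] by simp
  qed auto
  then show ?thesis using assms by (simp add: Connes_eq const_series_def cong: if_cong)
qed

lemma circ_0 [simp]: "circ p q k 0 \<psi> = 0" "circ p q k \<phi> 0 = 0"
proof -
  have "ocomp P (nat p) (nat q) (nat (k + 1)) 0 \<psi> = 0" if "0 \<le> k" "k < p" "0 \<le> q" "\<psi> \<in> OS q"
    using ocomp_linear(4)[of "nat (k + 1)" "nat p" 0 \<psi> "nat q" 0] that O.subspace_0[OF ospace_subspace]
    by (simp add: zero_ext_space_def)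
  then show "circ p q k 0 \<psi> = 0" by (auto simp: circ_def)
  have "ocomp P (nat p) (nat q) (nat (k + 1)) \<phi> 0 = 0" if "0 \<le> k" "k < p" "0 \<le> q" "\<phi> \<in> OS p"
    using ocomp_linear(5)[of "nat (k + 1)" "nat p" \<phi> 0 "nat q" 0] that O.subspace_0[OF ospace_subspace]
    by (simp add: zero_ext_space_def)
  then show "circ p q k \<phi> 0 = 0" by (auto simp: circ_def)
qed

lemma odel_0 [simp]: "odel p 0 = 0"
proof (cases "0 \<le> p")
  case True
  then show ?thesis by (simp only: odel_eq[OF _ OS_closed(1)]) (simp add: brace_def)
qed (simp add: zero_ext_map_def)

lemma ocoboundaries_eq: "ocoboundaries P k = odel (k - 1) ` OS (k - 1)"
  by (simp add: boundaries_def)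

lemma zero_ocoboundary [simp]: "0 \<in> ocoboundaries P k"
  unfolding ocoboundaries_eq using odel_0[of "k - 1"] by (metis OS_closed(1) image_eqI)

lemma ocohomology_eq: "ocohomology P k = coset (ocoboundaries P k) ` {\<phi> \<in> OS k. odel k \<phi> = 0}"
  by (simp add: ocohomology_def homology_def cycles_def)

end

section \<open>Duality and the Lie bracket\<close>

locale dual_operad_calculus = operad_calculus P M
  for P :: "('k::field, 'o::ab_group_add, 'z) operad_mult_scheme"
  and M :: "('k, 'o, 'n::ab_group_add, 'y) opmod_scheme" +
  fixes d :: nat and \<zeta> :: 'n
  assumes \<zeta>_in: "\<zeta> \<in> nspace M d" and \<zeta>_cycle: "bdiff P M d \<zeta> = 0"
    and duality_bij: "bij_betw (duality P M d \<zeta> p) (ocohomology P (int d - p)) (nhomology P M p)"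
begin

lemma \<zeta>_NN [simp]: "\<zeta> \<in> NN (int d)"
  using \<zeta>_in by simp

lemma bd_\<zeta> [simp]: "bd (int d) \<zeta> = 0"
  using bdiff_eq[of \<zeta> "int d"] \<zeta>_in \<zeta>_cycle by (simp add: zero_ext_map_def)

definition dual :: "int \<Rightarrow> 'o \<Rightarrow> 'n \<Rightarrow> bool"
  where "dual k \<phi> x \<longleftrightarrow> \<phi> \<in> OS k \<and> odel k \<phi> = 0 \<and> hom (int d - k) (capn k \<phi> (int d) \<zeta>) x"

lemma duality_coset:
  assumes f: "\<phi> \<in> OS k" "odel k \<phi> = 0" and k: "k = int d - p"
  shows "duality P M d \<zeta> p (coset (ocoboundaries P k) \<phi>) = coset (bounds p) (capn k \<phi> (int d) \<zeta>)"
proof -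
  let ?D = "duality P M d \<zeta> p (coset (ocoboundaries P k) \<phi>)"
  have "coset (ocoboundaries P k) \<phi> \<in> ocohomology P k"
    using f by (auto simp: ocohomology_eq)
  then have "?D \<in> nhomology P M p"
    using bij_betwE[OF duality_bij[of p]] k by simp
  then obtain y where y: "?D = coset (bounds p) y" by (auto simp: nhomology_eq)
  have "\<phi> \<in> coset (ocoboundaries P k) \<phi>" by (simp add: coset_mem)
  then have "capn k \<phi> (int d) \<zeta> \<in> ?D"
    unfolding duality_def induced_def nboundaries_eq using f \<zeta>_in k
    by (auto simp: cap_eq coset_self intro!: bexI[of _ \<phi>])
  then show ?thesis by (simp add: y coset_mem coset_eq_iff) (metis bounds_closed(4) minus_diff_eq)
qed

lemma ex_dual:
  assumes "x \<in> NN p" "bd p x = 0"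
  shows "\<exists>\<phi>. dual (int d - p) \<phi> x"
proof -
  have "coset (bounds p) x \<in> nhomology P M p" using assms by (auto simp: nhomology_eq)
  then obtain \<Phi> where "\<Phi> \<in> ocohomology P (int d - p)" "duality P M d \<zeta> p \<Phi> = coset (bounds p) x"
    using bij_betw_imp_surj_on[OF duality_bij[of p]] by (metis imageE)
  then obtain \<phi> where f: "\<phi> \<in> OS (int d - p)" "odel (int d - p) \<phi> = 0"
    "duality P M d \<zeta> p (coset (ocoboundaries P (int d - p)) \<phi>) = coset (bounds p) x"
    by (auto simp: ocohomology_eq)
  then show ?thesis
    using duality_coset[of \<phi> "int d - p" p] by (auto simp: dual_def hom_def coset_eq_iff)
qed

lemma dual_inv:
  assumes f: "dual k \<phi> x" and k: "k = int d - p"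
  shows "inv_into (ocohomology P k) (duality P M d \<zeta> p) (coset (bounds p) x) = coset (ocoboundaries P k) \<phi>"
proof -
  have "duality P M d \<zeta> p (coset (ocoboundaries P k) \<phi>) = coset (bounds p) x"
    using f k by (subst duality_coset) (auto simp: dual_def hom_def coset_eq_iff)
  moreover have "coset (ocoboundaries P k) \<phi> \<in> ocohomology P k"
    using f by (auto simp: dual_def ocohomology_eq)
  ultimately show ?thesis
    using inv_into_f_f[OF bij_betw_imp_inj_on[OF duality_bij[of p]]] k by metis
qed

lemma dual_cocyc: "dual k \<phi> x \<Longrightarrow> 0 \<le> k \<Longrightarrow> cocyc k \<phi>"
  by (simp add: dual_def cocyc_iff_del)

lemma dual_hom:
  assumes f: "dual k \<phi> x" and "hom n y z" "y \<in> NN n" "z \<in> NN n" "m = n - k"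
  shows "hom m (capn k \<phi> n y) (capn k \<phi> n z)"
  using capn_hom[OF dual_cocyc[OF f]] assms by (cases "0 \<le> k") (auto simp: capn_neg)

lemma dual_bd:
  assumes f: "dual k \<phi> x" and "bd n y = 0" "m = n - k" shows "bd m (capn k \<phi> n y) = 0"
  using bd_capn[OF dual_cocyc[OF f]] assms by (cases "0 \<le> k") (auto simp: capn_neg)

lemma capn_ocup_any:
  assumes "\<phi> \<in> OS k" "\<psi> \<in> OS l"
  shows "capn (k + l) (if 0 \<le> k \<and> 0 \<le> l then ocup P (nat k) (nat l) \<phi> \<psi> else 0) n x = capn k \<phi> (n - l) (capn l \<psi> n x)"
  using assms by (cases "0 \<le> k \<and> 0 \<le> l") (auto simp: capn_ocup capn_neg)

lemma nhomology_cup_coset: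
  assumes f: "dual k \<phi> x" and k: "k = int d - p" and y: "y \<in> NN q" "bd q y = 0"
  shows "nhomology_cup P M d \<zeta> p q (coset (bounds p) x) (coset (bounds q) y)
    = coset (bounds (p + q - int d)) (capn k \<phi> q y)"
proof -
  define l where "l = int d - q"
  obtain \<psi> where g: "dual l \<psi> y" using ex_dual[OF y] l_def by blast
  have d: "int d - (p + q - int d) = k + l" "int d - p = k" "int d - q = l" "int d - l = q" "q - k = p + q - int d"
    "int d - (k + l) = p + q - int d" "k + l - 1 + 1 = k + l"
    using k l_def by auto
  let ?S = "bounds (p + q - int d)"
  let ?cup = "\<lambda>\<phi> \<psi>. if 0 \<le> k \<and> 0 \<le> l then ocup P (nat k) (nat l) \<phi> \<psi> else 0"
  let ?I = "induced2 (ocoboundaries P (k + l)) ?cup (coset (ocoboundaries P k) \<phi>) (coset (ocoboundaries P l) \<psi>)"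
  have *: "nhomology_cup P M d \<zeta> p q (coset (bounds p) x) (coset (bounds q) y)
    = (\<Union>\<omega>\<in>?I. coset ?S (cap P M d \<zeta> (k + l) \<omega>))"
    unfolding nhomology_cup_def ocohomology_cup_def d dual_inv[OF f k] dual_inv[OF g l_def]
    by (simp add: duality_def d nboundaries_eq induced_def)
  have main: "coset ?S (cap P M d \<zeta> (k + l) \<omega>) = coset ?S (capn k \<phi> q y)" if "\<omega> \<in> ?I" for \<omega>
  proof -
    from that obtain \<phi>' \<psi>' where 1: "\<phi>' \<in> coset (ocoboundaries P k) \<phi>" "\<psi>' \<in> coset (ocoboundaries P l) \<psi>"
      "\<omega> \<in> coset (ocoboundaries P (k + l)) (?cup \<phi>' \<psi>')"
      unfolding induced2_def by blast
    obtain a where a: "a \<in> OS (k - 1)" "\<phi>' = \<phi> + odel (k - 1) a"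
      using 1(1) by (auto simp: coset_mem ocoboundaries_eq) (metis add.commute diff_add_cancel)
    obtain b where b: "b \<in> OS (l - 1)" "\<psi>' = \<psi> + odel (l - 1) b"
      using 1(2) by (auto simp: coset_mem ocoboundaries_eq) (metis add.commute diff_add_cancel)
    obtain c where c: "c \<in> OS (k + l - 1)" "\<omega> = ?cup \<phi>' \<psi>' + odel (k + l - 1) c"
      using 1(3) unfolding coset_mem ocoboundaries_eq by (metis (no_types, lifting) add.commute diff_add_cancel imageE)
    have F: "\<phi> \<in> OS k" "\<psi> \<in> OS l" using f g by (auto simp: dual_def)
    have dl: "odel (k - 1) a \<in> OS k" "odel (l - 1) b \<in> OS l" "odel (k + l - 1) c \<in> OS (k + l)"
      using odel_in[of a "k - 1" k] odel_in[of b "l - 1" l] odel_in[of c "k + l - 1" "k + l"] a b c by auto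
    then have F': "\<phi>' \<in> OS k" "\<psi>' \<in> OS l" using F a b by auto
    have cup: "?cup \<phi>' \<psi>' \<in> OS (k + l)" using F' by (auto simp: ocup_in)
    have yb: "capn l \<psi>' (int d) \<zeta> = capn l \<psi> (int d) \<zeta> + capn l (odel (l - 1) b) (int d) \<zeta>"
      unfolding b(2) using F dl by (simp add: capn_op_add)
    have b2: "capn l (odel (l - 1) b) (int d) \<zeta> \<in> bounds q"
      using capn_odel[OF b(1) bd_\<zeta>] d by simp
    have hy: "hom q (capn l \<psi>' (int d) \<zeta>) y"
    proof -
      have "hom q (capn l \<psi> (int d) \<zeta> + capn l (odel (l - 1) b) (int d) \<zeta>) (y + 0)"
        using g b2 d by (intro hom_add) (auto simp: dual_def hom_0_iff)
      then show ?thesis by (simp add: yb)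
    qed
    have yc: "bd q (capn l \<psi>' (int d) \<zeta>) = 0" "capn l \<psi>' (int d) \<zeta> \<in> NN q"
      using dual_bd[OF g bd_\<zeta>, of q] bounds_cycle[OF b2] d unfolding yb by (auto simp: bd_add)
    have "cap P M d \<zeta> (k + l) \<omega> = capn (k + l) \<omega> (int d) \<zeta>"
      using c cup dl \<zeta>_in by (intro cap_eq) auto
    also have "\<dots> = capn k \<phi>' q (capn l \<psi>' (int d) \<zeta>) + capn (k + l) (odel (k + l - 1) c) (int d) \<zeta>"
      unfolding c(2) using cup dl F' capn_ocup_any[OF F', of "int d" \<zeta>] d by (simp add: capn_op_add)
    also have "capn k \<phi>' q (capn l \<psi>' (int d) \<zeta>) = capn k \<phi> q (capn l \<psi>' (int d) \<zeta>) + capn k (odel (k - 1) a) q (capn l \<psi>' (int d) \<zeta>)"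
      unfolding a(2) using F dl by (simp add: capn_op_add)
    finally have e: "cap P M d \<zeta> (k + l) \<omega> = capn k \<phi> q (capn l \<psi>' (int d) \<zeta>)
      + capn k (odel (k - 1) a) q (capn l \<psi>' (int d) \<zeta>) + capn (k + l) (odel (k + l - 1) c) (int d) \<zeta>" .
    have "hom (p + q - int d) (cap P M d \<zeta> (k + l) \<omega>) (capn k \<phi> q y + 0 + 0)"
      unfolding e
    proof (intro hom_add)
      show "hom (p + q - int d) (capn k \<phi> q (capn l \<psi>' (int d) \<zeta>)) (capn k \<phi> q y)"
        using dual_hom[OF f hy yc(2) y(1)] d by simp
      show "hom (p + q - int d) (capn k (odel (k - 1) a) q (capn l \<psi>' (int d) \<zeta>)) 0"
        using capn_odel[OF a(1) yc(1)] d by (simp add: hom_0_iff)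
      show "hom (p + q - int d) (capn (k + l) (odel (k + l - 1) c) (int d) \<zeta>) 0"
        using capn_odel[OF c(1) bd_\<zeta>] d by (simp add: hom_0_iff)
    qed
    then show ?thesis by (simp add: coset_eq_iff hom_def)
  qed
  have "\<exists>\<omega>. \<omega> \<in> ?I"
  proof -
    have "\<phi> \<in> coset (ocoboundaries P k) \<phi>" "\<psi> \<in> coset (ocoboundaries P l) \<psi>"
      "?cup \<phi> \<psi> \<in> coset (ocoboundaries P (k + l)) (?cup \<phi> \<psi>)"
      by (simp_all add: coset_mem)
    then show ?thesis unfolding induced2_def by blast
  qed
  then show ?thesis unfolding * using main by blast
qed

lemma dual_commute:
  assumes f: "dual k \<phi> x" and g: "dual l \<psi> y" and k: "k = int d - p" "l = int d - q"
    and x: "x \<in> NN p" "bd p x = 0" and y: "y \<in> NN q" "bd q y = 0" and m: "m = p + q - int d"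
  shows "hom m (capn k \<phi> q y) (sg (k * l) (capn l \<psi> p x))"
proof -
  have d: "int d - l = q" "int d - k = p" "int d - k - l = m" using k m by auto
  have hx: "hom p (capn k \<phi> (int d) \<zeta>) x" and hy: "hom q (capn l \<psi> (int d) \<zeta>) y"
    using f g d by (auto simp: dual_def)
  show ?thesis
  proof (cases "0 \<le> k \<and> 0 \<le> l")
    case True
    then have c: "cocyc k \<phi>" "cocyc l \<psi>" using dual_cocyc f g by auto
    have "hom m (capn k \<phi> q y) (capn k \<phi> q (capn l \<psi> (int d) \<zeta>))"
      using hom_sym[OF hy] y d k m by (intro capn_hom[OF c(1)]) auto
    also have "hom m \<dots> (sg (k * l) (capn l \<psi> p (capn k \<phi> (int d) \<zeta>)))"
      using capn_commute[OF c bd_\<zeta>, of m] d by simp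
    also have "hom m \<dots> (sg (k * l) (capn l \<psi> p x))"
      using hx x d k m by (intro hom_sg capn_hom[OF c(2)]) auto
    finally show ?thesis .
  next
    case False
    have "hom m (capn k \<phi> q y) 0" 
    proof (cases "k < 0")
      case False
      with \<open>\<not> (0 \<le> k \<and> 0 \<le> l)\<close> have "l < 0" by simp
      then have "hom q y 0" using hom_sym[OF hy] by (simp add: capn_neg)
      then show ?thesis using dual_hom[OF f, of q y 0 m] y k m by simp
    qed (simp add: capn_neg)
    moreover have "hom m (capn l \<psi> p x) 0"
    proof (cases "l < 0")
      case False
      with \<open>\<not> (0 \<le> k \<and> 0 \<le> l)\<close> have "k < 0" by simp
      then have "hom p x 0" using hom_sym[OF hx] by (simp add: capn_neg)
      then show ?thesis using dual_hom[OF g, of p x 0 m] x k m by simp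
    qed (simp add: capn_neg)
    ultimately show ?thesis using hom_trans hom_sym hom_sg[of m "capn l \<psi> p x" 0 "k * l"] by (metis sg_zero)
  qed
qed

lemma BB_\<zeta>: "hom (int d + 1) (BB (int d) \<zeta>) 0"
proof -
  have "bd (int d + 1) (BB (int d) \<zeta>) = 0" using bd_BB[OF \<zeta>_NN] by simp
  then obtain \<phi> where "dual (int d - (int d + 1)) \<phi> (BB (int d) \<zeta>)" using ex_dual by force
  then show ?thesis by (auto simp: dual_def capn_neg intro: hom_sym)
qed

lemma nc_bracket_coset:
  assumes f: "f \<in> ncyc p" and g: "g \<in> ncyc q" and F: "dual k \<phi> (f 0)" and k: "k = int d - p" and m: "m = p + q + 1 - int d"
  shows "nc_bracket P M d \<zeta> p q (coset (ncb p) f) (coset (ncb q) g)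
    = coset (ncb m) (const_series (sg k (BB (p + q - int d) (capn k \<phi> q (g 0)))))"
proof -
  have e: "q - k = p + q - int d" using k by simp
  have "capn k \<phi> q (g 0) \<in> NN (p + q - int d)" using e by simp
  then have "nc_bracket P M d \<zeta> p q (coset (ncb p) f) (coset (ncb q) g)
    = coset (ncb m) (nc_scale M ((-1) powi (p + int d)) (const_series (BB (p + q - int d) (capn k \<phi> q (g 0)))))"
    unfolding nc_bracket_def Connes_pi_coset nhomology_cup_coset[OF F k ncycD(1,2)[OF g]]
    by (subst Connes_beta_coset[of _ _ m]) (use m in \<open>auto simp: nc_homology_scale_coset\<close>)
  also have "nc_scale M ((-1) powi (p + int d)) (const_series (BB (p + q - int d) (capn k \<phi> q (g 0))))
    = const_series (sg k (BB (p + q - int d) (capn k \<phi> q (g 0))))"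
    unfolding const_series_linear(3)[symmetric] N.scale_sign_powi
    by (rule arg_cong[of _ _ const_series]) (auto intro: sg_cong simp: k)
  finally show ?thesis .
qed

lemma nc_bracket_coset':
  assumes f: "f \<in> ncyc p" and g: "g \<in> ncyc q" and G: "dual l \<psi> (g 0)"
    and k: "k = int d - p" "l = int d - q" and m: "m = p + q + 1 - int d"
  shows "nc_bracket P M d \<zeta> p q (coset (ncb p) f) (coset (ncb q) g)
    = coset (ncb m) (const_series (sg (k + k * l) (BB (p + q - int d) (capn l \<psi> p (f 0)))))"
proof -
  obtain \<phi> where F: "dual k \<phi> (f 0)" using ex_dual[OF ncycD(1,2)[OF f]] k by blast
  have "hom (p + q - int d) (sg k (capn k \<phi> q (g 0))) (sg k (sg (k * l) (capn l \<psi> p (f 0))))"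
    by (intro hom_sg dual_commute[OF F G k ncycD(1,2)[OF f] ncycD(1,2)[OF g]]) simp
  then show ?thesis
    unfolding nc_bracket_coset[OF f g F k(1) m] BB_sg[symmetric]
    using k m by (subst const_series_BB_hom[of "p + q - int d" _ "sg k (sg (k * l) (capn l \<psi> p (f 0)))"]) auto
qed

lemma bracket_ncyc:
  assumes f: "f \<in> ncyc p" and g: "g \<in> ncyc q" and F: "dual k \<phi> (f 0)" and k: "k = int d - p" and m: "m = p + q + 1 - int d"
  shows "const_series (sg k (BB (p + q - int d) (capn k \<phi> q (g 0)))) \<in> ncyc m"
proof -
  have "bd (p + q - int d) (capn k \<phi> q (g 0)) = 0"
    using ncycD[OF g] k by (intro dual_bd[OF F]) auto
  then show ?thesis
    unfolding BB_sg[symmetric] using k m by (intro const_series_BB_cycle) (auto simp: bd_sg)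
qed

abbreviation br :: "int \<Rightarrow> int \<Rightarrow> (nat \<Rightarrow> 'n) set \<Rightarrow> (nat \<Rightarrow> 'n) set \<Rightarrow> (nat \<Rightarrow> 'n) set"
  where "br \<equiv> nc_bracket P M d \<zeta>"

lemma ncyc_dual: "f \<in> ncyc p \<Longrightarrow> k = int d - p \<Longrightarrow> \<exists>\<phi>. dual k \<phi> (f 0)"
  using ex_dual ncycD by blast

lemma br_in:
  assumes "X \<in> nc_homology P M p" "Y \<in> nc_homology P M q" "m = p + q + 1 - int d"
  shows "br p q X Y \<in> nc_homology P M m"
proof -
  obtain f g where fg: "f \<in> ncyc p" "X = coset (ncb p) f" "g \<in> ncyc q" "Y = coset (ncb q) g"
    using assms by (auto simp: nc_homology_ncyc)
  obtain \<phi> where "dual (int d - p) \<phi> (f 0)" using ncyc_dual fg by blast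
  then show ?thesis
    using nc_bracket_coset[OF fg(1,3) _ refl assms(3)] bracket_ncyc[OF fg(1,3) _ refl assms(3)]
    by (auto simp: fg nc_homology_ncyc)
qed

lemma br_left_linear:
  assumes "X \<in> nc_homology P M p" "X' \<in> nc_homology P M p" "Y \<in> nc_homology P M q"
    and m: "m = p + q + 1 - int d"
  shows "br p q (nc_homology_add P M p X X') Y = nc_homology_add P M m (br p q X Y) (br p q X' Y)"
    and "br p q (nc_homology_scale P M p c X) Y = nc_homology_scale P M m c (br p q X Y)"
proof -
  obtain f f' g where f: "f \<in> ncyc p" "X = coset (ncb p) f" and f': "f' \<in> ncyc p" "X' = coset (ncb p) f'"
    and g: "g \<in> ncyc q" "Y = coset (ncb q) g"
    using assms by (auto simp: nc_homology_ncyc)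
  obtain \<psi> where G: "dual (int d - q) \<psi> (g 0)" using ncyc_dual g by blast
  note br = nc_bracket_coset'[OF _ g(1) G refl refl m]
  have N: "f 0 \<in> NN p" "f' 0 \<in> NN p" using f f' ncycD by auto
  show "br p q (nc_homology_add P M p X X') Y = nc_homology_add P M m (br p q X Y) (br p q X' Y)"
    unfolding f(2) f'(2) g(2) nc_homology_add_coset br[OF f(1)] br[OF f'(1)]
      br[OF ncyc_closed(1)[OF f(1) f'(1)]]
    using N by (simp add: capn_add BB_add sg_add const_series_linear)
  show "br p q (nc_homology_scale P M p c X) Y = nc_homology_scale P M m c (br p q X Y)"
    unfolding f(2) f'(2) g(2) nc_homology_scale_coset br[OF f(1)] br[OF ncyc_closed(2)[OF f(1)]]
    using N by (simp add: nc_scale_def[of M c f] capn_scale BB_scale flip: N.scale_sg const_series_linear)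
qed

lemma br_right_linear:
  assumes "X \<in> nc_homology P M p" "Y \<in> nc_homology P M q" "Y' \<in> nc_homology P M q"
    and m: "m = p + q + 1 - int d"
  shows "br p q X (nc_homology_add P M q Y Y') = nc_homology_add P M m (br p q X Y) (br p q X Y')"
    and "br p q X (nc_homology_scale P M q c Y) = nc_homology_scale P M m c (br p q X Y)"
proof -
  obtain f g g' where f: "f \<in> ncyc p" "X = coset (ncb p) f" and g: "g \<in> ncyc q" "Y = coset (ncb q) g"
    and g': "g' \<in> ncyc q" "Y' = coset (ncb q) g'"
    using assms by (auto simp: nc_homology_ncyc)
  obtain \<phi> where F: "dual (int d - p) \<phi> (f 0)" using ncyc_dual f by blast
  note br = nc_bracket_coset[OF f(1) _ F refl m]
  have N: "g 0 \<in> NN q" "g' 0 \<in> NN q" using g g' ncycD by auto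
  show "br p q X (nc_homology_add P M q Y Y') = nc_homology_add P M m (br p q X Y) (br p q X Y')"
    unfolding f(2) g(2) g'(2) nc_homology_add_coset br[OF g(1)] br[OF g'(1)]
      br[OF ncyc_closed(1)[OF g(1) g'(1)]]
    using N by (simp add: capn_add BB_add sg_add const_series_linear)
  show "br p q X (nc_homology_scale P M q c Y) = nc_homology_scale P M m c (br p q X Y)"
    unfolding f(2) g(2) nc_homology_scale_coset br[OF g(1)] br[OF ncyc_closed(2)[OF g(1)]]
    using N by (simp add: nc_scale_def[of M c g] capn_scale BB_scale flip: N.scale_sg const_series_linear)
qed

lemma br_antisym:
  assumes "X \<in> nc_homology P M p" "Y \<in> nc_homology P M q" and m: "m = p + q + 1 - int d"
  shows "br p q X Y = nc_homology_scale P M m (- ((-1) powi ((int d - 1 - p) * (int d - 1 - q)))) (br q p Y X)"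
proof -
  obtain f g where fg: "f \<in> ncyc p" "X = coset (ncb p) f" "g \<in> ncyc q" "Y = coset (ncb q) g"
    using assms by (auto simp: nc_homology_ncyc)
  obtain \<psi> where G: "dual (int d - q) \<psi> (g 0)" using ncyc_dual fg by blast
  have e: "p + q = q + p" "m = q + p + 1 - int d" using m by auto
  let ?y = "BB (q + p - int d) (capn (int d - q) \<psi> p (f 0))"
  have "nc_scale M (- ((-1) powi ((int d - 1 - p) * (int d - 1 - q)))) (const_series (sg (int d - q) ?y))
    = const_series (sg (int d - p + (int d - p) * (int d - q)) ?y)"
    unfolding const_series_linear(3)[symmetric] N.scale_minus_left N.scale_sign_powi
    by (rule arg_cong[of _ _ const_series]) (auto simp: sg_def)
  then show ?thesis
    unfolding fg nc_bracket_coset[OF fg(3,1) G refl e(2)] nc_bracket_coset'[OF fg(1,3) G refl refl m]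
    by (simp add: nc_homology_scale_coset e(1))
qed

lemma br_Jacobi_core:
  assumes f: "f \<in> ncyc p" and g: "g \<in> ncyc q" and h: "h \<in> ncyc t"
    and F: "dual k \<phi> (f 0)" and G: "dual l \<psi> (g 0)" and H: "dual r \<chi> (h 0)"
    and k: "k = int d - p" "l = int d - q" "r = int d - t"
    and u: "u = p + q + t + 1 - 2 * int d" and v: "v = u + 1"
  shows "const_series (BB u (sg k (capn k \<phi> (q + t + 1 - int d) (BB (q + t - int d) (capn l \<psi> t (h 0))))
      + sg ((k + l + 1) * r) (capn r \<chi> (p + q + 1 - int d) (BB (p + q - int d) (capn k \<phi> q (g 0))))
      + sg ((k + 1) * l) (capn l \<psi> (p + t + 1 - int d) (BB (p + t - int d) (capn k \<phi> t (h 0)))))) \<in> ncb v"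
    (is "const_series (BB u ?J) \<in> ncb v")
proof -
  let ?z = "\<lambda>k \<phi>. capn k \<phi> (int d) \<zeta>"
  have d: "int d - k = p" "int d - l = q" "int d - r = t" "int d - l - r = q + t - int d"
    "int d + 1 - l - r = q + t + 1 - int d" "int d - k - l = p + q - int d"
    "int d + 1 - k - l = p + q + 1 - int d" "int d - k - r = p + t - int d"
    "int d + 1 - k - r = p + t + 1 - int d" "int d - k - l - r = u - 1" "int d + 1 - k - l - r = u"
    using k u by auto
  have hf: "hom p (?z k \<phi>) (f 0)" and hg: "hom q (?z l \<psi>) (g 0)" and hh: "hom t (?z r \<chi>) (h 0)"
    using F G H d by (auto simp: dual_def)
  have N: "f 0 \<in> NN p" "g 0 \<in> NN q" "h 0 \<in> NN t" using f g h ncycD by auto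
  have zN: "?z k \<phi> \<in> NN p" "?z l \<psi> \<in> NN q" "?z r \<chi> \<in> NN t" using d by simp_all
  let ?A = "\<lambda>z. capn k \<phi> (q + t + 1 - int d) (BB (q + t - int d) (capn l \<psi> t z))"
  let ?C = "\<lambda>z. capn r \<chi> (p + q + 1 - int d) (BB (p + q - int d) (capn k \<phi> q z))"
  let ?D = "\<lambda>z. capn l \<psi> (p + t + 1 - int d) (BB (p + t - int d) (capn k \<phi> t z))"
  let ?J' = "sg k (?A (?z r \<chi>)) + sg ((k + l + 1) * r) (?C (?z l \<psi>)) + sg ((k + 1) * l) (?D (?z r \<chi>))"
  have JN: "?J \<in> NN u" "?J' \<in> NN u" using k u by simp_all
  have J: "hom u ?J ?J'"
  proof (intro hom_add hom_sg)
    show "hom u (?A (h 0)) (?A (?z r \<chi>))"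
      by (rule dual_hom[OF F], rule hom_BB, rule dual_hom[OF G hom_sym[OF hh]]) (use N zN k u in auto)
    show "hom u (?C (g 0)) (?C (?z l \<psi>))"
      by (rule dual_hom[OF H], rule hom_BB, rule dual_hom[OF F hom_sym[OF hg]]) (use N zN k u in auto)
    show "hom u (?D (h 0)) (?D (?z r \<chi>))"
      by (rule dual_hom[OF G], rule hom_BB, rule dual_hom[OF F hom_sym[OF hh]]) (use N zN k u in auto)
  qed
  have J': "\<exists>w\<in>NN (u - 1). hom u (BB (u - 1) w) ?J'"
  proof (cases "0 \<le> k \<and> 0 \<le> l \<and> 0 \<le> r")
    case True
    have B: "hom (p' + 1) (BB p' (?z k' \<phi>')) 0"
      if "hom p' (?z k' \<phi>') (f' 0)" "f' \<in> ncyc p'" "?z k' \<phi>' \<in> NN p'" for p' k' \<phi>' f'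
      using hom_trans[OF hom_BB[OF that(1,3) ncycD(1)[OF that(2)] refl] ncycD(3)[OF that(2)]] .
    have "hom u (BB (u - 1) (capn k \<phi> (q + t - int d) (capn l \<psi> t (?z r \<chi>)))) ?J'"
    proof -
      have d': "q - r = q + t - int d" "p - l = p + q - int d" "p - r = p + t - int d"
        "p + q - int d - r = u - 1" "p + q + 1 - int d - r = u"
        using k u by auto
      have c: "cocyc k \<phi>" "cocyc l \<psi>" "cocyc r \<chi>" using True dual_cocyc F G H by auto
      show ?thesis
        using second_order[OF c \<zeta>_NN bd_\<zeta> BB_\<zeta> _ _ _ refl] B[OF hf f zN(1)] B[OF hg g zN(2)] B[OF hh h zN(3)]
        by (simp only: d d')
    qed
    then show ?thesis using k u by (intro bexI[of _ "capn k \<phi> (q + t - int d) (capn l \<psi> t (?z r \<chi>))"]) auto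
  next
    case False
    then have "?J' = 0" by (auto simp: capn_neg)
    then show ?thesis by (intro bexI[of _ 0]) auto
  qed
  then obtain w where w: "w \<in> NN (u - 1)" "hom u (BB (u - 1) w) ?J'" by blast
  have "hom u ?J (BB (u - 1) w)" using hom_trans[OF J hom_sym[OF w(2)]] .
  then have "coset (ncb v) (const_series (BB u ?J)) = coset (ncb v) (const_series (BB u (BB (u - 1) w)))"
    using JN v by (intro const_series_BB_hom) auto
  also have "\<dots> = coset (ncb v) 0" by (simp add: BB_BB) (simp add: const_series_def zero_fun_def)
  finally show ?thesis by (simp add: coset_eq_iff)
qed

lemma br_Jacobi:
  assumes "X \<in> nc_homology P M p" "Y \<in> nc_homology P M q" "Z \<in> nc_homology P M t"
    and v: "v = p + q + t + 2 - 2 * int d"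
  shows "br p (q + t + 1 - int d) X (br q t Y Z) =
    nc_homology_add P M v (br (p + q + 1 - int d) t (br p q X Y) Z)
      (nc_homology_scale P M v ((-1) powi ((int d - 1 - p) * (int d - 1 - q)))
        (br q (p + t + 1 - int d) Y (br p t X Z)))"
proof -
  obtain f where f: "f \<in> ncyc p" "X = coset (ncb p) f" using assms(1) by (auto simp: nc_homology_ncyc)
  obtain g where g: "g \<in> ncyc q" "Y = coset (ncb q) g" using assms(2) by (auto simp: nc_homology_ncyc)
  obtain h where h: "h \<in> ncyc t" "Z = coset (ncb t) h" using assms(3) by (auto simp: nc_homology_ncyc)
  define k l r where klr: "k = int d - p" "l = int d - q" "r = int d - t"
  define s1 s2 s3 u where s: "s1 = q + t + 1 - int d" "s2 = p + q + 1 - int d" "s3 = p + t + 1 - int d"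
    "u = p + q + t + 1 - 2 * int d"
  obtain \<phi> where F: "dual k \<phi> (f 0)" using ncyc_dual[OF f(1) klr(1)] by blast
  obtain \<psi> where G: "dual l \<psi> (g 0)" using ncyc_dual[OF g(1) klr(2)] by blast
  obtain \<chi> where H: "dual r \<chi> (h 0)" using ncyc_dual[OF h(1) klr(3)] by blast
  have e: "p + s1 - int d = u" "s2 + t - int d = u" "q + s3 - int d = u" "v = u + 1"
    "v = p + s1 + 1 - int d" "v = s2 + t + 1 - int d" "v = q + s3 + 1 - int d" "int d - s2 = k + l - 1"
    using s klr v by auto
  let ?a = "BB (q + t - int d) (capn l \<psi> t (h 0))" and ?b = "BB (p + q - int d) (capn k \<phi> q (g 0))"
    and ?c = "BB (p + t - int d) (capn k \<phi> t (h 0))"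
  let ?A = "capn k \<phi> s1 ?a" and ?C = "capn r \<chi> s2 ?b" and ?D = "capn l \<psi> s3 ?c"
  have N: "?A \<in> NN u" "?C \<in> NN u" "?D \<in> NN u" using s klr by simp_all
  have 1: "br p s1 X (br q t Y Z) = coset (ncb v) (const_series (sg (k + l) (BB u ?A)))"
    unfolding f(2) g(2) h(2) nc_bracket_coset[OF g(1) h(1) G klr(2) s(1)]
      nc_bracket_coset[OF f(1) bracket_ncyc[OF g(1) h(1) G klr(2) s(1)] F klr(1) e(5)]
    by (simp add: e(1) const_series_linear capn_sg BB_sg)
  have 2: "br s2 t (br p q X Y) Z = coset (ncb v) (const_series (sg (l - 1 + (k + l - 1) * r) (BB u ?C)))"
    unfolding f(2) g(2) h(2) nc_bracket_coset[OF f(1) g(1) F klr(1) s(2)]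
      nc_bracket_coset'[OF bracket_ncyc[OF f(1) g(1) F klr(1) s(2)] h(1) H refl klr(3) e(6)] e(8)
    by (simp add: e(2) const_series_linear capn_sg BB_sg)
      (rule arg_cong[of _ _ "\<lambda>x. coset (ncb v) (const_series x)"], auto intro: sg_cong)
  have 3: "br q s3 Y (br p t X Z) = coset (ncb v) (const_series (sg (k + l) (BB u ?D)))"
    unfolding f(2) g(2) h(2) nc_bracket_coset[OF f(1) h(1) F klr(1) s(3)]
      nc_bracket_coset[OF g(1) bracket_ncyc[OF f(1) h(1) F klr(1) s(3)] G klr(2) e(7)]
    by (simp add: e(3) const_series_linear capn_sg BB_sg add.commute[of l k])
  have "const_series (BB u (sg k ?A + sg ((k + l + 1) * r) ?C + sg ((k + 1) * l) ?D)) \<in> ncb v"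
    using br_Jacobi_core[OF f(1) g(1) h(1) F G H klr s(4) e(4)] unfolding s .
  then have J: "nc_scale M ((-1) powi l) (const_series (BB u (sg k ?A + sg ((k + l + 1) * r) ?C + sg ((k + 1) * l) ?D))) \<in> ncb v"
    by (rule ncb_closed)
  have "coset (ncb v) (const_series (sg (k + l) (BB u ?A))) = coset (ncb v)
    (const_series (sg (l - 1 + (k + l - 1) * r) (BB u ?C)) +
      nc_scale M ((-1) powi ((int d - 1 - p) * (int d - 1 - q))) (const_series (sg (k + l) (BB u ?D))))"
  proof -
    have "const_series (sg (k + l) (BB u ?A)) - (const_series (sg (l - 1 + (k + l - 1) * r) (BB u ?C)) +
      nc_scale M ((-1) powi ((int d - 1 - p) * (int d - 1 - q))) (const_series (sg (k + l) (BB u ?D))))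
      = nc_scale M ((-1) powi l) (const_series (BB u (sg k ?A + sg ((k + l + 1) * r) ?C + sg ((k + 1) * l) ?D)))"
    proof -
      have kl: "int d - 1 - p = k - 1" "int d - 1 - q = l - 1" using klr by auto
      show ?thesis
        unfolding kl const_series_linear[symmetric] N.scale_sign_powi
        using N by (intro arg_cong[of _ _ const_series])
          (cases "even k"; cases "even l"; cases "even r"; simp add: sg_def BB_add BB_minus BB_diff)
    qed
    then show ?thesis using J by (simp add: coset_eq_iff)
  qed
  then show ?thesis
    unfolding s(1-3)[symmetric] 1 2 3 nc_homology_scale_coset nc_homology_add_coset .
qed

theorem graded_Lie_bracket_nc_homology:
  "graded_Lie_bracket
    (\<lambda>m. nc_homology P M (int d - 1 - m))
    (\<lambda>m. nc_homology_add P M (int d - 1 - m))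
    (\<lambda>m. nc_homology_scale P M (int d - 1 - m))
    (\<lambda>m n. br (int d - 1 - m) (int d - 1 - n))"
  unfolding graded_Lie_bracket_def
proof (intro conjI allI ballI)
  fix m n k :: int and c :: 'k and X X' Y Y' Z
  assume X: "X \<in> nc_homology P M (int d - 1 - m)" and Y: "Y \<in> nc_homology P M (int d - 1 - n)"
  have e: "int d - 1 - (i + j) = int d - 1 - i + (int d - 1 - j) + 1 - int d" for i j by simp
  show "br (int d - 1 - m) (int d - 1 - n) X Y \<in> nc_homology P M (int d - 1 - (m + n))"
    by (rule br_in[OF X Y e])
  show "br (int d - 1 - m) (int d - 1 - n) (nc_homology_scale P M (int d - 1 - m) c X) Y =
      nc_homology_scale P M (int d - 1 - (m + n)) c (br (int d - 1 - m) (int d - 1 - n) X Y)"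
    by (rule br_left_linear(2)[OF X X Y e])
  show "br (int d - 1 - m) (int d - 1 - n) X (nc_homology_scale P M (int d - 1 - n) c Y) =
      nc_homology_scale P M (int d - 1 - (m + n)) c (br (int d - 1 - m) (int d - 1 - n) X Y)"
    by (rule br_right_linear(2)[OF X Y Y e])
  show "br (int d - 1 - m) (int d - 1 - n) X Y = nc_homology_scale P M (int d - 1 - (m + n))
      (- ((-1) powi (m * n))) (br (int d - 1 - n) (int d - 1 - m) Y X)"
    using br_antisym[OF X Y e] by simp
  show "br (int d - 1 - m) (int d - 1 - n) (nc_homology_add P M (int d - 1 - m) X X') Y =
      nc_homology_add P M (int d - 1 - (m + n)) (br (int d - 1 - m) (int d - 1 - n) X Y)
        (br (int d - 1 - m) (int d - 1 - n) X' Y)"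
    if X': "X' \<in> nc_homology P M (int d - 1 - m)"
    by (rule br_left_linear(1)[OF X X' Y e])
  show "br (int d - 1 - m) (int d - 1 - n) X (nc_homology_add P M (int d - 1 - n) Y Y') =
      nc_homology_add P M (int d - 1 - (m + n)) (br (int d - 1 - m) (int d - 1 - n) X Y)
        (br (int d - 1 - m) (int d - 1 - n) X Y')"
    if Y': "Y' \<in> nc_homology P M (int d - 1 - n)"
    by (rule br_right_linear(1)[OF X Y Y' e])
  show "br (int d - 1 - m) (int d - 1 - (n + k)) X (br (int d - 1 - n) (int d - 1 - k) Y Z) =
      nc_homology_add P M (int d - 1 - (m + n + k))
        (br (int d - 1 - (m + n)) (int d - 1 - k) (br (int d - 1 - m) (int d - 1 - n) X Y) Z)
        (nc_homology_scale P M (int d - 1 - (m + n + k)) ((-1) powi (m * n))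
          (br (int d - 1 - n) (int d - 1 - (m + k)) Y (br (int d - 1 - m) (int d - 1 - k) X Z)))"
    if Z: "Z \<in> nc_homology P M (int d - 1 - k)"
  proof -
    have v: "int d - 1 - (m + n + k) = int d - 1 - m + (int d - 1 - n) + (int d - 1 - k) + 2 - 2 * int d"
      by simp
    have "int d - 1 - (int d - 1 - i) = i" for i by simp
    then show ?thesis
      using br_Jacobi[OF X Y Z v] unfolding e[symmetric] by simp
  qed
qed

end

theorem corollaryC:
  fixes \<O> :: "('k::field_char_0, 'o::ab_group_add) operad_mult"
    and \<N> :: "('k, 'o, 'n::ab_group_add) opmod"
    and d :: nat and \<zeta> :: 'n
  assumes "operad_with_multiplication \<O>"
    and "cyclic_opposite_module \<O> \<N>"
    and "\<zeta> \<in> nspace \<N> d" and "bdiff \<O> \<N> d \<zeta> = 0"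
    and "\<And>p::int. bij_betw (duality \<O> \<N> d \<zeta> p) (ocohomology \<O> (int d - p)) (nhomology \<O> \<N> p)"
  shows "graded_Lie_bracket
    (\<lambda>m. nc_homology \<O> \<N> (int d - 1 - m))
    (\<lambda>m. nc_homology_add \<O> \<N> (int d - 1 - m))
    (\<lambda>m. nc_homology_scale \<O> \<N> (int d - 1 - m))
    (\<lambda>m n. nc_bracket \<O> \<N> d \<zeta> (int d - 1 - m) (int d - 1 - n))"
proof -
  interpret operad_with_multiplication \<O> by (rule assms(1))
  interpret cyclic_opposite_module \<O> \<N> by (rule assms(2))
  interpret dual_operad_calculus \<O> \<N> d \<zeta>
    by unfold_locales (use assms(3-5) in auto)
  show ?thesis by (rule graded_Lie_bracket_nc_homology)
qed

end
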